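(* For every $0<c<1$, the pair $(X_c,X_c)$ has the compact perturbation property but does not have the weak maximizing property. In particular, the compact perturbation property does not imply the weak maximizing property even for pairs $(E,E)$ with $E$ a reflexive space isomorphic to $\ell_2$, and the counterexamples may be chosen arbitrarily close to $\ell_2$ in Banach--Mazur distance: for every $\varepsilon>0$ there is a real reflexive Banach space $E$ isomorphic to $\ell_2$ with $d_{\mathrm{BM}}(E,\ell_2)<1+\varepsilon$ such that $(E,E)$ has the compact perturbation property but not the weak maximizing property.
   Context: All Banach spaces are real. $\mathcal L(E,F)$ and $\mathcal K(E,F)$ denote the bounded and the compact linear operators from $E$ to $F$; $S_E$ is the unit sphere of $E$. An operator $T\in\mathcal L(E,F)$ attains its norm if $\|Tx\|=\|T\|$ for some $x\in S_E$. A sequence $(x_n)\subset S_E$ is a maximizing sequence for $T$ if $\|Tx_n\|\to\|T\|$. A pair $(E,F)$ has the weak maximizing property (WMP) if every $T\in\mathcal L(E,F)$ which admits a maximizing sequence that is not weakly null attains its norm. A pair $(E,F)$ has the compact perturbation property (CPP) if for every $T\in\mathcal L(E,F)$ and $K\in\mathcal K(E,F)$, $\|T+K\|>\|T\|$ implies that $T+K$ attains its norm. The Banach--Mazur distance is $d_{\mathrm{BM}}(E,F)=\inf\{\|U\|\,\|U^{-1}\|: U:E\to F\text{ is an isomorphism}\}$. Definition of $X_c$. A norm $N$ on $\mathbb R^2$ is absolute if $N(s,t)=N(|s|,|t|)$ and normalized if $N(1,0)=N(0,1)=1$. Given a sequence $(N_n)_{n\ge1}$ of absolute normalized norms on $\mathbb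 R^2$, define norms $M_n$ on $\mathbb R^{n+1}$ by $M_0(x_0)=|x_0|$ and $M_n(x_0,\dots,x_n)=N_n(M_{n-1}(x_0,\dots,x_{n-1}),|x_n|)$ for $n\ge1$. For a finitely supported real sequence $x=(x_j)_{j\ge0}\in c_{00}$ put $\|x\|=M_n(x_0,\dots,x_n)$ for any $n$ with $x_j=0$ for all $j>n$ (this is independent of $n$). $A(N_n)$ denotes the completion of $c_{00}$ in this norm, with canonical basis $(e_j)_{j\ge0}$. For $0<c<1$ and $n\ge1$ let $$N_{n,c}(s,t)=\left[(1-c^{2n})|t|^{2n}+(s^2+c^2t^2)^n\right]^{1/(2n)},$$ which is an absolute normalized norm on $\mathbb R^2$, and set $X_c:=A(N_{n,c})$. *)

theory Defs
  imports "HOL-Analysis.Analysis" "HOL-Library.Function_Algebras"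
begin

section \<open>Pointwise real vector space structure on function types\<close>

instantiation "fun" :: (type, real_vector) real_vector
begin

definition scaleR_fun :: "real \<Rightarrow> ('a \<Rightarrow> 'b) \<Rightarrow> 'a \<Rightarrow> 'b"
  where "scaleR_fun a f = (\<lambda>x. a *\<^sub>R f x)"

instance
  by standard (simp_all add: scaleR_fun_def fun_eq_iff algebra_simps)

end

lemma scaleR_fun_apply [simp]: "(a *\<^sub>R f) x = a *\<^sub>R f x"
  for f :: "'a \<Rightarrow> 'b::real_vector"
  by (simp add: scaleR_fun_def)

section \<open>Normed spaces with explicit carrier\<close>

text \<open>
  The spaces in question depend on real parameters and are quantified over existentially, so they
  are values rather than types: a linear subspace \<open>vecs E\<close> of an ambient real vector space, with a
  norm \<open>nm E\<close> that is only meaningful on \<open>vecs E\<close>.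
\<close>

record 'a nspace =
  vecs :: "'a set"
  nm :: "'a \<Rightarrow> real"

definition normed_space :: "'a::real_vector nspace \<Rightarrow> bool" where
  "normed_space E \<longleftrightarrow>
     subspace (vecs E) \<and>
     (\<forall>x\<in>vecs E. 0 \<le> nm E x) \<and>
     (\<forall>x\<in>vecs E. nm E x = 0 \<longleftrightarrow> x = 0) \<and>
     (\<forall>a. \<forall>x\<in>vecs E. nm E (a *\<^sub>R x) = \<bar>a\<bar> * nm E x) \<and>
     (\<forall>x\<in>vecs E. \<forall>y\<in>vecs E. nm E (x + y) \<le> nm E x + nm E y)"

definition cauchy_in :: "'a::real_vector nspace \<Rightarrow> (nat \<Rightarrow> 'a) \<Rightarrow> bool" where
  "cauchy_in E s \<longleftrightarrow> (\<forall>e>0. \<exists>K. \<forall>m\<ge>K. \<forall>n\<ge>K. nm E (s m - s n) < e)"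

definition converges_in :: "'a::real_vector nspace \<Rightarrow> (nat \<Rightarrow> 'a) \<Rightarrow> 'a \<Rightarrow> bool" where
  "converges_in E s l \<longleftrightarrow> (\<lambda>n. nm E (s n - l)) \<longlonglongrightarrow> 0"

definition banach_space :: "'a::real_vector nspace \<Rightarrow> bool" where
  "banach_space E \<longleftrightarrow> normed_space E \<and>
     (\<forall>s. (\<forall>n. s n \<in> vecs E) \<and> cauchy_in E s \<longrightarrow> (\<exists>l\<in>vecs E. converges_in E s l))"

definition sphere_of :: "'a nspace \<Rightarrow> 'a set" where
  "sphere_of E = {x \<in> vecs E. nm E x = 1}"

definition ball_of :: "'a nspace \<Rightarrow> 'a set" where
  "ball_of E = {x \<in> vecs E. nm E x \<le> 1}"

definition real_line :: "real nspace" where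
  "real_line = \<lparr>vecs = UNIV, nm = abs\<rparr>"

section \<open>Operators\<close>

text \<open>
  Operators are functions on the ambient type of which only the restriction to \<open>vecs E\<close> matters.
\<close>

definition bounded_op ::
  "'a::real_vector nspace \<Rightarrow> 'b::real_vector nspace \<Rightarrow> ('a \<Rightarrow> 'b) \<Rightarrow> bool" where
  "bounded_op E F T \<longleftrightarrow>
     (\<forall>x\<in>vecs E. T x \<in> vecs F) \<and>
     (\<forall>x\<in>vecs E. \<forall>y\<in>vecs E. T (x + y) = T x + T y) \<and>
     (\<forall>a. \<forall>x\<in>vecs E. T (a *\<^sub>R x) = a *\<^sub>R T x) \<and>
     (\<exists>B. \<forall>x\<in>vecs E. nm F (T x) \<le> B * nm E x)"

definition opnorm :: "'a nspace \<Rightarrow> 'b nspace \<Rightarrow> ('a \<Rightarrow> 'b) \<Rightarrow> real" where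
  "opnorm E F T = (SUP x\<in>ball_of E. nm F (T x))"

definition compact_op ::
  "'a::real_vector nspace \<Rightarrow> 'b::real_vector nspace \<Rightarrow> ('a \<Rightarrow> 'b) \<Rightarrow> bool" where
  "compact_op E F K \<longleftrightarrow> bounded_op E F K \<and>
     (\<forall>s. (\<forall>n. s n \<in> ball_of E) \<longrightarrow>
        (\<exists>r y. strict_mono (r :: nat \<Rightarrow> nat) \<and> y \<in> vecs F \<and>
               converges_in F (\<lambda>n. K (s (r n))) y))"

definition attains_norm :: "'a nspace \<Rightarrow> 'b nspace \<Rightarrow> ('a \<Rightarrow> 'b) \<Rightarrow> bool" where
  "attains_norm E F T \<longleftrightarrow> (\<exists>x\<in>sphere_of E. nm F (T x) = opnorm E F T)"

text \<open>
  Functionals are extended by \<open>0\<close> outside \<open>vecs E\<close>, so that distinct elements of the dual differ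
  somewhere on \<open>vecs E\<close>.
\<close>

definition dual :: "'a::real_vector nspace \<Rightarrow> ('a \<Rightarrow> real) nspace" where
  "dual E = \<lparr>vecs = {f. bounded_op E real_line f \<and> (\<forall>x. x \<notin> vecs E \<longrightarrow> f x = 0)},
             nm = opnorm E real_line\<rparr>"

definition weakly_null :: "'a::real_vector nspace \<Rightarrow> (nat \<Rightarrow> 'a) \<Rightarrow> bool" where
  "weakly_null E s \<longleftrightarrow> (\<forall>f\<in>vecs (dual E). (\<lambda>n. f (s n)) \<longlonglongrightarrow> 0)"

definition reflexive :: "'a::real_vector nspace \<Rightarrow> bool" where
  "reflexive E \<longleftrightarrow>
     (\<forall>\<phi>. bounded_op (dual E) real_line \<phi> \<longrightarrow>
        (\<exists>x\<in>vecs E. \<forall>f\<in>vecs (dual E). \<phi> f = f x))"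

definition isomorphism ::
  "'a::real_vector nspace \<Rightarrow> 'b::real_vector nspace \<Rightarrow> ('a \<Rightarrow> 'b) \<Rightarrow> bool" where
  "isomorphism E F U \<longleftrightarrow>
     bounded_op E F U \<and> bij_betw U (vecs E) (vecs F) \<and> bounded_op F E (inv_into (vecs E) U)"

definition isomorphic :: "'a::real_vector nspace \<Rightarrow> 'b::real_vector nspace \<Rightarrow> bool" where
  "isomorphic E F \<longleftrightarrow> (\<exists>U. isomorphism E F U)"

text \<open>Extended real valued, hence \<open>\<infinity>\<close> for spaces that are not isomorphic.\<close>

definition banach_mazur :: "'a::real_vector nspace \<Rightarrow> 'b::real_vector nspace \<Rightarrow> ereal" where
  "banach_mazur E F =
     (INF U\<in>{U. isomorphism E F U}. ereal (opnorm E F U * opnorm F E (inv_into (vecs E) U)))"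

section \<open>The two properties\<close>

definition maximizing :: "'a nspace \<Rightarrow> 'b nspace \<Rightarrow> ('a \<Rightarrow> 'b) \<Rightarrow> (nat \<Rightarrow> 'a) \<Rightarrow> bool" where
  "maximizing E F T s \<longleftrightarrow>
     (\<forall>n. s n \<in> sphere_of E) \<and> (\<lambda>n. nm F (T (s n))) \<longlonglongrightarrow> opnorm E F T"

definition WMP :: "'a::real_vector nspace \<Rightarrow> 'b::real_vector nspace \<Rightarrow> bool" where
  "WMP E F \<longleftrightarrow>
     (\<forall>T. bounded_op E F T \<and> (\<exists>s. maximizing E F T s \<and> \<not> weakly_null E s) \<longrightarrow>
        attains_norm E F T)"

definition CPP :: "'a::real_vector nspace \<Rightarrow> 'b::real_vector nspace \<Rightarrow> bool" where
  "CPP E F \<longleftrightarrow>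
     (\<forall>T K. bounded_op E F T \<and> compact_op E F K \<and>
        opnorm E F (\<lambda>x. T x + K x) > opnorm E F T \<longrightarrow>
        attains_norm E F (\<lambda>x. T x + K x))"

section \<open>The space \<open>\<ell>\<^sub>2\<close>\<close>

definition ell2 :: "(nat \<Rightarrow> real) nspace" where
  "ell2 = \<lparr>vecs = {x. summable (\<lambda>j. (x j)\<^sup>2)}, nm = (\<lambda>x. sqrt (\<Sum>j. (x j)\<^sup>2))\<rparr>"

section \<open>The spaces \<open>A(N\<^sub>n)\<close> and \<open>X\<^sub>c\<close>\<close>

definition abs_normalized_norm :: "(real \<Rightarrow> real \<Rightarrow> real) \<Rightarrow> bool" where
  "abs_normalized_norm P \<longleftrightarrow>
     (\<forall>s t. 0 \<le> P s t) \<and>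
     (\<forall>s t. P s t = 0 \<longleftrightarrow> s = 0 \<and> t = 0) \<and>
     (\<forall>a s t. P (a * s) (a * t) = \<bar>a\<bar> * P s t) \<and>
     (\<forall>s t s' t'. P (s + s') (t + t') \<le> P s t + P s' t') \<and>
     (\<forall>s t. P s t = P \<bar>s\<bar> \<bar>t\<bar>) \<and>
     P 1 0 = 1 \<and> P 0 1 = 1"

text \<open>\<open>iter_norm N n x\<close> is \<open>M\<^sub>n(x\<^sub>0,\<dots>,x\<^sub>n)\<close>.\<close>

primrec iter_norm :: "(nat \<Rightarrow> real \<Rightarrow> real \<Rightarrow> real) \<Rightarrow> nat \<Rightarrow> (nat \<Rightarrow> real) \<Rightarrow> real" where
  "iter_norm N 0 x = \<bar>x 0\<bar>"
| "iter_norm N (Suc n) x = N (Suc n) (iter_norm N n x) \<bar>x (Suc n)\<bar>"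

definition c00_space :: "(nat \<Rightarrow> real \<Rightarrow> real \<Rightarrow> real) \<Rightarrow> (nat \<Rightarrow> real) nspace" where
  "c00_space N = \<lparr>vecs = {x. finite {j. x j \<noteq> 0}},
                  nm = (\<lambda>x. iter_norm N (LEAST n. \<forall>j>n. x j = 0) x)\<rparr>"

definition trunc :: "nat \<Rightarrow> (nat \<Rightarrow> real) \<Rightarrow> nat \<Rightarrow> real" where
  "trunc n x = (\<lambda>j. if j \<le> n then x j else 0)"

text \<open>
  The completion of \<open>c\<^sub>0\<^sub>0\<close>, realized concretely as the sequences whose truncations are Cauchy in
  \<open>c\<^sub>0\<^sub>0\<close>, with the limit of the norms of the truncations as norm. That this is the completion
  is \<open>A_space_completion\<close> below.
\<close>

definition A_space :: "(nat \<Rightarrow> real \<Rightarrow> real \<Rightarrow> real) \<Rightarrow> (nat \<Rightarrow> real) nspace" where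
  "A_space N = \<lparr>vecs = {x. cauchy_in (c00_space N) (\<lambda>n. trunc n x)},
                nm = (\<lambda>x. lim (\<lambda>n. nm (c00_space N) (trunc n x)))\<rparr>"

definition Nc :: "real \<Rightarrow> nat \<Rightarrow> real \<Rightarrow> real \<Rightarrow> real" where
  "Nc c n s t =
     root (2 * n) ((1 - c ^ (2 * n)) * \<bar>t\<bar> ^ (2 * n) + (s\<^sup>2 + c\<^sup>2 * t\<^sup>2) ^ n)"

definition X_space :: "real \<Rightarrow> (nat \<Rightarrow> real) nspace" where
  "X_space c = A_space (Nc c)"

definition completion_of :: "'a::real_vector nspace \<Rightarrow> 'a nspace \<Rightarrow> bool" where
  "completion_of E D \<longleftrightarrow>
     normed_space D \<and> banach_space E \<and> vecs D \<subseteq> vecs E \<and> (\<forall>x\<in>vecs D. nm E x = nm D x) \<and>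
     (\<forall>x\<in>vecs E. \<forall>e>0. \<exists>y\<in>vecs D. nm E (x - y) < e)"

section \<open>\<open>X\<^sub>c\<close> is the completion of \<open>c\<^sub>0\<^sub>0\<close>\<close>

lemma abs_normalized_normD:
  assumes "abs_normalized_norm P"
  shows "0 \<le> P s t" "P s t = 0 \<longleftrightarrow> s = 0 \<and> t = 0" "P (a * s) (a * t) = \<bar>a\<bar> * P s t"
    "P (s + s') (t + t') \<le> P s t + P s' t'" "P s t = P \<bar>s\<bar> \<bar>t\<bar>" "P 1 0 = 1" "P 0 1 = 1"
  using assms unfolding abs_normalized_norm_def by blast+

lemma abs_normalized_norm_axes:
  assumes "abs_normalized_norm P"
  shows "P s 0 = \<bar>s\<bar>" "P 0 t = \<bar>t\<bar>"
  using abs_normalized_normD(3)[OF assms, of s 1 0] abs_normalized_normD(3)[OF assms, of t 0 1]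
    abs_normalized_normD(6,7)[OF assms] by simp_all

lemma abs_normalized_norm_mono_left:
  assumes P: "abs_normalized_norm P" and "\<bar>s\<bar> \<le> \<bar>s'\<bar>"
  shows "P s t \<le> P s' t"
proof (cases "s' = 0")
  case True
  with assms show ?thesis by simp
next
  case False
  define l where "l = (1 + s / s') / 2"
  have "\<bar>s / s'\<bar> \<le> 1"
    using assms False by (simp add: field_simps)
  then have l: "0 \<le> l" "l \<le> 1"
    unfolding l_def abs_le_iff by simp_all
  have s: "s = l * s' + (1 - l) * (- s')"
    using False by (simp add: l_def field_simps)
  have "P s t = P (l * s' + (1 - l) * (- s')) (l * t + (1 - l) * t)"
    by (rule arg_cong2[OF s]) (simp add: algebra_simps)
  also have "\<dots> \<le> P (l * s') (l * t) + P ((1 - l) * (- s')) ((1 - l) * t)"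
    by (rule abs_normalized_normD(4)[OF P])
  also have "\<dots> = l * P s' t + (1 - l) * P (- s') t"
    using l by (simp only: abs_normalized_normD(3)[OF P] abs_of_nonneg)
  also have "P (- s') t = P s' t"
    using abs_normalized_normD(5)[OF P, of "- s'" t] abs_normalized_normD(5)[OF P, of s' t] by simp
  finally show ?thesis by (simp add: algebra_simps)
qed

lemma abs_normalized_norm_mono:
  assumes P: "abs_normalized_norm P" and "\<bar>s\<bar> \<le> \<bar>s'\<bar>" "\<bar>t\<bar> \<le> \<bar>t'\<bar>"
  shows "P s t \<le> P s' t'"
proof -
  have "abs_normalized_norm (\<lambda>s t. P t s)"
    using P unfolding abs_normalized_norm_def by blast
  from abs_normalized_norm_mono_left[OF this assms(3)]
  have "P s' t \<le> P s' t'" .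
  with abs_normalized_norm_mono_left[OF P assms(2)] show ?thesis
    by (rule order_trans)
qed

context
  fixes N :: "nat \<Rightarrow> real \<Rightarrow> real \<Rightarrow> real"
  assumes N: "\<forall>n\<ge>1. abs_normalized_norm (N n)"
begin

private lemma NS: "abs_normalized_norm (N (Suc n))"
  using N by simp

private lemma it_nonneg: "0 \<le> iter_norm N n x"
  by (cases n) (simp_all add: abs_normalized_normD(1)[OF NS])

private lemma it_scale: "iter_norm N n (a *\<^sub>R x) = \<bar>a\<bar> * iter_norm N n x"
proof (induction n)
  case (Suc n)
  then show ?case
    using abs_normalized_normD(3)[OF NS, of n "\<bar>a\<bar>" "iter_norm N n x" "\<bar>x (Suc n)\<bar>"]
    by (simp add: abs_mult)
qed (simp add: abs_mult)

private lemma it_add: "iter_norm N n (x + y) \<le> iter_norm N n x + iter_norm N n y"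
proof (induction n)
  case (Suc n)
  have "iter_norm N (Suc n) (x + y) \<le>
      N (Suc n) (iter_norm N n x + iter_norm N n y) (\<bar>x (Suc n)\<bar> + \<bar>y (Suc n)\<bar>)"
    unfolding iter_norm.simps
    using Suc it_nonneg[of n x] it_nonneg[of n y] it_nonneg[of n "x + y"]
    by (intro abs_normalized_norm_mono[OF NS]) (unfold plus_fun_apply, linarith+)
  also have "\<dots> \<le> iter_norm N (Suc n) x + iter_norm N (Suc n) y"
    using abs_normalized_normD(4)[OF NS] by simp
  finally show ?case .
qed (simp add: abs_triangle_ineq)

private lemma it_mono_abs: "(\<And>j. j \<le> n \<Longrightarrow> \<bar>x j\<bar> \<le> \<bar>y j\<bar>) \<Longrightarrow> iter_norm N n x \<le> iter_norm N n y"
proof (induction n)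
  case (Suc n)
  then show ?case
    using it_nonneg[of n] by (simp, intro abs_normalized_norm_mono[OF NS]) auto
qed simp

private lemma it_cong: "(\<And>j. j \<le> n \<Longrightarrow> x j = y j) \<Longrightarrow> iter_norm N n x = iter_norm N n y"
  by (intro antisym it_mono_abs) auto

private lemma it_Suc: "iter_norm N n x \<le> iter_norm N (Suc n) x"
proof -
  have "iter_norm N n x = N (Suc n) (iter_norm N n x) 0"
    using abs_normalized_norm_axes(1)[OF NS, of n] it_nonneg[of n x] by simp
  also have "\<dots> \<le> N (Suc n) (iter_norm N n x) \<bar>x (Suc n)\<bar>"
    by (intro abs_normalized_norm_mono[OF NS]) auto
  finally show ?thesis by simp
qed

private lemma it_mono: "m \<le> n \<Longrightarrow> iter_norm N m x \<le> iter_norm N n x"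
  by (rule lift_Suc_mono_le[of "\<lambda>n. iter_norm N n x"]) (use it_Suc in auto)

private lemma it_coord: "j \<le> n \<Longrightarrow> \<bar>x j\<bar> \<le> iter_norm N n x"
proof -
  assume "j \<le> n"
  have "\<bar>x j\<bar> \<le> iter_norm N j x"
  proof (cases j)
    case (Suc k)
    have "\<bar>x j\<bar> = N (Suc k) 0 \<bar>x (Suc k)\<bar>"
      using abs_normalized_norm_axes(2)[OF NS, of k] Suc by simp
    also have "\<dots> \<le> N (Suc k) (iter_norm N k x) \<bar>x (Suc k)\<bar>"
      by (intro abs_normalized_norm_mono[OF NS]) auto
    finally show ?thesis using Suc by simp
  qed simp
  with it_mono[OF \<open>j \<le> n\<close>, of x] show ?thesis by linarith
qed

private lemma it_sum: "iter_norm N n x \<le> (\<Sum>j\<le>n. \<bar>x j\<bar>)"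
proof (induction n)
  case (Suc n)
  have "iter_norm N (Suc n) x \<le> N (Suc n) (iter_norm N n x) 0 + N (Suc n) 0 \<bar>x (Suc n)\<bar>"
    using abs_normalized_normD(4)[OF NS, of n "iter_norm N n x" 0 0 "\<bar>x (Suc n)\<bar>"] by simp
  also have "\<dots> = iter_norm N n x + \<bar>x (Suc n)\<bar>"
    using it_nonneg[of n x] by (simp add: abs_normalized_norm_axes[OF NS])
  finally show ?case using Suc by simp
qed simp

private lemma it_stable: "m \<le> n \<Longrightarrow> (\<And>j. m < j \<Longrightarrow> x j = 0) \<Longrightarrow> iter_norm N n x = iter_norm N m x"
proof (induction n rule: dec_induct)
  case (step n)
  then show ?case
    using it_nonneg[of n x] by (simp add: abs_normalized_norm_axes[OF NS])
qed simp

lemma c00_norm_eq: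
  assumes "\<forall>j>n. x j = 0"
  shows "nm (c00_space N) x = iter_norm N n x"
proof -
  let ?k = "LEAST n. \<forall>j>n. x j = 0"
  have k: "\<forall>j>?k. x j = 0" by (rule LeastI) (rule assms)
  have "?k \<le> n" by (rule Least_le) (rule assms)
  then have "iter_norm N n x = iter_norm N ?k x"
    by (rule it_stable) (rule k[rule_format])
  then show ?thesis unfolding c00_space_def nspace.simps by (rule sym)
qed

private lemma c00_vecsD:
  assumes "x \<in> vecs (c00_space N)"
  shows "\<exists>n. \<forall>j>n. x j = 0"
proof -
  have "finite {j. x j \<noteq> 0}" using assms by (simp add: c00_space_def)
  then obtain n where n: "\<forall>j\<in>{j. x j \<noteq> 0}. j \<le> n"
    unfolding finite_nat_set_iff_bounded_le by (rule exE)
  have "x j = 0" if "n < j" for j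
  proof (rule ccontr)
    assume "x j \<noteq> 0"
    then have "j \<le> n" using n by simp
    with that show False by simp
  qed
  then show ?thesis by (intro exI[of _ n]) simp
qed

private lemma c00_vecsI: "\<forall>j>n. x j = 0 \<Longrightarrow> x \<in> vecs (c00_space N)"
proof -
  assume "\<forall>j>n. x j = 0"
  then have "{j. x j \<noteq> 0} \<subseteq> {..n}" using not_less by blast
  then show ?thesis by (auto simp: c00_space_def intro: finite_subset)
qed

lemma normed_space_c00: "normed_space (c00_space N)"
proof -
  have 1: "subspace (vecs (c00_space N))"
    unfolding subspace_def
  proof safe
    show "0 \<in> vecs (c00_space N)" by (rule c00_vecsI[of 0]) simp
  next
    fix x y assume "x \<in> vecs (c00_space N)" "y \<in> vecs (c00_space N)"
    then obtain m n where "\<forall>j>m. x j = 0" "\<forall>j>n. y j = 0" by (blast dest: c00_vecsD)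
    then show "x + y \<in> vecs (c00_space N)" by (intro c00_vecsI[of "max m n"]) auto
  next
    fix a :: real and x assume "x \<in> vecs (c00_space N)"
    then obtain m where "\<forall>j>m. x j = 0" by (blast dest: c00_vecsD)
    then show "a *\<^sub>R x \<in> vecs (c00_space N)" by (intro c00_vecsI[of "m"]) auto
  qed
  have 2: "0 \<le> nm (c00_space N) x \<and> (nm (c00_space N) x = 0 \<longleftrightarrow> x = 0) \<and>
      (\<forall>a. nm (c00_space N) (a *\<^sub>R x) = \<bar>a\<bar> * nm (c00_space N) x)"
    if "x \<in> vecs (c00_space N)" for x
  proof -
    obtain n where n: "\<forall>j>n. x j = 0" using \<open>x \<in> _\<close> by (blast dest: c00_vecsD)
    have eq: "nm (c00_space N) x = iter_norm N n x" by (rule c00_norm_eq[OF n])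
    have "x = 0" if "iter_norm N n x = 0"
    proof (rule ext)
      fix j show "x j = 0 j" using n it_coord[of j n x] that by (cases "j \<le> n") auto
    qed
    moreover have "iter_norm N n x = 0" if "x = 0"
      using it_sum[of n x] it_nonneg[of n x] that by simp
    moreover have "nm (c00_space N) (a *\<^sub>R x) = \<bar>a\<bar> * iter_norm N n x" for a
      using n by (subst c00_norm_eq[of n]) (auto simp: it_scale)
    ultimately show ?thesis using eq it_nonneg by metis
  qed
  have 3: "nm (c00_space N) (x + y) \<le> nm (c00_space N) x + nm (c00_space N) y"
    if xy: "x \<in> vecs (c00_space N)" "y \<in> vecs (c00_space N)" for x y
  proof -
    obtain m n where mn: "\<forall>j>m. x j = 0" "\<forall>j>n. y j = 0" using xy[THEN c00_vecsD] by blast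
    let ?k = "max m n"
    have "nm (c00_space N) x = iter_norm N ?k x" "nm (c00_space N) y = iter_norm N ?k y"
      "nm (c00_space N) (x + y) = iter_norm N ?k (x + y)"
      using mn by (auto intro!: c00_norm_eq)
    then show ?thesis using it_add by simp
  qed
  show ?thesis unfolding normed_space_def using 1 2 3 by blast
qed

private lemma nm_trunc: "nm (c00_space N) (trunc n x) = iter_norm N n x"
proof -
  have "nm (c00_space N) (trunc n x) = iter_norm N n (trunc n x)"
    by (rule c00_norm_eq) (simp add: trunc_def)
  also have "\<dots> = iter_norm N n x" by (rule it_cong) (simp add: trunc_def)
  finally show ?thesis .
qed

private lemma nm_trunc_diff:
  assumes "m \<le> n"
  shows "nm (c00_space N) (trunc n x - trunc m x) = iter_norm N n (x - trunc m x)"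
    "nm (c00_space N) (trunc m x - trunc n x) = iter_norm N n (x - trunc m x)"
proof -
  have *: "nm (c00_space N) z = iter_norm N n z" if "\<forall>j>n. z j = 0" for z
    using that by (rule c00_norm_eq)
  have "nm (c00_space N) (trunc n x - trunc m x) = iter_norm N n (trunc n x - trunc m x)"
    using assms by (intro *) (auto simp: trunc_def)
  also have "\<dots> = iter_norm N n (x - trunc m x)" by (rule it_cong) (simp add: trunc_def)
  finally show "nm (c00_space N) (trunc n x - trunc m x) = iter_norm N n (x - trunc m x)" .
  have "nm (c00_space N) (trunc m x - trunc n x) = iter_norm N n (trunc m x - trunc n x)"
    using assms by (intro *) (auto simp: trunc_def)
  also have "\<dots> = iter_norm N n (x - trunc m x)"
    by (intro antisym it_mono_abs) (simp_all add: trunc_def)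
  finally show "nm (c00_space N) (trunc m x - trunc n x) = iter_norm N n (x - trunc m x)" .
qed

private lemma A_iff:
  "x \<in> vecs (A_space N) \<longleftrightarrow> (\<forall>e>0. \<exists>K. \<forall>n. iter_norm N n (x - trunc K x) \<le> e)"
  (is "_ \<longleftrightarrow> ?R")
proof
  assume "x \<in> vecs (A_space N)"
  then have C: "cauchy_in (c00_space N) (\<lambda>n. trunc n x)" by (simp add: A_space_def)
  show ?R
  proof safe
    fix e :: real assume "0 < e"
    then obtain K where K: "\<forall>m\<ge>K. \<forall>n\<ge>K. nm (c00_space N) (trunc m x - trunc n x) < e"
      using C unfolding cauchy_in_def by blast
    have "iter_norm N n (x - trunc K x) \<le> e" for n
    proof -
      have "iter_norm N n (x - trunc K x) \<le> iter_norm N (max K n) (x - trunc K x)"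
        by (rule it_mono) simp
      also have "\<dots> = nm (c00_space N) (trunc (max K n) x - trunc K x)"
        by (rule nm_trunc_diff(1)[symmetric]) simp
      also have "\<dots> < e" by (rule K[rule_format]) simp_all
      finally show ?thesis by simp
    qed
    then show "\<exists>K. \<forall>n. iter_norm N n (x - trunc K x) \<le> e" by blast
  qed
next
  assume R: ?R
  have "cauchy_in (c00_space N) (\<lambda>n. trunc n x)"
    unfolding cauchy_in_def
  proof safe
    fix e :: real assume "0 < e"
    then obtain K where K: "\<And>n. iter_norm N n (x - trunc K x) \<le> e / 2"
      using R[rule_format, of "e / 2"] by auto
    have tail: "iter_norm N n (x - trunc m x) < e" if "m \<ge> K" for m n
    proof -
      have "iter_norm N n (x - trunc m x) \<le> iter_norm N n (x - trunc K x)"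
        using that by (intro it_mono_abs) (auto simp: trunc_def)
      with K[of n] \<open>0 < e\<close> show ?thesis by linarith
    qed
    have "nm (c00_space N) (trunc m x - trunc n x) < e" if "m \<ge> K" "n \<ge> K" for m n
    proof (cases "m \<le> n")
      case True
      then show ?thesis unfolding nm_trunc_diff(2)[OF True] using that by (intro tail)
    next
      case False
      then have "n \<le> m" by simp
      then show ?thesis unfolding nm_trunc_diff(1)[OF \<open>n \<le> m\<close>] using that by (intro tail)
    qed
    then show "\<exists>K. \<forall>m\<ge>K. \<forall>n\<ge>K. nm (c00_space N) (trunc m x - trunc n x) < e" by blast
  qed
  then show "x \<in> vecs (A_space N)" by (simp add: A_space_def)
qed

private lemma A_tail:
  "x \<in> vecs (A_space N) \<Longrightarrow> 0 < e \<Longrightarrow> \<exists>K. \<forall>n. iter_norm N n (x - trunc K x) \<le> e"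
  using A_iff by blast

private lemma A_lim:
  assumes "x \<in> vecs (A_space N)"
  shows "(\<lambda>n. iter_norm N n x) \<longlonglongrightarrow> nm (A_space N) x"
proof -
  obtain K where K: "\<And>n. iter_norm N n (x - trunc K x) \<le> 1"
    using A_tail[OF assms, of 1] by auto
  have "iter_norm N n x \<le> 1 + iter_norm N K x" for n
  proof -
    have "iter_norm N n (trunc K x) \<le> iter_norm N (max K n) (trunc K x)"
      by (rule it_mono) simp
    also have "\<dots> = iter_norm N K (trunc K x)"
      by (rule it_stable) (simp_all add: trunc_def)
    also have "\<dots> = iter_norm N K x" by (rule it_cong) (simp add: trunc_def)
    finally show ?thesis
      using it_add[of n "x - trunc K x" "trunc K x"] K[of n] by simp
  qed
  then have "Bseq (\<lambda>n. iter_norm N n x)"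
    by (intro BseqI'[where K = "1 + iter_norm N K x"]) (simp add: it_nonneg)
  then have "convergent (\<lambda>n. iter_norm N n x)"
    using it_mono by (intro Bseq_mono_convergent) auto
  then show ?thesis
    by (simp add: A_space_def nm_trunc convergent_LIMSEQ_iff)
qed

private lemma A_le: "x \<in> vecs (A_space N) \<Longrightarrow> iter_norm N n x \<le> nm (A_space N) x"
  using incseq_le[OF _ A_lim] it_mono by (simp add: incseq_def)

private lemma A_leI:
  "x \<in> vecs (A_space N) \<Longrightarrow> (\<And>n. iter_norm N n x \<le> B) \<Longrightarrow> nm (A_space N) x \<le> B"
  by (rule LIMSEQ_le_const2[OF A_lim]) auto

private lemma c00_subset_A:
  assumes "x \<in> vecs (c00_space N)"
  shows "x \<in> vecs (A_space N)" "nm (A_space N) x = nm (c00_space N) x"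
proof -
  obtain k where k: "\<forall>j>k. x j = 0" using assms by (blast dest: c00_vecsD)
  have "x - trunc k x = 0" using k by (auto simp: trunc_def fun_eq_iff)
  moreover have "iter_norm N n 0 = 0" for n
    using it_sum[of n 0] it_nonneg[of n 0] by simp
  ultimately show A: "x \<in> vecs (A_space N)" 
    unfolding A_iff by (metis order.strict_implies_order)
  have "\<forall>\<^sub>F n in sequentially. iter_norm N n x = iter_norm N k x"
    using it_stable k by (auto simp: eventually_sequentially intro!: exI[of _ k])
  then have "(\<lambda>n. iter_norm N n x) \<longlonglongrightarrow> iter_norm N k x"
    by (rule tendsto_eventually)
  then have "nm (A_space N) x = iter_norm N k x"
    using A_lim[OF A] LIMSEQ_unique by blast
  then show "nm (A_space N) x = nm (c00_space N) x" using c00_norm_eq[OF k] by simp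
qed

private lemma trunc_in_A: "trunc n x \<in> vecs (c00_space N)"
  by (rule c00_vecsI[of n]) (simp add: trunc_def)

private lemma A_add:
  assumes "x \<in> vecs (A_space N)" "y \<in> vecs (A_space N)"
  shows "x + y \<in> vecs (A_space N)"
  unfolding A_iff
proof safe
  fix e :: real assume "0 < e"
  obtain K where K: "\<And>n. iter_norm N n (x - trunc K x) \<le> e / 2"
    using A_tail[OF assms(1), of "e / 2"] \<open>0 < e\<close> by auto
  obtain L where L: "\<And>n. iter_norm N n (y - trunc L y) \<le> e / 2"
    using A_tail[OF assms(2), of "e / 2"] \<open>0 < e\<close> by auto
  let ?m = "max K L"
  have "iter_norm N n (x + y - trunc ?m (x + y)) \<le> e" for n
  proof -
    have "x + y - trunc ?m (x + y) = (x - trunc ?m x) + (y - trunc ?m y)"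
      by (auto simp: trunc_def fun_eq_iff)
    then have "iter_norm N n (x + y - trunc ?m (x + y)) \<le>
        iter_norm N n (x - trunc ?m x) + iter_norm N n (y - trunc ?m y)"
      using it_add by metis
    moreover have "iter_norm N n (x - trunc ?m x) \<le> iter_norm N n (x - trunc K x)"
      by (intro it_mono_abs) (auto simp: trunc_def)
    moreover have "iter_norm N n (y - trunc ?m y) \<le> iter_norm N n (y - trunc L y)"
      by (intro it_mono_abs) (auto simp: trunc_def)
    ultimately show ?thesis using K[of n] L[of n] by linarith
  qed
  then show "\<exists>K. \<forall>n. iter_norm N n (x + y - trunc K (x + y)) \<le> e" by blast
qed

private lemma A_scale:
  assumes "x \<in> vecs (A_space N)"
  shows "a *\<^sub>R x \<in> vecs (A_space N)"
  unfolding A_iff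
proof safe
  fix e :: real assume "0 < e"
  then have "0 < e / (\<bar>a\<bar> + 1)" by simp
  then obtain K where K: "\<And>n. iter_norm N n (x - trunc K x) \<le> e / (\<bar>a\<bar> + 1)"
    using A_tail[OF assms] by blast
  have "iter_norm N n (a *\<^sub>R x - trunc K (a *\<^sub>R x)) \<le> e" for n
  proof -
    have "a *\<^sub>R x - trunc K (a *\<^sub>R x) = a *\<^sub>R (x - trunc K x)"
      by (auto simp: trunc_def fun_eq_iff)
    then have "iter_norm N n (a *\<^sub>R x - trunc K (a *\<^sub>R x)) = \<bar>a\<bar> * iter_norm N n (x - trunc K x)"
      by (simp add: it_scale)
    also have "\<dots> \<le> (\<bar>a\<bar> + 1) * (e / (\<bar>a\<bar> + 1))"
      using K[of n] it_nonneg by (intro mult_mono) auto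
    also have "\<dots> = e" by (simp add: add_nonneg_eq_0_iff)
    finally show ?thesis .
  qed
  then show "\<exists>K. \<forall>n. iter_norm N n (a *\<^sub>R x - trunc K (a *\<^sub>R x)) \<le> e" by blast
qed

private lemma normed_space_A: "normed_space (A_space N)"
proof -
  have sub: "subspace (vecs (A_space N))"
    unfolding subspace_def
    using A_add A_scale c00_subset_A(1) c00_vecsI[of 0 0] by simp
  have "nm (A_space N) x = 0 \<longleftrightarrow> x = 0" if x: "x \<in> vecs (A_space N)" for x
  proof
    assume "nm (A_space N) x = 0"
    then have "\<bar>x j\<bar> \<le> 0" for j
      using it_coord[of j j x] A_le[OF x, of j] by simp
    then show "x = 0" by (auto simp: fun_eq_iff)
  next
    assume "x = 0"
    then show "nm (A_space N) x = 0"
      using c00_subset_A(2)[of 0] c00_vecsI[of 0 0] normed_space_c00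
      by (auto simp: normed_space_def)
  qed
  moreover have "0 \<le> nm (A_space N) x" if x: "x \<in> vecs (A_space N)" for x
    using A_le[OF x, of 0] it_nonneg[of 0 x] by linarith
  moreover have "nm (A_space N) (a *\<^sub>R x) = \<bar>a\<bar> * nm (A_space N) x"
    if x: "x \<in> vecs (A_space N)" for a x
    by (rule LIMSEQ_unique[OF A_lim[OF A_scale[OF x]]])
      (simp add: it_scale tendsto_mult_left A_lim[OF x])
  moreover have "nm (A_space N) (x + y) \<le> nm (A_space N) x + nm (A_space N) y"
    if x: "x \<in> vecs (A_space N)" and y: "y \<in> vecs (A_space N)" for x y
    by (rule LIMSEQ_le[OF A_lim[OF A_add[OF x y]] tendsto_add[OF A_lim[OF x] A_lim[OF y]]])
      (use it_add in blast)
  ultimately show ?thesis unfolding normed_space_def using sub by blast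
qed

private lemma A_diff:
  "x \<in> vecs (A_space N) \<Longrightarrow> y \<in> vecs (A_space N) \<Longrightarrow> x - y \<in> vecs (A_space N)"
  using normed_space_A unfolding normed_space_def by (elim conjE) (rule subspace_diff)

private lemma banach_space_A: "banach_space (A_space N)"
  unfolding banach_space_def
proof (intro conjI allI impI)
  show "normed_space (A_space N)" by (rule normed_space_A)
next
  fix s assume "(\<forall>n. s n \<in> vecs (A_space N)) \<and> cauchy_in (A_space N) s"
  then have sA: "\<And>n. s n \<in> vecs (A_space N)" and C: "cauchy_in (A_space N) s" by auto
  have itC: "\<exists>K. \<forall>k\<ge>K. \<forall>l\<ge>K. \<forall>n. iter_norm N n (s k - s l) < e" if "0 < e" for e
  proof -
    obtain K where K: "\<forall>k\<ge>K. \<forall>l\<ge>K. nm (A_space N) (s k - s l) < e"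
      using C \<open>0 < e\<close> unfolding cauchy_in_def by blast
    have "iter_norm N n (s k - s l) < e" if "k \<ge> K" "l \<ge> K" for k l n
      by (rule le_less_trans[OF A_le[OF A_diff[OF sA sA]] K[rule_format, OF that]])
    then show ?thesis by blast
  qed
  have "Cauchy (\<lambda>k. s k j)" for j
  proof (rule CauchyI)
    fix e :: real assume "0 < e"
    then obtain K where K: "\<forall>k\<ge>K. \<forall>l\<ge>K. \<forall>n. iter_norm N n (s k - s l) < e" using itC by blast
    have "norm (s m j - s n j) < e" if "m \<ge> K" "n \<ge> K" for m n
    proof -
      have "\<bar>(s m - s n) j\<bar> \<le> iter_norm N j (s m - s n)" by (rule it_coord) simp
      also have "\<dots> < e" using K that by blast
      finally show ?thesis by simp
    qed
    then show "\<exists>K. \<forall>m\<ge>K. \<forall>n\<ge>K. norm (s m j - s n j) < e" by blast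
  qed
  then have lim: "(\<lambda>k. s k j) \<longlonglongrightarrow> lim (\<lambda>k. s k j)" for j
    by (simp only: Cauchy_convergent_iff convergent_LIMSEQ_iff)
  define x where "x j = lim (\<lambda>k. s k j)" for j
  have x: "(\<lambda>k. s k j) \<longlonglongrightarrow> x j" for j
    unfolding x_def by (rule lim)
  have itx: "(\<lambda>l. iter_norm N n (s l - x)) \<longlonglongrightarrow> 0" for n
  proof (rule tendsto_sandwich)
    show "\<forall>\<^sub>F l in sequentially. 0 \<le> iter_norm N n (s l - x)"
      by (simp add: it_nonneg)
    show "\<forall>\<^sub>F l in sequentially. iter_norm N n (s l - x) \<le> (\<Sum>j\<le>n. \<bar>(s l - x) j\<bar>)"
      by (rule always_eventually) (rule allI it_sum)+
    show "(\<lambda>l. \<Sum>j\<le>n. \<bar>(s l - x) j\<bar>) \<longlonglongrightarrow> 0"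
      unfolding minus_apply by (intro tendsto_null_sum tendsto_rabs_zero LIM_zero x)
  qed (rule tendsto_const)
  have close: "\<exists>K. \<forall>k\<ge>K. \<forall>n. iter_norm N n (x - s k) \<le> e" if "0 < e" for e
  proof -
    obtain K where K: "\<forall>k\<ge>K. \<forall>l\<ge>K. \<forall>n. iter_norm N n (s k - s l) < e"
      using itC \<open>0 < e\<close> by blast
    have "iter_norm N n (x - s k) \<le> e" if k: "k \<ge> K" for k n
    proof (rule LIMSEQ_le_const)
      show "(\<lambda>l. e + iter_norm N n (s l - x)) \<longlonglongrightarrow> e"
        using tendsto_add[OF tendsto_const itx[of n], of e] by (simp only: add_0_right)
      have "iter_norm N n (x - s k) \<le> e + iter_norm N n (s l - x)" if "l \<ge> K" for l
      proof -
        have "iter_norm N n (x - s k) = iter_norm N n (s k - x)"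
          by (intro antisym it_mono_abs) (simp_all add: abs_minus_commute)
        also have "\<dots> = iter_norm N n ((s k - s l) + (s l - x))"
          by (rule it_cong) simp
        also have "\<dots> \<le> iter_norm N n (s k - s l) + iter_norm N n (s l - x)"
          by (rule it_add)
        finally have "iter_norm N n (x - s k) \<le> iter_norm N n (s k - s l) + iter_norm N n (s l - x)" .
        moreover have "iter_norm N n (s k - s l) < e" using K k that by blast
        ultimately show ?thesis by linarith
      qed
      then show "\<exists>L. \<forall>l\<ge>L. iter_norm N n (x - s k) \<le> e + iter_norm N n (s l - x)" by blast
    qed
    then show ?thesis by blast
  qed
  have xA: "x \<in> vecs (A_space N)"
    unfolding A_iff
  proof safe
    fix e :: real assume "0 < e"
    then obtain k where k: "\<And>n. iter_norm N n (x - s k) \<le> e / 2"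
      using close[of "e / 2"] by auto
    obtain K where K: "\<And>n. iter_norm N n (s k - trunc K (s k)) \<le> e / 2"
      using A_tail[OF sA[of k], of "e / 2"] \<open>0 < e\<close> by auto
    have "iter_norm N n (x - trunc K x) \<le> e" for n
    proof -
      have "iter_norm N n (x - trunc K x) =
          iter_norm N n (((x - s k) - trunc K (x - s k)) + (s k - trunc K (s k)))"
        by (rule it_cong) (simp add: trunc_def)
      also have "\<dots> \<le>
          iter_norm N n ((x - s k) - trunc K (x - s k)) + iter_norm N n (s k - trunc K (s k))"
        by (rule it_add)
      finally have "iter_norm N n (x - trunc K x) \<le>
          iter_norm N n ((x - s k) - trunc K (x - s k)) + iter_norm N n (s k - trunc K (s k))" .
      moreover have "iter_norm N n ((x - s k) - trunc K (x - s k)) \<le> iter_norm N n (x - s k)"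
        by (intro it_mono_abs) (auto simp: trunc_def)
      ultimately show ?thesis using k[of n] K[of n] by linarith
    qed
    then show "\<exists>K. \<forall>n. iter_norm N n (x - trunc K x) \<le> e" by blast
  qed
  have "converges_in (A_space N) s x"
    unfolding converges_in_def
  proof (rule LIMSEQ_I)
    fix e :: real assume "0 < e"
    then obtain K where K: "\<And>k n. k \<ge> K \<Longrightarrow> iter_norm N n (x - s k) \<le> e / 2"
      using close[of "e / 2"] by auto
    have "norm (nm (A_space N) (s k - x) - 0) < e" if "k \<ge> K" for k
    proof -
      have "iter_norm N n (s k - x) \<le> e / 2" for n
      proof -
        have "iter_norm N n (s k - x) = iter_norm N n (x - s k)"
          by (intro antisym it_mono_abs) (simp_all add: abs_minus_commute)
        then show ?thesis using K[OF that, of n] by simp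
      qed
      then have "nm (A_space N) (s k - x) \<le> e / 2"
        by (intro A_leI A_diff sA xA)
      moreover have "0 \<le> nm (A_space N) (s k - x)"
        using A_le[OF A_diff[OF sA xA], of 0] it_nonneg[of 0] by (rule order_trans[rotated])
      ultimately show ?thesis using \<open>0 < e\<close> unfolding real_norm_def by linarith
    qed
    then show "\<exists>K. \<forall>k\<ge>K. norm (nm (A_space N) (s k - x) - 0) < e" by blast
  qed
  with xA show "\<exists>l\<in>vecs (A_space N). converges_in (A_space N) s l" by blast
qed

theorem A_space_completion: "completion_of (A_space N) (c00_space N)"
  unfolding completion_of_def
proof (intro conjI ballI allI impI subsetI)
  show "normed_space (c00_space N)" by (rule normed_space_c00)
  show "banach_space (A_space N)" by (rule banach_space_A)
  show "x \<in> vecs (A_space N)" if "x \<in> vecs (c00_space N)" for x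
    using that by (rule c00_subset_A(1))
  show "nm (A_space N) x = nm (c00_space N) x" if "x \<in> vecs (c00_space N)" for x
    using that by (rule c00_subset_A(2))
next
  fix x and e :: real assume x: "x \<in> vecs (A_space N)" and e: "0 < e"
  then obtain K where K: "\<And>n. iter_norm N n (x - trunc K x) \<le> e / 2"
    using A_tail[OF x, of "e / 2"] by auto
  have "x - trunc K x \<in> vecs (A_space N)"
    using A_diff[OF x] c00_subset_A(1)[OF trunc_in_A] by blast
  then have "nm (A_space N) (x - trunc K x) \<le> e / 2" using K by (rule A_leI)
  with e trunc_in_A show "\<exists>y\<in>vecs (c00_space N). nm (A_space N) (x - y) < e"
    by (intro bexI[of _ "trunc K x"]) auto
qed

end

lemma root_sum_powers_triangle:
  fixes a b a' b' :: real
  assumes k: "k > 0" and nn: "0 \<le> a" "0 \<le> b" "0 \<le> a'" "0 \<le> b'"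
  shows "root k ((a + a') ^ k + (b + b') ^ k) \<le> root k (a ^ k + b ^ k) + root k (a' ^ k + b' ^ k)"
proof -
  define A where "A = root k (a ^ k + b ^ k)"
  define B where "B = root k (a' ^ k + b' ^ k)"
  have A: "0 \<le> A" "A ^ k = a ^ k + b ^ k" and B: "0 \<le> B" "B ^ k = a' ^ k + b' ^ k"
    using k nn by (auto simp: A_def B_def real_root_ge_zero)
  have cvx: "(u * x + v * y) ^ k \<le> u * x ^ k + v * y ^ k"
    if "0 \<le> u" "0 \<le> v" "u + v = 1" "0 \<le> x" "0 \<le> y" for u v x y :: real
  proof -
    have "convex_on {0..} (\<lambda>x::real. x ^ k)"
      using convex_power_even[of k] convex_power_odd[of k] convex_on_subset by (cases "even k") auto
    then show ?thesis using that unfolding convex_on_def by auto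
  qed
  have zero: "u = 0 \<and> v = 0" if "u ^ k + v ^ k = 0" "0 \<le> u" "0 \<le> v" for u v :: real
    using that k by (simp add: add_nonneg_eq_0_iff)
  have "(a + a') ^ k + (b + b') ^ k \<le> (A + B) ^ k"
  proof (cases "A = 0 \<or> B = 0")
    case True
    then show ?thesis
    proof
      assume "A = 0"
      then have "a ^ k + b ^ k = 0" using A(2) k by (metis zero_power)
      then have "a = 0 \<and> b = 0" using zero nn by blast
      with B \<open>A = 0\<close> show ?thesis by simp
    next
      assume "B = 0"
      then have "a' ^ k + b' ^ k = 0" using B(2) k by (metis zero_power)
      then have "a' = 0 \<and> b' = 0" using zero nn by blast
      with A \<open>B = 0\<close> show ?thesis by simp
    qed
  next
    case False
    with A(1) B(1) have pos: "A > 0" "B > 0" by auto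
    define u where "u = A / (A + B)"
    define v where "v = B / (A + B)"
    have uv: "0 \<le> u" "0 \<le> v" "u + v = 1"
      using pos by (simp_all add: u_def v_def flip: add_divide_distrib)
    have uvAB: "(A + B) * u = A" "(A + B) * v = B"
      using pos by (simp_all add: u_def v_def)
    have split: "(x + y) ^ k \<le> (A + B) ^ k * (u * (x / A) ^ k + v * (y / B) ^ k)"
      if "0 \<le> x" "0 \<le> y" for x y
    proof -
      have "(A + B) * (u * (x / A) + v * (y / B)) = ((A + B) * u) * (x / A) + ((A + B) * v) * (y / B)"
        by (simp only: distrib_left mult.assoc)
      also have "\<dots> = x + y"
        unfolding uvAB using pos by simp
      finally have "(x + y) ^ k = (A + B) ^ k * (u * (x / A) + v * (y / B)) ^ k"
        by (metis power_mult_distrib)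
      also have "\<dots> \<le> (A + B) ^ k * (u * (x / A) ^ k + v * (y / B) ^ k)"
        using uv pos that by (intro mult_left_mono cvx) auto
      finally show ?thesis .
    qed
    have "(a + a') ^ k + (b + b') ^ k \<le>
        (A + B) ^ k * (u * (a / A) ^ k + v * (a' / B) ^ k) +
        (A + B) ^ k * (u * (b / A) ^ k + v * (b' / B) ^ k)"
      using nn by (intro add_mono split)
    also have "\<dots> = (A + B) ^ k * (u * ((a / A) ^ k + (b / A) ^ k) + v * ((a' / B) ^ k + (b' / B) ^ k))"
      by (simp add: distrib_left)
    also have "(a / A) ^ k + (b / A) ^ k = A ^ k / A ^ k"
      by (simp only: A(2) power_divide add_divide_distrib)
    also have "(a' / B) ^ k + (b' / B) ^ k = B ^ k / B ^ k"
      by (simp only: B(2) power_divide add_divide_distrib)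
    finally show ?thesis using uv(3) pos by simp
  qed
  then have "root k ((a + a') ^ k + (b + b') ^ k) \<le> root k ((A + B) ^ k)"
    using k by simp
  also have "\<dots> = A + B" using k A B by (simp add: real_root_power_cancel)
  finally show ?thesis by (simp add: A_def B_def)
qed

lemma abs_normalized_norm_Nc:
  assumes c: "0 < c" "c < 1" and n: "n \<ge> 1"
  shows "abs_normalized_norm (Nc c n)"
proof -
  define k where "k = 2 * n"
  have k: "k > 0" "even k" using n by (simp_all add: k_def)
  define d where "d = root k (1 - c ^ k)"
  have ck: "0 < 1 - c ^ k" using c k by (simp add: power_less_one_iff)
  have d: "0 < d" "d ^ k = 1 - c ^ k"
    using k ck by (auto simp: d_def real_root_pow_pos2)
  define r where "r s t = sqrt (s\<^sup>2 + (c * t)\<^sup>2)" for s t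
  have Nc: "Nc c n s t = root k ((d * \<bar>t\<bar>) ^ k + r s t ^ k)" for s t
  proof -
    have "r s t ^ k = (s\<^sup>2 + c\<^sup>2 * t\<^sup>2) ^ n"
      by (simp add: r_def k_def power_mult power_mult_distrib)
    then show ?thesis by (simp add: Nc_def d power_mult_distrib flip: k_def)
  qed
  have r0: "0 \<le> r s t" for s t by (simp add: r_def)
  have arg0: "0 \<le> (d * \<bar>t\<bar>) ^ k + r s t ^ k" for s t
    using d r0 by simp
  have 1: "0 \<le> Nc c n s t" for s t
    using arg0 k by (simp add: Nc real_root_ge_zero)
  have 2: "Nc c n s t = 0 \<longleftrightarrow> s = 0 \<and> t = 0" for s t
  proof -
    have "Nc c n s t = 0 \<longleftrightarrow> (d * \<bar>t\<bar>) ^ k + r s t ^ k = 0" using k by (simp add: Nc)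
    also have "\<dots> \<longleftrightarrow> (d * \<bar>t\<bar>) ^ k = 0 \<and> r s t ^ k = 0"
      using d r0 by (intro add_nonneg_eq_0_iff) auto
    also have "\<dots> \<longleftrightarrow> s = 0 \<and> t = 0" using d k c by (auto simp: r_def)
    finally show ?thesis .
  qed
  have 3: "Nc c n (a * s) (a * t) = \<bar>a\<bar> * Nc c n s t" for a s t
  proof -
    have "r (a * s) (a * t) = \<bar>a\<bar> * r s t"
    proof -
      have "(a * s)\<^sup>2 + (c * (a * t))\<^sup>2 = a\<^sup>2 * (s\<^sup>2 + (c * t)\<^sup>2)" by (simp add: algebra_simps power2_eq_square)
      then show ?thesis by (simp add: r_def real_sqrt_mult)
    qed
    then have "(d * \<bar>a * t\<bar>) ^ k + r (a * s) (a * t) ^ k = \<bar>a\<bar> ^ k * ((d * \<bar>t\<bar>) ^ k + r s t ^ k)"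
      by (simp add: abs_mult power_mult_distrib algebra_simps)
    then show ?thesis using k by (simp add: Nc real_root_mult real_root_power_cancel)
  qed
  have 4: "Nc c n (s + s') (t + t') \<le> Nc c n s t + Nc c n s' t'" for s t s' t'
  proof -
    have "r (s + s') (t + t') \<le> r s t + r s' t'"
      using real_sqrt_sum_squares_triangle_ineq[of s s' "c * t" "c * t'"]
      by (simp add: r_def algebra_simps)
    moreover have "d * \<bar>t + t'\<bar> \<le> d * \<bar>t\<bar> + d * \<bar>t'\<bar>"
      using d abs_triangle_ineq[of t t'] by (simp flip: distrib_left)
    ultimately have "Nc c n (s + s') (t + t') \<le>
        root k ((d * \<bar>t\<bar> + d * \<bar>t'\<bar>) ^ k + (r s t + r s' t') ^ k)"
      unfolding Nc using k d r0 by (intro real_root_le_mono add_mono power_mono) auto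
    also have "\<dots> \<le> Nc c n s t + Nc c n s' t'"
      unfolding Nc using k d r0 by (intro root_sum_powers_triangle) auto
    finally show ?thesis .
  qed
  have 5: "Nc c n s t = Nc c n \<bar>s\<bar> \<bar>t\<bar>" for s t by (simp add: Nc_def)
  have 6: "Nc c n 1 0 = 1" using n by (simp add: Nc_def)
  have 7: "Nc c n 0 1 = 1" using n by (simp add: Nc_def power_mult)
  show ?thesis
    unfolding abs_normalized_norm_def by (intro conjI allI) (rule 1 2 3 4 5 6 7)+
qed

corollary X_space_completion:
  "0 < c \<Longrightarrow> c < 1 \<Longrightarrow> completion_of (X_space c) (c00_space (Nc c))"
  unfolding X_space_def by (intro A_space_completion) (simp add: abs_normalized_norm_Nc)

end

theory Submission
  imports Defs
begin

text \<open>
  As \<open>n \<rightarrow> \<infinity>\<close>, the norms \<open>Nc c n\<close> converge to \<open>max \<bar>t\<bar> (sqrt (s\<^sup>2 + c\<^sup>2 t\<^sup>2))\<close>. Hence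
  adding to a vector \<open>x\<close> of \<open>X\<^sub>c\<close> a vector \<open>w\<close> with support far out gives, up to a small error,
  \<open>\<parallel>x + w\<parallel>\<^sup>2 = max (\<parallel>x\<parallel>\<^sup>2 + c\<^sup>2 \<parallel>w\<parallel>\<^sub>2\<^sup>2) (\<parallel>w\<parallel>\<^sup>2)\<close>, where \<open>\<parallel>w\<parallel>\<^sub>2\<close> is the norm of \<open>\<ell>\<^sub>2\<close>. The first
  alternative is a Hilbertian regime; in the second one \<open>x\<close> is invisible.

  The invisibility refutes the weak maximizing property. With \<open>r\<^sup>2 = 1 - c\<^sup>2\<close> the vectors
  \<open>r e\<^sub>0 + e\<^sub>n\<close> have norms tending to \<open>1\<close> (\<open>P_spread\<close>) and are not weakly null, and the diagonal
  operator with entries \<open>n / (n + 1)\<close> sends them to vectors with norms tending to \<open>1\<close>. This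
  operator strictly decreases the norm of every nonzero vector (\<open>P_diag_op_less\<close>), so its norm
  \<open>1\<close> is not attained.

  For the compact perturbation property let \<open>S = T + K\<close> with \<open>\<parallel>S\<parallel> > \<parallel>T\<parallel>\<close>. By weak compactness there is a
  maximizing sequence \<open>x + w\<^sub>n\<close> in the unit ball with \<open>w\<^sub>n\<close> weakly null, and \<open>K w\<^sub>n \<rightarrow> 0\<close> after passing
  to a subsequence. Then \<open>\<parallel>S w\<^sub>n\<parallel>\<close> is asymptotically at most \<open>\<parallel>T\<parallel> < \<parallel>S\<parallel>\<close>, so the images \<open>S x + S w\<^sub>n\<close>
  are in the Hilbertian regime: writing \<open>a\<close> and \<open>b\<close> for the limits of \<open>\<parallel>w\<^sub>n\<parallel>\<^sub>2\<^sup>2\<close> and \<open>\<parallel>T w\<^sub>n\<parallel>\<^sub>2\<^sup>2\<close>,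
  one has \<open>\<parallel>S\<parallel>\<^sup>2 \<le> \<parallel>S x\<parallel>\<^sup>2 + c\<^sup>2 b\<close> (\<open>P_sq_asymptotic_upper\<close>) and \<open>\<parallel>x\<parallel>\<^sup>2 + c\<^sup>2 a \<le> 1\<close>
  (\<open>P_sq_asymptotic_lower\<close>). If \<open>b \<le> \<parallel>T\<parallel>\<^sup>2 a\<close>, these combine to \<open>x \<noteq> 0\<close> and \<open>\<parallel>S x\<parallel> \<ge> \<parallel>S\<parallel> \<parallel>x\<parallel>\<close>, and the norm is
  attained at \<open>x / \<parallel>x\<parallel>\<close>.

  The inequality \<open>b \<le> \<parallel>T\<parallel>\<^sup>2 a\<close> (\<open>asymptotic_contraction\<close>) compares \<open>\<ell>\<^sub>2\<close> norms although \<open>\<parallel>T\<parallel>\<close> is the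
  norm for \<open>X\<^sub>c\<close>. It follows by averaging: the coordinates of \<open>k\<^bsup>-1/2\<^esup> (w\<^bsub>n\<^sub>1\<^esub> + \<dots> + w\<^bsub>n\<^sub>k\<^esub>)\<close> are
  uniformly small for sparse indices and large \<open>k\<close>, and on such flat vectors far out the norm of
  \<open>X\<^sub>c\<close> is nearly \<open>c\<close> times the norm of \<open>\<ell>\<^sub>2\<close> (\<open>P_sq_upper_flat\<close>), which is its minimum.

  Since \<open>c \<parallel>x\<parallel>\<^sub>2 \<le> \<parallel>x\<parallel> \<le> \<parallel>x\<parallel>\<^sub>2\<close>, the space \<open>X\<^sub>c\<close> is \<open>\<ell>\<^sub>2\<close> with an equivalent norm, hence reflexive, and its
  Banach--Mazur distance from \<open>\<ell>\<^sub>2\<close> is at most \<open>1 / c\<close>.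
\<close>

lemma sequentially_exE:
  assumes "eventually Q sequentially"
  obtains n where "Q n"
  using eventually_happens'[OF sequentially_bot assms] by (rule exE)

section \<open>Square summable sequences\<close>

text \<open>
  Only used on \<open>\<ell>\<^sub>2\<close>. The square of the norm is written \<open>ip x x\<close> throughout, which keeps square
  roots out of the estimates.
\<close>

definition ip :: "(nat \<Rightarrow> real) \<Rightarrow> (nat \<Rightarrow> real) \<Rightarrow> real" where
  "ip x y = (\<Sum>j. x j * y j)"

abbreviation l2 :: "(nat \<Rightarrow> real) set" where
  "l2 \<equiv> vecs ell2"

definition unit_vec :: "nat \<Rightarrow> nat \<Rightarrow> real" where
  "unit_vec i = (\<lambda>j. if j = i then 1 else 0)"

lemma l2_iff: "x \<in> l2 \<longleftrightarrow> summable (\<lambda>j. (x j)\<^sup>2)"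
  by (simp add: ell2_def)

lemma nm_ell2: "nm ell2 x = sqrt (ip x x)"
  by (simp add: ell2_def ip_def power2_eq_square)

lemma l2_summable: "x \<in> l2 \<Longrightarrow> y \<in> l2 \<Longrightarrow> summable (\<lambda>j. x j * y j)"
proof (rule summable_comparison_test')
  assume "x \<in> l2" "y \<in> l2"
  then show "summable (\<lambda>j. (x j)\<^sup>2 + (y j)\<^sup>2)"
    unfolding l2_iff by (rule summable_add)
  show "norm (x j * y j) \<le> (x j)\<^sup>2 + (y j)\<^sup>2" for j
  proof -
    have "0 \<le> (\<bar>x j\<bar> - \<bar>y j\<bar>)\<^sup>2" by simp
    then have "2 * (\<bar>x j\<bar> * \<bar>y j\<bar>) \<le> (x j)\<^sup>2 + (y j)\<^sup>2"
      by (simp add: power2_diff)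
    moreover have "0 \<le> \<bar>x j\<bar> * \<bar>y j\<bar>" by simp
    ultimately show ?thesis unfolding real_norm_def abs_mult by linarith
  qed
qed

lemma l2_dominated:
  assumes "y \<in> l2" "\<And>j. \<bar>x j\<bar> \<le> \<bar>y j\<bar>"
  shows "x \<in> l2"
  unfolding l2_iff
proof (rule summable_comparison_test')
  show "summable (\<lambda>j. (y j)\<^sup>2)" using assms(1) by (simp only: l2_iff)
  show "norm ((x j)\<^sup>2) \<le> (y j)\<^sup>2" for j
    using assms(2)[of j] by (simp add: abs_le_square_iff)
qed

lemma l2_add: "x \<in> l2 \<Longrightarrow> y \<in> l2 \<Longrightarrow> x + y \<in> l2"
proof -
  assume "x \<in> l2" "y \<in> l2"
  then have "summable (\<lambda>j. (x j)\<^sup>2 + (y j)\<^sup>2 + 2 * (x j * y j))"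
    using l2_summable by (intro summable_add summable_mult) (auto simp: l2_iff)
  then show ?thesis by (simp add: l2_iff power2_sum mult.assoc)
qed

lemma l2_scale: "x \<in> l2 \<Longrightarrow> a *\<^sub>R x \<in> l2"
  by (simp add: l2_iff power_mult_distrib summable_mult)

lemma l2_diff: "x \<in> l2 \<Longrightarrow> y \<in> l2 \<Longrightarrow> x - y \<in> l2"
  using l2_add[of x "(-1) *\<^sub>R y"] l2_scale[of y "-1"] by simp

lemma finite_support_l2: "(\<And>j. j > n \<Longrightarrow> x j = 0) \<Longrightarrow> x \<in> l2"
  unfolding l2_iff by (rule summable_finite[of "{..n}"]) auto

lemma trunc_l2: "trunc n x \<in> l2"
  by (rule finite_support_l2[of n]) (simp add: trunc_def)

lemma trunc_add: "trunc m (x + y) = trunc m x + trunc m y"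
  by (simp add: trunc_def fun_eq_iff)

lemma tail_add: "x + y - trunc m (x + y) = (x - trunc m x) + (y - trunc m y)"
  by (simp add: trunc_def fun_eq_iff)

lemma tail_l2: "x \<in> l2 \<Longrightarrow> x - trunc m x \<in> l2"
  by (intro l2_diff trunc_l2)

lemma zero_l2: "0 \<in> l2"
  by (rule finite_support_l2[of 0]) simp

lemma unit_vec_l2: "unit_vec i \<in> l2"
  by (rule finite_support_l2[of i]) (simp add: unit_vec_def)

lemma ip_commute: "ip x y = ip y x"
  by (simp add: ip_def mult.commute)

lemma ip_add:
  assumes "x \<in> l2" "y \<in> l2" "z \<in> l2"
  shows "ip (x + y) z = ip x z + ip y z"
proof -
  have "ip x z + ip y z = (\<Sum>j. x j * z j + y j * z j)"
    unfolding ip_def using assms by (intro suminf_add l2_summable)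
  then show ?thesis by (simp add: ip_def distrib_right)
qed

lemma ip_scale:
  assumes "x \<in> l2" "y \<in> l2"
  shows "ip (a *\<^sub>R x) y = a * ip x y"
proof -
  have "(\<Sum>j. a * (x j * y j)) = a * ip x y"
    unfolding ip_def using assms by (intro suminf_mult l2_summable)
  then show ?thesis by (simp add: ip_def mult.assoc)
qed

lemma ip_scale_self: "x \<in> l2 \<Longrightarrow> ip (a *\<^sub>R x) (a *\<^sub>R x) = a\<^sup>2 * ip x x"
  using ip_scale[of x "a *\<^sub>R x" a] ip_scale[of x x a] ip_commute[of x "a *\<^sub>R x"]
  by (simp add: l2_scale power2_eq_square)

lemma ip_add_self:
  "x \<in> l2 \<Longrightarrow> y \<in> l2 \<Longrightarrow> ip (x + y) (x + y) = ip x x + 2 * ip x y + ip y y"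
  using ip_add[of x y "x + y"] ip_add[of x y x] ip_add[of x y y]
    ip_commute[of x "x + y"] ip_commute[of y "x + y"] ip_commute[of y x]
  by (simp add: l2_add)

lemma ip_nonneg: "x \<in> l2 \<Longrightarrow> 0 \<le> ip x x"
  unfolding ip_def by (intro suminf_nonneg l2_summable) auto

lemma ip_partial: "x \<in> l2 \<Longrightarrow> (\<Sum>j\<le>n. (x j)\<^sup>2) \<le> ip x x"
  unfolding ip_def power2_eq_square by (intro sum_le_suminf l2_summable) auto

lemma ip_coord: "x \<in> l2 \<Longrightarrow> (x j)\<^sup>2 \<le> ip x x"
proof -
  assume "x \<in> l2"
  moreover have "(x j)\<^sup>2 \<le> (\<Sum>i\<le>j. (x i)\<^sup>2)"
    by (rule member_le_sum) auto
  ultimately show ?thesis using ip_partial order_trans by blast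
qed

lemma ip_lim: "x \<in> l2 \<Longrightarrow> y \<in> l2 \<Longrightarrow> (\<lambda>n. \<Sum>j\<le>n. x j * y j) \<longlonglongrightarrow> ip x y"
  unfolding ip_def by (rule summable_LIMSEQ') (rule l2_summable)

lemma ip_lim_self: "x \<in> l2 \<Longrightarrow> (\<lambda>n. \<Sum>j\<le>n. (x j)\<^sup>2) \<longlonglongrightarrow> ip x x"
  using ip_lim[of x x] by (simp add: power2_eq_square)

lemma ip_trunc_left: "ip (trunc n x) y = (\<Sum>j\<le>n. x j * y j)"
proof -
  have "ip (trunc n x) y = (\<Sum>j\<in>{..n}. trunc n x j * y j)"
    unfolding ip_def by (rule suminf_finite) (auto simp: trunc_def)
  then show ?thesis by (simp add: trunc_def)
qed

lemma ip_trunc_self: "ip (trunc n x) (trunc n x) = (\<Sum>j\<le>n. (x j)\<^sup>2)"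
  unfolding ip_trunc_left by (simp add: trunc_def power2_eq_square)

lemma ip_tail:
  assumes "x \<in> l2"
  shows "ip (x - trunc n x) (x - trunc n x) = ip x x - (\<Sum>j\<le>n. (x j)\<^sup>2)"
proof -
  have t: "x - trunc n x \<in> l2" using assms trunc_l2 by (rule l2_diff)
  have "ip (trunc n x) (x - trunc n x) = 0"
    unfolding ip_trunc_left by (simp add: trunc_def)
  then have "ip x x = ip (trunc n x) (trunc n x) + ip (x - trunc n x) (x - trunc n x)"
    using ip_add_self[OF trunc_l2[of n x] t] by simp
  then show ?thesis by (simp add: ip_trunc_self)
qed

lemma ip_tail_tendsto_0:
  assumes "x \<in> l2"
  shows "(\<lambda>n. ip (x - trunc n x) (x - trunc n x)) \<longlonglongrightarrow> 0"
  unfolding ip_tail[OF assms]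
  using tendsto_diff[OF tendsto_const ip_lim_self[OF assms], of "ip x x"] by simp

lemma ip_Cauchy_Schwarz:
  assumes "x \<in> l2" "y \<in> l2"
  shows "\<bar>ip x y\<bar> \<le> sqrt (ip x x) * sqrt (ip y y)"
proof -
  have "(ip x y)\<^sup>2 \<le> ip x x * ip y y"
  proof (rule LIMSEQ_le)
    show "(\<lambda>n. (\<Sum>j\<le>n. x j * y j)\<^sup>2) \<longlonglongrightarrow> (ip x y)\<^sup>2"
      using assms by (intro tendsto_intros ip_lim)
    show "(\<lambda>n. (\<Sum>j\<le>n. (x j)\<^sup>2) * (\<Sum>j\<le>n. (y j)\<^sup>2)) \<longlonglongrightarrow> ip x x * ip y y"
      using assms by (intro tendsto_intros ip_lim_self)
  qed (use Cauchy_Schwarz_ineq_sum in blast)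
  then have "sqrt ((ip x y)\<^sup>2) \<le> sqrt (ip x x * ip y y)" by (rule real_sqrt_le_mono)
  then show ?thesis by (simp add: real_sqrt_mult)
qed

lemma l2_boundedI:
  assumes "\<And>n. (\<Sum>j\<le>n. (x j)\<^sup>2) \<le> C"
  shows "x \<in> l2" "ip x x \<le> C"
proof -
  show x: "x \<in> l2"
    unfolding l2_iff
  proof (rule summableI_nonneg_bounded)
    show "(\<Sum>j<n. (x j)\<^sup>2) \<le> C" for n
      using assms[of n] sum_mono2[of "{..n}" "{..<n}" "\<lambda>j. (x j)\<^sup>2"] by force
  qed simp
  show "ip x x \<le> C"
    by (rule LIMSEQ_le_const2[OF ip_lim_self[OF x]]) (use assms in blast)
qed

text \<open>
  Evaluating the functional at the truncations of its own coefficient sequence shows that this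
  sequence is square summable; the representation extends from truncations by continuity.
\<close>

lemma riesz_ell2:
  assumes f: "bounded_op ell2 real_line f"
  obtains a where "a \<in> l2" "\<And>x. x \<in> l2 \<Longrightarrow> f x = ip a x"
proof -
  have add: "f (x + y) = f x + f y" if "x \<in> l2" "y \<in> l2" for x y
    using f that unfolding bounded_op_def by blast
  have scale: "f (r *\<^sub>R x) = r * f x" if "x \<in> l2" for x r
    using f that unfolding bounded_op_def real_scaleR_def by blast
  obtain B where B: "\<And>x. x \<in> l2 \<Longrightarrow> \<bar>f x\<bar> \<le> B * sqrt (ip x x)"
    using f unfolding bounded_op_def real_line_def nm_ell2 nspace.simps by blast
  define a where "a j = f (unit_vec j)" for j
  have tr: "f (trunc n x) = (\<Sum>j\<le>n. a j * x j)" for n x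
  proof (induction n)
    case 0
    have "trunc 0 x = x 0 *\<^sub>R unit_vec 0" by (auto simp: trunc_def unit_vec_def fun_eq_iff)
    then have "f (trunc 0 x) = x 0 * a 0"
      using scale[OF unit_vec_l2] by (simp only: a_def)
    then show ?case by simp
  next
    case (Suc n)
    have "trunc (Suc n) x = trunc n x + x (Suc n) *\<^sub>R unit_vec (Suc n)"
      by (auto simp: trunc_def unit_vec_def fun_eq_iff le_Suc_eq)
    then have "f (trunc (Suc n) x) = f (trunc n x) + x (Suc n) * a (Suc n)"
      using add[OF trunc_l2 l2_scale[OF unit_vec_l2]] scale[OF unit_vec_l2]
      by (simp only: a_def)
    then show ?case using Suc by simp
  qed
  have a: "a \<in> l2"
  proof (rule l2_boundedI)
    fix n
    define s where "s = (\<Sum>j\<le>n. (a j)\<^sup>2)"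
    have s: "0 \<le> s" by (simp add: s_def sum_nonneg)
    have "f (trunc n a) = s" "ip (trunc n a) (trunc n a) = s"
      by (simp_all add: tr ip_trunc_self s_def power2_eq_square)
    then have "s \<le> B * sqrt s" using B[OF trunc_l2[of n a]] s by simp
    then have "sqrt s * sqrt s \<le> B * sqrt s" using s by simp
    then have "sqrt s \<le> \<bar>B\<bar>"
      using s by (cases "s = 0") (auto simp only: mult_le_cancel_right real_sqrt_zero abs_ge_zero
        real_sqrt_gt_0_iff real_sqrt_lt_0_iff)
    then have "(sqrt s)\<^sup>2 \<le> \<bar>B\<bar>\<^sup>2" using s by (intro power_mono) auto
    then show "(\<Sum>j\<le>n. (a j)\<^sup>2) \<le> B\<^sup>2" using s by (simp add: s_def)
  qed
  moreover have "f x = ip a x" if x: "x \<in> l2" for x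
  proof (rule LIMSEQ_unique)
    show "(\<lambda>n. f (trunc n x)) \<longlonglongrightarrow> ip a x"
      unfolding tr using a x by (rule ip_lim)
    have "(\<lambda>n. f x - f (trunc n x)) \<longlonglongrightarrow> 0"
    proof (rule Lim_null_comparison)
      show "\<forall>\<^sub>F n in sequentially.
          norm (f x - f (trunc n x)) \<le> B * sqrt (ip (x - trunc n x) (x - trunc n x))"
      proof (intro always_eventually allI)
        fix n
        have "f ((x - trunc n x) + trunc n x) = f (x - trunc n x) + f (trunc n x)"
          by (intro add l2_diff x trunc_l2)
        then show "norm (f x - f (trunc n x)) \<le> B * sqrt (ip (x - trunc n x) (x - trunc n x))"
          using B[OF l2_diff[OF x trunc_l2]] by simp
      qed
      show "(\<lambda>n. B * sqrt (ip (x - trunc n x) (x - trunc n x))) \<longlonglongrightarrow> 0"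
        using tendsto_mult_right_zero[OF tendsto_real_sqrt[OF ip_tail_tendsto_0[OF x], simplified]] by simp
    qed
    then show "(\<lambda>n. f (trunc n x)) \<longlonglongrightarrow> f x"
      using tendsto_diff[OF tendsto_const, of _ 0 sequentially "f x"] by fastforce
  qed
  ultimately show ?thesis by (rule that)
qed

section \<open>Weakly null sequences in coordinates\<close>

text \<open>
  The coordinate form of weak convergence to \<open>0\<close> in \<open>\<ell>\<^sub>2\<close>. It does not mention functionals and
  can therefore be verified on subsequences obtained by compactness of a product of intervals.
\<close>

definition wnull :: "(nat \<Rightarrow> nat \<Rightarrow> real) \<Rightarrow> bool" where
  "wnull s \<longleftrightarrow> (\<forall>n. s n \<in> l2) \<and> (\<exists>C. \<forall>n. ip (s n) (s n) \<le> C) \<and> (\<forall>j. (\<lambda>n. s n j) \<longlonglongrightarrow> 0)"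

lemma wnullD: "wnull w \<Longrightarrow> w n \<in> l2"
  by (simp add: wnull_def)

lemma wnull_subseq: "wnull s \<Longrightarrow> strict_mono r \<Longrightarrow> wnull (\<lambda>n. s (r n))"
  unfolding wnull_def using LIMSEQ_subseq_LIMSEQ[of "\<lambda>n. s n j" 0 r for j]
  by (auto simp: o_def)

lemma wnull_ip:
  assumes w: "wnull w" and y: "y \<in> l2"
  shows "(\<lambda>n. ip y (w n)) \<longlonglongrightarrow> 0"
proof (rule LIMSEQ_I)
  fix e :: real assume e: "0 < e"
  obtain C where C: "\<And>n. ip (w n) (w n) \<le> C" and wl: "\<And>n. w n \<in> l2"
    and w0: "\<And>j. (\<lambda>n. w n j) \<longlonglongrightarrow> 0"
    using w by (auto simp: wnull_def)
  have C0: "0 \<le> C" using C[of 0] ip_nonneg[OF wl[of 0]] by linarith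
  have "(\<lambda>J. sqrt (ip (y - trunc J y) (y - trunc J y)) * sqrt C) \<longlonglongrightarrow> sqrt 0 * sqrt C"
    by (intro tendsto_intros ip_tail_tendsto_0 y)
  then have "\<forall>\<^sub>F J in sequentially. sqrt (ip (y - trunc J y) (y - trunc J y)) * sqrt C < e / 2"
    by (rule order_tendstoD) (use e in simp)
  then obtain J where J: "sqrt (ip (y - trunc J y) (y - trunc J y)) * sqrt C < e / 2"
    by (rule sequentially_exE)
  have "(\<lambda>n. \<bar>ip (trunc J y) (w n)\<bar>) \<longlonglongrightarrow> 0"
    unfolding ip_trunc_left by (intro tendsto_rabs_zero tendsto_null_sum tendsto_mult_right_zero w0)
  then have "\<forall>\<^sub>F n in sequentially. \<bar>ip (trunc J y) (w n)\<bar> < e / 2"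
    by (rule order_tendstoD) (use e in simp)
  then obtain N where N: "\<And>n. n \<ge> N \<Longrightarrow> \<bar>ip (trunc J y) (w n)\<bar> < e / 2"
    by (auto simp: eventually_sequentially)
  have "norm (ip y (w n) - 0) < e" if "n \<ge> N" for n
  proof -
    have t: "y - trunc J y \<in> l2" by (intro l2_diff y trunc_l2)
    have "ip y (w n) = ip (trunc J y) (w n) + ip (y - trunc J y) (w n)"
      using ip_add[OF trunc_l2 t wl, of J y n] by simp
    moreover have "\<bar>ip (y - trunc J y) (w n)\<bar> \<le> sqrt (ip (y - trunc J y) (y - trunc J y)) * sqrt C"
      by (rule order_trans[OF ip_Cauchy_Schwarz[OF t wl]])
        (use C ip_nonneg[OF t] in \<open>intro mult_left_mono; simp\<close>)
    ultimately show ?thesis using N[OF that] J unfolding real_norm_def by linarith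
  qed
  then show "\<exists>N. \<forall>n\<ge>N. norm (ip y (w n) - 0) < e" by blast
qed

lemma bounded_coordwise_convergent_subseq:
  fixes s :: "nat \<Rightarrow> nat \<Rightarrow> real"
  assumes "\<And>n j. \<bar>s n j\<bar> \<le> C"
  obtains r x where "strict_mono r" "\<And>j. (\<lambda>n. s (r n) j) \<longlonglongrightarrow> x j"
proof -
  have "compactin (product_topology (\<lambda>_. euclidean) UNIV) (PiE UNIV (\<lambda>_::nat. cball (0::real) C))"
    unfolding compactin_PiE by simp
  then have "compact (PiE UNIV (\<lambda>_::nat. cball (0::real) C))"
    by (simp add: euclidean_product_topology)
  then have "seq_compact (PiE UNIV (\<lambda>_::nat. cball (0::real) C))"
    by (rule compact_imp_seq_compact)
  moreover have "\<forall>n. s n \<in> PiE UNIV (\<lambda>_::nat. cball (0::real) C)"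
    using assms by (auto simp: dist_real_def)
  ultimately obtain x r where r: "strict_mono (r::nat\<Rightarrow>nat)" "(s \<circ> r) \<longlonglongrightarrow> x"
    unfolding seq_compact_def by blast
  have "(\<lambda>n. s (r n) j) \<longlonglongrightarrow> x j" for j
    using continuous_on_tendsto_compose[OF continuous_on_product_coordinates r(2)]
    by (simp add: o_def)
  with r(1) show ?thesis by (rule that)
qed

text \<open>
  Weak sequential compactness of balls, in the form in which maximizing sequences are split into a
  weak limit and a weakly null part.
\<close>

lemma l2_bounded_decompose:
  fixes s :: "nat \<Rightarrow> nat \<Rightarrow> real"
  assumes sl: "\<And>n. s n \<in> l2" and C: "\<And>n. ip (s n) (s n) \<le> C"
  obtains r x where "strict_mono r" "x \<in> l2" "wnull (\<lambda>n. s (r n) - x)"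
proof -
  have bd: "\<bar>s n j\<bar> \<le> sqrt C" for n j
    using order_trans[OF ip_coord[OF sl[of n], of j] C[of n]] by (simp add: real_le_rsqrt)
  obtain r x where r: "strict_mono r" and x: "\<And>j. (\<lambda>n. s (r n) j) \<longlonglongrightarrow> x j"
    using bounded_coordwise_convergent_subseq[of s "sqrt C", OF bd] by metis
  have xl: "x \<in> l2"
  proof (rule l2_boundedI)
    fix m
    have "(\<lambda>n. \<Sum>j\<le>m. (s (r n) j)\<^sup>2) \<longlonglongrightarrow> (\<Sum>j\<le>m. (x j)\<^sup>2)"
      by (intro tendsto_intros x)
    then show "(\<Sum>j\<le>m. (x j)\<^sup>2) \<le> C"
      by (rule LIMSEQ_le_const2) (use order_trans[OF ip_partial[OF sl] C] in blast)
  qed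
  have "wnull (\<lambda>n. s (r n) - x)"
    unfolding wnull_def
  proof (intro conjI allI exI)
    fix n show "s (r n) - x \<in> l2" by (intro l2_diff sl xl)
    \<comment> \<open>the parallelogram identity bounds the difference without a triangle inequality\<close>
    have "ip (s (r n) - x) (s (r n) - x) + ip (s (r n) + x) (s (r n) + x)
        = 2 * ip (s (r n)) (s (r n)) + 2 * ip x x"
    proof -
      have "ip (s (r n) + (-1) *\<^sub>R x) (s (r n) + (-1) *\<^sub>R x)
          = ip (s (r n)) (s (r n)) - 2 * ip (s (r n)) x + ip x x"
        using ip_scale[OF xl sl, of "-1" "r n"] ip_scale_self[OF xl, of "-1"]
          ip_commute[of "s (r n)" x] ip_commute[of "s (r n)" "(-1) *\<^sub>R x"]
        by (subst ip_add_self[OF sl l2_scale[OF xl]]) simp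
      then show ?thesis using ip_add_self[OF sl xl, of "r n"] by simp
    qed
    then show "ip (s (r n) - x) (s (r n) - x) \<le> 2 * C + 2 * ip x x"
      using C[of "r n"] ip_nonneg[OF l2_add[OF sl xl], of "r n"] by linarith
  next
    fix j show "(\<lambda>n. (s (r n) - x) j) \<longlonglongrightarrow> 0"
      using LIM_zero[OF x[of j]] by simp
  qed
  with r xl show ?thesis by (rule that)
qed

section \<open>Operator norms\<close>

lemma normed_spaceD:
  assumes "normed_space E"
  shows "x \<in> vecs E \<Longrightarrow> 0 \<le> nm E x" "x \<in> vecs E \<Longrightarrow> nm E x = 0 \<longleftrightarrow> x = 0"
    "x \<in> vecs E \<Longrightarrow> nm E (a *\<^sub>R x) = \<bar>a\<bar> * nm E x"
    "0 \<in> vecs E"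
    "x \<in> vecs E \<Longrightarrow> a *\<^sub>R x \<in> vecs E"
  using assms unfolding normed_space_def subspace_def by (elim conjE, simp only: Ball_def)+

lemma bounded_opD:
  assumes "bounded_op E F T"
  shows "x \<in> vecs E \<Longrightarrow> T x \<in> vecs F"
    "x \<in> vecs E \<Longrightarrow> y \<in> vecs E \<Longrightarrow> T (x + y) = T x + T y"
    "x \<in> vecs E \<Longrightarrow> T (a *\<^sub>R x) = a *\<^sub>R T x"
  using assms unfolding bounded_op_def by (elim conjE, simp only: Ball_def)+

lemma bounded_op_boundE:
  assumes "bounded_op E F T" "normed_space E"
  obtains B where "0 \<le> B" "\<And>x. x \<in> vecs E \<Longrightarrow> nm F (T x) \<le> B * nm E x"
proof -
  obtain B where B: "\<forall>x\<in>vecs E. nm F (T x) \<le> B * nm E x"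
    using assms(1) unfolding bounded_op_def by (elim conjE exE)
  have "nm F (T x) \<le> \<bar>B\<bar> * nm E x" if x: "x \<in> vecs E" for x
  proof -
    have "B * nm E x \<le> \<bar>B\<bar> * nm E x"
      using normed_spaceD(1)[OF assms(2) x] by (intro mult_right_mono) auto
    then show ?thesis using B[rule_format, OF x] by linarith
  qed
  then show ?thesis using that[of "\<bar>B\<bar>"] by simp
qed

lemma zero_in_ball: "normed_space E \<Longrightarrow> 0 \<in> ball_of E"
  using normed_spaceD(2)[of E 0] normed_spaceD(4)[of E] by (simp add: ball_of_def)

text \<open>
  Makes the supremum in \<open>opnorm\<close> meaningful: over an unbounded set it is an unspecified real.
\<close>

lemma opnorm_bdd_above:
  assumes "bounded_op E F T" "normed_space E"
  shows "bdd_above ((\<lambda>x. nm F (T x)) ` ball_of E)"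
proof -
  obtain B where B: "0 \<le> B" "\<And>x. x \<in> vecs E \<Longrightarrow> nm F (T x) \<le> B * nm E x"
    by (rule bounded_op_boundE[OF assms]) (rule that)
  have "nm F (T x) \<le> B" if "x \<in> ball_of E" for x
    using B(2)[of x] mult_left_mono[OF _ B(1), of "nm E x" 1] that by (simp add: ball_of_def)
  then show ?thesis by (intro bdd_aboveI2[where M = B])
qed

lemma opnorm_ge:
  assumes "bounded_op E F T" "normed_space E" "x \<in> ball_of E"
  shows "nm F (T x) \<le> opnorm E F T"
  unfolding opnorm_def by (rule cSUP_upper[OF assms(3) opnorm_bdd_above[OF assms(1,2)]])

lemma opnorm_le:
  assumes "normed_space E" "\<And>x. x \<in> ball_of E \<Longrightarrow> nm F (T x) \<le> B"
  shows "opnorm E F T \<le> B"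
  unfolding opnorm_def using zero_in_ball[OF assms(1)] assms(2) by (intro cSUP_least) auto

lemma opnorm_bound:
  assumes T: "bounded_op E F T" and E: "normed_space E" and F: "normed_space F" and x: "x \<in> vecs E"
  shows "nm F (T x) \<le> opnorm E F T * nm E x"
proof (cases "nm E x = 0")
  case True
  obtain B where "nm F (T x) \<le> B * nm E x"
    using bounded_op_boundE[OF T E] x by metis
  then show ?thesis using True by simp
next
  case False
  then have pos: "0 < nm E x" using normed_spaceD(1)[OF E x] by simp
  define u where "u = (1 / nm E x) *\<^sub>R x"
  have u: "u \<in> ball_of E"
    using pos normed_spaceD(3,5)[OF E x] by (simp add: u_def ball_of_def)
  have "nm F (T u) = nm F (T x) / nm E x"
    unfolding u_def bounded_opD(3)[OF T x] normed_spaceD(3)[OF F bounded_opD(1)[OF T x]]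
    using pos by simp
  then have "nm F (T x) / nm E x \<le> opnorm E F T" using opnorm_ge[OF T E u] by simp
  then show ?thesis using pos by (simp add: divide_le_eq)
qed

lemma opnorm_nonneg:
  assumes "bounded_op E F T" "normed_space E" "normed_space F"
  shows "0 \<le> opnorm E F T"
  using opnorm_ge[OF assms(1,2) zero_in_ball[OF assms(2)]]
    normed_spaceD(1)[OF assms(3) bounded_opD(1)[OF assms(1) normed_spaceD(4)[OF assms(2)]]] by linarith

lemma opnorm_approximating_sequence:
  assumes T: "bounded_op E F T" and E: "normed_space E"
  obtains s where "\<And>n. s n \<in> ball_of E" "(\<lambda>n. nm F (T (s n))) \<longlonglongrightarrow> opnorm E F T"
proof -
  have "\<exists>x. x \<in> ball_of E \<and> opnorm E F T - 1 / real (Suc n) < nm F (T x)" for n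
  proof -
    have "opnorm E F T - 1 / real (Suc n) < opnorm E F T" by simp
    moreover have "ball_of E \<noteq> {}" using zero_in_ball[OF E] by auto
    ultimately show ?thesis
      using less_cSUP_iff[OF _ opnorm_bdd_above[OF T E]] unfolding opnorm_def by metis
  qed
  then obtain s where s: "\<And>n. s n \<in> ball_of E \<and> opnorm E F T - 1 / real (Suc n) < nm F (T (s n))"
    by metis
  have "(\<lambda>n. nm F (T (s n))) \<longlonglongrightarrow> opnorm E F T"
  proof (rule tendsto_sandwich)
    show "(\<lambda>n. opnorm E F T - 1 / real (Suc n)) \<longlonglongrightarrow> opnorm E F T"
      using tendsto_diff[OF tendsto_const LIMSEQ_inverse_real_of_nat, of "opnorm E F T"]
      by (simp add: inverse_eq_divide)
    show "\<forall>\<^sub>F n in sequentially. opnorm E F T - 1 / real (Suc n) \<le> nm F (T (s n))"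
      using s by (intro always_eventually allI less_imp_le) simp
    show "\<forall>\<^sub>F n in sequentially. nm F (T (s n)) \<le> opnorm E F T"
      using s opnorm_ge[OF T E] by (intro always_eventually allI) simp
  qed simp
  then show ?thesis by (rule that[rotated]) (use s in simp)
qed

section \<open>The two-dimensional norms\<close>

lemma Nc_power:
  assumes "0 < c" "c < 1" "1 \<le> n"
  shows "((Nc c n s t)\<^sup>2) ^ n = (1 - c ^ (2 * n)) * (t\<^sup>2) ^ n + (s\<^sup>2 + c\<^sup>2 * t\<^sup>2) ^ n"
proof -
  have "c ^ (2 * n) \<le> 1" using assms by (intro power_le_one) auto
  then have "0 \<le> (1 - c ^ (2 * n)) * \<bar>t\<bar> ^ (2 * n) + (s\<^sup>2 + c\<^sup>2 * t\<^sup>2) ^ n"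
    by (intro add_nonneg_nonneg mult_nonneg_nonneg) auto
  then have "Nc c n s t ^ (2 * n) = (1 - c ^ (2 * n)) * \<bar>t\<bar> ^ (2 * n) + (s\<^sup>2 + c\<^sup>2 * t\<^sup>2) ^ n"
    unfolding Nc_def using assms by (intro real_root_pow_pos2) auto
  then show ?thesis by (simp add: power_mult)
qed

lemma Nc_sq_ge:
  assumes "0 < c" "c < 1" "1 \<le> n"
  shows "s\<^sup>2 + c\<^sup>2 * t\<^sup>2 \<le> (Nc c n s t)\<^sup>2"
proof (rule power_le_imp_le_base[of _ "n - 1"])
  have "c ^ (2 * n) \<le> 1" using assms by (intro power_le_one) auto
  then have "0 \<le> (1 - c ^ (2 * n)) * (t\<^sup>2) ^ n" by simp
  then have "(s\<^sup>2 + c\<^sup>2 * t\<^sup>2) ^ n \<le> ((Nc c n s t)\<^sup>2) ^ n"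
    unfolding Nc_power[OF assms] by simp
  then show "(s\<^sup>2 + c\<^sup>2 * t\<^sup>2) ^ Suc (n - 1) \<le> ((Nc c n s t)\<^sup>2) ^ Suc (n - 1)"
    using assms by simp
qed simp

text \<open>
  Dropping the mixed terms of \<open>(s\<^sup>2 + t\<^sup>2)\<^sup>n - (s\<^sup>2 + c\<^sup>2 t\<^sup>2)\<^sup>n\<close> leaves \<open>(1 - c\<^bsup>2n\<^esup>) t\<^bsup>2n\<^esup>\<close>. The induction
  on the exponent avoids the binomial expansion.
\<close>

lemma Nc_sq_le:
  assumes "0 < c" "c < 1" "1 \<le> n"
  shows "(Nc c n s t)\<^sup>2 \<le> s\<^sup>2 + t\<^sup>2"
proof (rule power_le_imp_le_base[of _ "n - 1"])
  have c2: "c\<^sup>2 \<le> 1" using assms by (intro power_le_one) auto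
  have mono: "u ^ n * (1 - c ^ (2 * n)) + (a + c\<^sup>2 * u) ^ n \<le> (a + u) ^ n"
    if "0 \<le> a" "0 \<le> u" for a u :: real
    using \<open>1 \<le> n\<close>
  proof (induction n rule: dec_induct)
    case base
    then show ?case by (simp add: algebra_simps power2_eq_square)
  next
    case (step k)
    have "u ^ Suc k * (1 - c ^ (2 * Suc k)) + (a + c\<^sup>2 * u) ^ Suc k
        = (a + u) * (u ^ k * (1 - c ^ (2 * k)) + (a + c\<^sup>2 * u) ^ k)
          - (a * u ^ k * (1 - c ^ (2 * k)) + (1 - c\<^sup>2) * u * ((a + c\<^sup>2 * u) ^ k - (c\<^sup>2 * u) ^ k))"
      by (simp add: algebra_simps power_mult power2_eq_square)
    also have "\<dots> \<le> (a + u) * (u ^ k * (1 - c ^ (2 * k)) + (a + c\<^sup>2 * u) ^ k)"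
    proof -
      have "c ^ (2 * k) \<le> 1" using assms by (intro power_le_one) auto
      moreover have "(c\<^sup>2 * u) ^ k \<le> (a + c\<^sup>2 * u) ^ k" using that by (intro power_mono) auto
      ultimately have "0 \<le> a * u ^ k * (1 - c ^ (2 * k)) + (1 - c\<^sup>2) * u * ((a + c\<^sup>2 * u) ^ k - (c\<^sup>2 * u) ^ k)"
        using that c2 by (intro add_nonneg_nonneg mult_nonneg_nonneg) auto
      then show ?thesis by linarith
    qed
    also have "\<dots> \<le> (a + u) * (a + u) ^ k" using step that by (intro mult_left_mono) auto
    finally show ?case by simp
  qed
  have "((Nc c n s t)\<^sup>2) ^ n \<le> (s\<^sup>2 + t\<^sup>2) ^ n"
    unfolding Nc_power[OF assms] using mono[of "s\<^sup>2" "t\<^sup>2"] by (simp add: mult.commute)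
  then show "((Nc c n s t)\<^sup>2) ^ Suc (n - 1) \<le> (s\<^sup>2 + t\<^sup>2) ^ Suc (n - 1)"
    using assms by simp
qed simp

text \<open>
  The norm \<open>Nc c n\<close> exceeds its limit \<open>max \<bar>t\<bar> (sqrt (s\<^sup>2 + c\<^sup>2 t\<^sup>2))\<close> by a factor of at most
  \<open>2\<^bsup>1/(2n)\<^esup>\<close>. These factors have a divergent product, so this bound cannot be iterated. But the
  excess is also small where \<open>t\<^sup>2\<close> is small relative to \<open>s\<^sup>2\<close>. The factor \<open>exp (t\<^sup>2 / (n b))\<close> (for
  the squared norm) captures both effects, and over all coordinates of a square summable sequence
  the exponents add up to a multiple of its squared norm. The factor \<open>E\<close> carries the error
  accumulated at earlier coordinates.
\<close>

lemma Nc_sq_upper: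
  assumes c: "0 < c" "c < 1" "1 \<le> n"
    and s: "s\<^sup>2 \<le> A * E" and E: "1 \<le> E" and b: "0 < b" "b \<le> A"
    and B: "t\<^sup>2 \<le> B" "A + c\<^sup>2 * t\<^sup>2 \<le> B"
  shows "(Nc c n s t)\<^sup>2 \<le> B * (E * exp (t\<^sup>2 / (real n * b)))"
proof (rule power_le_imp_le_base[of _ "n - 1"])
  let ?D = "A + c\<^sup>2 * t\<^sup>2"
  have D: "b \<le> ?D" "0 < ?D" using b by (auto intro: add_pos_nonneg add_increasing2)
  \<comment> \<open>in either case the ratio of the smaller summand to the larger one is at most \<open>t\<^sup>2 / b\<close>\<close>
  have key: "(t\<^sup>2) ^ n + ?D ^ n \<le> B ^ n * (1 + t\<^sup>2 / b)"
  proof (cases "t\<^sup>2 \<le> ?D")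
    case True
    have "(t\<^sup>2) ^ n = ?D ^ n * (t\<^sup>2 / ?D) ^ n" using D by (simp add: power_divide)
    also have "\<dots> \<le> ?D ^ n * (t\<^sup>2 / ?D)"
      using D True power_decreasing[of 1 n "t\<^sup>2 / ?D"] c by (intro mult_left_mono) auto
    also have "\<dots> \<le> ?D ^ n * (t\<^sup>2 / b)"
      using D b by (intro mult_left_mono divide_left_mono) auto
    finally have "(t\<^sup>2) ^ n + ?D ^ n \<le> ?D ^ n * (1 + t\<^sup>2 / b)" by (simp add: distrib_left)
    also have "\<dots> \<le> B ^ n * (1 + t\<^sup>2 / b)"
      using D B b by (intro mult_right_mono power_mono) auto
    finally show ?thesis .
  next
    case False
    then have "?D ^ n \<le> (t\<^sup>2) ^ n" using D by (intro power_mono) auto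
    then have "(t\<^sup>2) ^ n + ?D ^ n \<le> (t\<^sup>2) ^ n * 2" by simp
    also have "\<dots> \<le> B ^ n * (1 + t\<^sup>2 / b)"
      using False B b D by (intro mult_mono power_mono) (auto simp: le_divide_eq)
    finally show ?thesis .
  qed
  have "((Nc c n s t)\<^sup>2) ^ n \<le> (t\<^sup>2) ^ n + (s\<^sup>2 + c\<^sup>2 * t\<^sup>2) ^ n"
    unfolding Nc_power[OF c] using c by (intro add_right_mono mult_left_le_one_le) (auto intro: power_le_one)
  also have "\<dots> \<le> E ^ n * (t\<^sup>2) ^ n + (E * ?D) ^ n"
  proof (intro add_mono power_mono)
    show "(t\<^sup>2) ^ n \<le> E ^ n * (t\<^sup>2) ^ n"
      using E by (intro mult_le_cancel_right1[THEN iffD2]) (auto intro: one_le_power)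
    have "1 * (c\<^sup>2 * t\<^sup>2) \<le> E * (c\<^sup>2 * t\<^sup>2)" using E by (intro mult_right_mono) auto
    then show "s\<^sup>2 + c\<^sup>2 * t\<^sup>2 \<le> E * ?D" using s by (simp add: distrib_left mult.commute[of E A])
  qed simp
  also have "\<dots> = E ^ n * ((t\<^sup>2) ^ n + ?D ^ n)"
    by (simp only: power_mult_distrib[of E] distrib_left[of "E ^ n"])
  also have "\<dots> \<le> E ^ n * (B ^ n * (1 + t\<^sup>2 / b))"
    using E by (intro mult_left_mono key) auto
  also have "\<dots> \<le> E ^ n * (B ^ n * exp (t\<^sup>2 / b))"
    using E D B exp_ge_add_one_self[of "t\<^sup>2 / b"]
    by (intro mult_left_mono zero_le_power) linarith+
  also have "exp (t\<^sup>2 / b) = exp (t\<^sup>2 / (real n * b)) ^ n"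
    using c by (simp flip: exp_of_nat_mult)
  finally show "((Nc c n s t)\<^sup>2) ^ Suc (n - 1) \<le> (B * (E * exp (t\<^sup>2 / (real n * b)))) ^ Suc (n - 1)"
    using c by (simp add: power_mult_distrib mult_ac)
  show "0 \<le> B * (E * exp (t\<^sup>2 / (real n * b)))"
    using E B D by (intro mult_nonneg_nonneg) auto
qed

section \<open>The iterated norms\<close>

context
  fixes c :: real
  assumes c: "0 < c" "c < 1"
begin

abbreviation M :: "nat \<Rightarrow> (nat \<Rightarrow> real) \<Rightarrow> real" where
  "M \<equiv> iter_norm (Nc c)"

lemma Nc_norm: "abs_normalized_norm (Nc c (Suc n))"
  using c by (intro abs_normalized_norm_Nc) auto

lemma M_nonneg: "0 \<le> M n x"
  by (cases n) (simp_all add: abs_normalized_normD(1)[OF Nc_norm])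

lemma M_mono_abs: "(\<And>j. j \<le> n \<Longrightarrow> \<bar>x j\<bar> \<le> \<bar>y j\<bar>) \<Longrightarrow> M n x \<le> M n y"
proof (induction n)
  case (Suc n)
  then show ?case
    using M_nonneg[of n] by (simp, intro abs_normalized_norm_mono[OF Nc_norm]) auto
qed simp

lemma M_trunc: "n \<le> m \<Longrightarrow> M n (trunc m x) = M n x"
  by (intro antisym M_mono_abs) (auto simp: trunc_def)

lemma M_sq_le: "(M n x)\<^sup>2 \<le> (\<Sum>j\<le>n. (x j)\<^sup>2)"
proof (induction n)
  case (Suc n)
  have "(M (Suc n) x)\<^sup>2 \<le> (M n x)\<^sup>2 + (x (Suc n))\<^sup>2"
    using Nc_sq_le[OF c, of "Suc n" "M n x" "\<bar>x (Suc n)\<bar>"] by simp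
  then show ?case using Suc by simp
qed simp

lemma M_sq_increment:
  "m \<le> n \<Longrightarrow> (M m x)\<^sup>2 + c\<^sup>2 * ((\<Sum>j\<le>n. (x j)\<^sup>2) - (\<Sum>j\<le>m. (x j)\<^sup>2)) \<le> (M n x)\<^sup>2"
proof (induction n rule: dec_induct)
  case (step n)
  have "(M n x)\<^sup>2 + c\<^sup>2 * (x (Suc n))\<^sup>2 \<le> (M (Suc n) x)\<^sup>2"
    using Nc_sq_ge[OF c, of "Suc n" "M n x" "\<bar>x (Suc n)\<bar>"] by simp
  then show ?case using step by (simp add: algebra_simps)
qed simp

lemma M_sq_ge: "c\<^sup>2 * (\<Sum>j\<le>n. (x j)\<^sup>2) \<le> (M n x)\<^sup>2"
proof -
  have "c\<^sup>2 * (x 0)\<^sup>2 \<le> (x 0)\<^sup>2" using c by (intro mult_left_le_one_le power_le_one) auto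
  then show ?thesis using M_sq_increment[of 0 n x] by (simp add: algebra_simps)
qed

text \<open>
  Any \<open>B\<close> that grows as fast as the iteration of the limiting norms
  \<open>max \<bar>t\<bar> (sqrt (s\<^sup>2 + c\<^sup>2 t\<^sup>2))\<close> bounds the true iteration up to a factor tending to \<open>1\<close> as the
  starting index \<open>m\<close> tends to infinity.
\<close>

lemma M_sq_upper:
  assumes m: "1 \<le> m" "m \<le> n" and A: "0 < A" "(M m x)\<^sup>2 \<le> A" and B: "B m = A"
    "\<And>k. m \<le> k \<Longrightarrow> (x (Suc k))\<^sup>2 \<le> B (Suc k)"
    "\<And>k. m \<le> k \<Longrightarrow> B k + c\<^sup>2 * (x (Suc k))\<^sup>2 \<le> B (Suc k)"
  shows "(M n x)\<^sup>2 \<le> B n * exp (((\<Sum>j\<le>n. (x j)\<^sup>2) - (\<Sum>j\<le>m. (x j)\<^sup>2)) / (real m * A))"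
  using m(2)
proof (induction n rule: dec_induct)
  case (step n)
  let ?S = "\<lambda>n. \<Sum>j\<le>n. (x j)\<^sup>2"
  have "A \<le> B n" using step(1)
  proof (induction n rule: dec_induct)
    case (step k)
    have "0 \<le> c\<^sup>2 * (x (Suc k))\<^sup>2" by simp
    with step B(3)[of k] show ?case by linarith
  qed (simp add: B(1))
  have "?S m \<le> ?S n" using step by (intro sum_mono2) auto
  then have "0 \<le> (?S n - ?S m) / (real m * A)" using A by simp
  then have E: "1 \<le> exp ((?S n - ?S m) / (real m * A))" by simp
  have "(M (Suc n) x)\<^sup>2 \<le> B (Suc n) *
      (exp ((?S n - ?S m) / (real m * A)) * exp (\<bar>x (Suc n)\<bar>\<^sup>2 / (real (Suc n) * A)))"
    unfolding iter_norm.simps using c step E A \<open>A \<le> B n\<close> B by (intro Nc_sq_upper[where A = "B n"]) auto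
  also have "\<dots> \<le> B (Suc n) *
      (exp ((?S n - ?S m) / (real m * A)) * exp ((x (Suc n))\<^sup>2 / (real m * A)))"
  proof (intro mult_left_mono)
    have "(x (Suc n))\<^sup>2 / (real (Suc n) * A) \<le> (x (Suc n))\<^sup>2 / (real m * A)"
      using A m step by (intro divide_left_mono mult_right_mono) auto
    then show "exp (\<bar>x (Suc n)\<bar>\<^sup>2 / (real (Suc n) * A)) \<le> exp ((x (Suc n))\<^sup>2 / (real m * A))" by simp
    show "0 \<le> B (Suc n)" using order_trans[OF zero_le_power2 B(2)] step(1) by blast
  qed simp
  also have "\<dots> = B (Suc n) * exp ((?S (Suc n) - ?S m) / (real m * A))"
    by (simp add: exp_add[symmetric] add_divide_distrib[symmetric])
  finally show ?case .
qed (use A B in simp)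

lemma M_sq_coord: "(x n)\<^sup>2 \<le> (M n x)\<^sup>2"
proof (cases n)
  case (Suc k)
  have "\<bar>x n\<bar> = Nc c (Suc k) 0 \<bar>x (Suc k)\<bar>"
    using abs_normalized_norm_axes(2)[OF Nc_norm, of k] Suc by simp
  also have "\<dots> \<le> M n x"
    unfolding Suc iter_norm.simps by (intro abs_normalized_norm_mono[OF Nc_norm]) auto
  finally show ?thesis by (simp add: abs_le_square_iff[symmetric] M_nonneg)
qed simp

section \<open>\<open>X\<^sub>c\<close> as a renorming of \<open>\<ell>\<^sub>2\<close>\<close>

abbreviation X :: "(nat \<Rightarrow> real) nspace" where
  "X \<equiv> X_space c"

abbreviation P :: "(nat \<Rightarrow> real) \<Rightarrow> real" where
  "P \<equiv> nm X"

lemma c00_nm: "(\<And>j. j > n \<Longrightarrow> x j = 0) \<Longrightarrow> nm (c00_space (Nc c)) x = M n x"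
  by (rule c00_norm_eq) (auto simp: abs_normalized_norm_Nc c)

text \<open>
  The truncations are Cauchy for \<open>X\<^sub>c\<close> exactly if they are Cauchy for \<open>\<ell>\<^sub>2\<close>, because \<open>M n\<close> is squeezed
  between \<open>c\<close> times the Euclidean norm and the Euclidean norm.
\<close>

lemma X_vecs: "vecs (X_space c) = l2"
proof (intro equalityI subsetI)
  fix x assume "x \<in> l2"
  show "x \<in> vecs (X_space c)"
    unfolding X_space_def A_space_def nspace.simps mem_Collect_eq cauchy_in_def
  proof safe
    fix e :: real assume e: "0 < e"
    have "\<forall>\<^sub>F n in sequentially. ip (x - trunc n x) (x - trunc n x) < e\<^sup>2"
      using e by (intro order_tendstoD(2)[OF ip_tail_tendsto_0[OF \<open>x \<in> l2\<close>]]) simp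
    then obtain K where K: "ip (x - trunc K x) (x - trunc K x) < e\<^sup>2"
      by (rule sequentially_exE)
    have "nm (c00_space (Nc c)) (trunc m x - trunc n x) < e" if "m \<ge> K" "n \<ge> K" for m n
    proof -
      let ?k = "max m n" and ?d = "trunc m x - trunc n x"
      have "(M ?k ?d)\<^sup>2 \<le> (\<Sum>j\<le>?k. (?d j)\<^sup>2)" by (rule M_sq_le)
      also have "\<dots> \<le> (\<Sum>j\<le>?k. ((x - trunc K x) j)\<^sup>2)"
        using that by (intro sum_mono) (auto simp: trunc_def)
      also have "\<dots> \<le> ip (x - trunc K x) (x - trunc K x)"
        by (intro ip_partial l2_diff \<open>x \<in> l2\<close> trunc_l2)
      finally have "(M ?k ?d)\<^sup>2 < e\<^sup>2" using K by linarith
      then have "M ?k ?d < e" using e by (intro power_less_imp_less_base[of _ 2 e]) auto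
      moreover have "nm (c00_space (Nc c)) ?d = M ?k ?d"
        by (rule c00_nm) (auto simp: trunc_def)
      ultimately show ?thesis by simp
    qed
    then show "\<exists>K. \<forall>m\<ge>K. \<forall>n\<ge>K. nm (c00_space (Nc c)) (trunc m x - trunc n x) < e" by blast
  qed
next
  fix x assume "x \<in> vecs (X_space c)"
  then have C: "cauchy_in (c00_space (Nc c)) (\<lambda>n. trunc n x)" by (simp add: X_space_def A_space_def)
  obtain K where K: "\<And>n. n \<ge> K \<Longrightarrow> nm (c00_space (Nc c)) (trunc n x - trunc K x) < 1"
    using C unfolding cauchy_in_def by (metis order_refl zero_less_one)
  have "x - trunc K x \<in> l2"
  proof (rule l2_boundedI)
    fix n
    let ?k = "max n K"
    let ?d = "trunc ?k x - trunc K x"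
    have "nm (c00_space (Nc c)) ?d = M ?k ?d"
      by (rule c00_nm) (auto simp: trunc_def)
    then have "M ?k ?d \<le> 1" using K[of ?k] by simp
    then have "(M ?k ?d)\<^sup>2 \<le> 1" using M_nonneg by (intro power_le_one) auto
    then have "c\<^sup>2 * (\<Sum>j\<le>?k. (?d j)\<^sup>2) \<le> 1" using M_sq_ge[where n = ?k and x = ?d] by linarith
    then have "(\<Sum>j\<le>?k. (?d j)\<^sup>2) \<le> 1 / c\<^sup>2" using c by (simp add: field_simps)
    moreover have "(\<Sum>j\<le>n. ((x - trunc K x) j)\<^sup>2) \<le> (\<Sum>j\<le>?k. (?d j)\<^sup>2)"
    proof -
      have "(\<Sum>j\<le>n. ((x - trunc K x) j)\<^sup>2) = (\<Sum>j\<le>n. (?d j)\<^sup>2)"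
        by (intro sum.cong) (auto simp: trunc_def)
      also have "\<dots> \<le> (\<Sum>j\<le>?k. (?d j)\<^sup>2)" by (intro sum_mono2) auto
      finally show ?thesis .
    qed
    ultimately show "(\<Sum>j\<le>n. ((x - trunc K x) j)\<^sup>2) \<le> 1 / c\<^sup>2" by linarith
  qed
  then show "x \<in> l2" using l2_add[OF _ trunc_l2[of K x]] by fastforce
qed

lemma M_incseq: "incseq (\<lambda>n. M n x)"
proof (rule incseq_SucI)
  fix n
  have "0 \<le> c\<^sup>2 * (x (Suc n))\<^sup>2" by simp
  moreover have "(M n x)\<^sup>2 + c\<^sup>2 * (x (Suc n))\<^sup>2 \<le> (M (Suc n) x)\<^sup>2"
    using M_sq_increment[of n "Suc n" x] by simp
  ultimately have "(M n x)\<^sup>2 \<le> (M (Suc n) x)\<^sup>2" by linarith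
  then show "M n x \<le> M (Suc n) x" by (rule power2_le_imp_le) (rule M_nonneg)
qed

lemma M_tendsto_P:
  assumes x: "x \<in> l2"
  shows "(\<lambda>n. M n x) \<longlonglongrightarrow> P x"
proof -
  have "M n x \<le> sqrt (ip x x)" for n
    using order_trans[OF M_sq_le ip_partial[OF x]] by (rule real_le_rsqrt)
  then have "convergent (\<lambda>n. M n x)"
    using M_incseq M_nonneg
    by (intro Bseq_mono_convergent BseqI'[where K = "sqrt (ip x x)"]) (auto simp: incseq_def)
  moreover have "nm (c00_space (Nc c)) (trunc n x) = M n x" for n
  proof -
    have "nm (c00_space (Nc c)) (trunc n x) = M n (trunc n x)"
      by (rule c00_nm) (simp add: trunc_def)
    then show ?thesis by (simp add: M_trunc)
  qed
  ultimately show ?thesis by (simp add: X_space_def A_space_def convergent_LIMSEQ_iff)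
qed

lemma M_le_P: "x \<in> l2 \<Longrightarrow> M n x \<le> P x"
  by (rule incseq_le[OF M_incseq M_tendsto_P])

lemma X_banach: "banach_space (X_space c)"
  using X_space_completion[OF c] by (simp add: completion_of_def)

lemma X_normed: "normed_space (X_space c)"
  using X_banach by (simp add: banach_space_def)

lemma P_nonneg: "x \<in> l2 \<Longrightarrow> 0 \<le> P x"
  and P_eq_0: "x \<in> l2 \<Longrightarrow> P x = 0 \<longleftrightarrow> x = 0"
  and P_scale: "x \<in> l2 \<Longrightarrow> P (a *\<^sub>R x) = \<bar>a\<bar> * P x"
  and P_add: "x \<in> l2 \<Longrightarrow> y \<in> l2 \<Longrightarrow> P (x + y) \<le> P x + P y"
  using X_normed unfolding normed_space_def X_vecs by (elim conjE, simp only: Ball_def)+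

lemma P_diff_bound:
  assumes "x \<in> l2" "y \<in> l2"
  shows "\<bar>P (x + y) - P x\<bar> \<le> P y"
proof -
  have "P ((x + y) + (-1) *\<^sub>R y) \<le> P (x + y) + P ((-1) *\<^sub>R y)"
    using assms by (intro P_add l2_add l2_scale)
  moreover have "(x + y) + (-1) *\<^sub>R y = x" by (simp add: fun_eq_iff)
  moreover have "P ((-1) *\<^sub>R y) = P y" using P_scale[OF assms(2), of "-1"] by simp
  ultimately show ?thesis using P_add[OF assms] by (simp only: abs_le_iff) linarith
qed

lemma P_mono_abs:
  assumes "x \<in> l2" "y \<in> l2" "\<And>j. \<bar>x j\<bar> \<le> \<bar>y j\<bar>"
  shows "P x \<le> P y"
proof (rule LIMSEQ_le[OF M_tendsto_P[OF assms(1)] M_tendsto_P[OF assms(2)]])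
  show "\<exists>N. \<forall>n\<ge>N. M n x \<le> M n y"
    by (intro exI[of _ 0] allI impI M_mono_abs assms(3))
qed

lemma P_tail_le: "x \<in> l2 \<Longrightarrow> P (x - trunc m x) \<le> P x"
  by (rule P_mono_abs[OF tail_l2]) (simp_all add: trunc_def)

lemma coord_le_P: "x \<in> l2 \<Longrightarrow> \<bar>x j\<bar> \<le> P x"
proof -
  assume x: "x \<in> l2"
  have "\<bar>x j\<bar>\<^sup>2 \<le> (P x)\<^sup>2"
    unfolding power2_abs by (rule order_trans[OF M_sq_coord power_mono[OF M_le_P[OF x] M_nonneg]])
  then show ?thesis by (rule power2_le_imp_le) (rule P_nonneg[OF x])
qed

lemma P_trunc: "P (trunc n x) = M n x"
proof (rule LIMSEQ_unique[OF M_tendsto_P[OF trunc_l2]])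
  have "M m (trunc n x) = M n x" if "n \<le> m" for m
    using that
  proof (induction m rule: dec_induct)
    case base
    then show ?case by (rule M_trunc) simp
  next
    case (step k)
    then show ?case
      using abs_normalized_norm_axes(1)[OF Nc_norm, of k "M n x"] M_nonneg[of n x]
      by (simp add: trunc_def)
  qed
  then show "(\<lambda>m. M m (trunc n x)) \<longlonglongrightarrow> M n x"
    by (intro tendsto_eventually) (auto simp: eventually_sequentially)
qed

lemma P_sq_le: "x \<in> l2 \<Longrightarrow> (P x)\<^sup>2 \<le> ip x x"
  by (rule LIMSEQ_le_const2[OF tendsto_power[OF M_tendsto_P]])
    (auto intro: order_trans[OF M_sq_le ip_partial])

lemma P_sq_lower:
  assumes "x \<in> l2"
  shows "(M m x)\<^sup>2 + c\<^sup>2 * ip (x - trunc m x) (x - trunc m x) \<le> (P x)\<^sup>2"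
  unfolding ip_tail[OF assms]
proof (rule LIMSEQ_le)
  show "(\<lambda>n. (M m x)\<^sup>2 + c\<^sup>2 * ((\<Sum>j\<le>n. (x j)\<^sup>2) - (\<Sum>j\<le>m. (x j)\<^sup>2)))
      \<longlonglongrightarrow> (M m x)\<^sup>2 + c\<^sup>2 * (ip x x - (\<Sum>j\<le>m. (x j)\<^sup>2))"
    using assms by (intro tendsto_intros ip_lim_self)
  show "(\<lambda>n. (M n x)\<^sup>2) \<longlonglongrightarrow> (P x)\<^sup>2"
    using assms by (intro tendsto_intros M_tendsto_P)
qed (intro exI[of _ m] allI impI M_sq_increment)

lemma P_sq_ge: "x \<in> l2 \<Longrightarrow> c\<^sup>2 * ip x x \<le> (P x)\<^sup>2"
  by (rule LIMSEQ_le[OF tendsto_mult[OF tendsto_const ip_lim_self] tendsto_power[OF M_tendsto_P]])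
    (auto intro: M_sq_ge)

lemma P_sq_upper:
  assumes x: "x \<in> l2" and m: "1 \<le> m" and A: "0 < A" "(M m x)\<^sup>2 \<le> A" and B: "B m = A"
    "\<And>k. m \<le> k \<Longrightarrow> (x (Suc k))\<^sup>2 \<le> B (Suc k)"
    "\<And>k. m \<le> k \<Longrightarrow> B k + c\<^sup>2 * (x (Suc k))\<^sup>2 \<le> B (Suc k)"
    "\<And>k. m \<le> k \<Longrightarrow> B k \<le> L"
  shows "(P x)\<^sup>2 \<le> L * exp (ip x x / (real m * A))"
proof (rule LIMSEQ_le_const2[OF tendsto_power[OF M_tendsto_P[OF x]]], intro exI allI impI)
  fix n assume n: "m \<le> n"
  have "(M n x)\<^sup>2 \<le> B n * exp (((\<Sum>j\<le>n. (x j)\<^sup>2) - (\<Sum>j\<le>m. (x j)\<^sup>2)) / (real m * A))"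
    using m n A B(1-3) by (rule M_sq_upper)
  also have "\<dots> \<le> L * exp (ip x x / (real m * A))"
  proof (intro mult_mono)
    have "0 \<le> (\<Sum>j\<le>m. (x j)\<^sup>2)" by (simp add: sum_nonneg)
    then have "(\<Sum>j\<le>n. (x j)\<^sup>2) - (\<Sum>j\<le>m. (x j)\<^sup>2) \<le> ip x x" using ip_partial[OF x, of n] by linarith
    then show "exp (((\<Sum>j\<le>n. (x j)\<^sup>2) - (\<Sum>j\<le>m. (x j)\<^sup>2)) / (real m * A)) \<le> exp (ip x x / (real m * A))"
      using A m by (simp add: divide_right_mono)
    show "B n \<le> L" using B(4) n by blast
    show "0 \<le> L" using B(1) B(4)[of m] A by simp
  qed simp
  finally show "(M n x)\<^sup>2 \<le> L * exp (ip x x / (real m * A))" .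
qed

text \<open>
  The two alternatives in the maximum are the Hilbertian regime, where a tail \<open>t\<close> adds
  \<open>c\<^sup>2 ip t t\<close>, and the regime where the head of \<open>x\<close> is dominated by the tail.
\<close>

lemma P_sq_upper_tail:
  assumes x: "x \<in> l2" and m: "1 \<le> m" and A: "0 < A" "(M m x)\<^sup>2 \<le> A"
  defines "t \<equiv> x - trunc m x"
  shows "(P x)\<^sup>2 \<le> max (A + c\<^sup>2 * ip t t) ((P t)\<^sup>2) * exp (ip x x / (real m * A))"
proof (rule P_sq_upper[OF x m A])
  let ?S = "\<lambda>n. \<Sum>j\<le>n. (t j)\<^sup>2"
  let ?B = "\<lambda>k. max (A + c\<^sup>2 * ?S k) ((M k t)\<^sup>2)"
  have t: "t \<in> l2" unfolding t_def by (intro l2_diff x trunc_l2)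
  have S0: "?S m = 0" by (simp add: t_def trunc_def)
  moreover have "(M m t)\<^sup>2 \<le> 0" using M_sq_le[of m t] S0 by simp
  ultimately show "?B m = A" using A by simp
  fix k assume "m \<le> k"
  then have tk: "t (Suc k) = x (Suc k)" by (simp add: t_def trunc_def)
  show "(x (Suc k))\<^sup>2 \<le> ?B (Suc k)"
    using M_sq_coord[of t "Suc k"] tk by (simp add: le_max_iff_disj)
  have "(M k t)\<^sup>2 + c\<^sup>2 * (x (Suc k))\<^sup>2 \<le> (M (Suc k) t)\<^sup>2"
    using M_sq_increment[of k "Suc k" t] tk by simp
  then show "?B k + c\<^sup>2 * (x (Suc k))\<^sup>2 \<le> ?B (Suc k)"
    using tk by (simp add: max_def algebra_simps)
  have "c\<^sup>2 * ?S k \<le> c\<^sup>2 * ip t t" by (intro mult_left_mono ip_partial t) simp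
  moreover have "(M k t)\<^sup>2 \<le> (P t)\<^sup>2" by (intro power_mono M_le_P t M_nonneg)
  ultimately show "?B k \<le> max (A + c\<^sup>2 * ip t t) ((P t)\<^sup>2)" by (intro max.mono) auto
qed

text \<open>
  If every coordinate is small, the coordinates never dominate what is accumulated before them, and
  only the Hilbertian regime remains.
\<close>

lemma P_sq_upper_flat:
  assumes x: "x \<in> l2" and m: "1 \<le> m" and A: "0 < A" "(M m x)\<^sup>2 \<le> A"
    and flat: "\<And>j. (x j)\<^sup>2 \<le> A"
  shows "(P x)\<^sup>2 \<le> (A + c\<^sup>2 * ip x x) * exp (ip x x / (real m * A))"
proof (rule P_sq_upper[OF x m A, where B = "\<lambda>k. A + c\<^sup>2 * ((\<Sum>j\<le>k. (x j)\<^sup>2) - (\<Sum>j\<le>m. (x j)\<^sup>2))"])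
  let ?S = "\<lambda>n. \<Sum>j\<le>n. (x j)\<^sup>2"
  let ?B = "\<lambda>k. A + c\<^sup>2 * (?S k - ?S m)"
  show "?B m = A" by simp
  fix k assume k: "m \<le> k"
  have "?S m \<le> ?S (Suc k)" using k by (intro sum_mono2) auto
  then have "0 \<le> c\<^sup>2 * (?S (Suc k) - ?S m)" by simp
  then show "(x (Suc k))\<^sup>2 \<le> ?B (Suc k)" using flat[of "Suc k"] by linarith
  show "?B k + c\<^sup>2 * (x (Suc k))\<^sup>2 \<le> ?B (Suc k)" by (simp add: algebra_simps)
  have "0 \<le> ?S m" by (simp add: sum_nonneg)
  then have "c\<^sup>2 * (?S k - ?S m) \<le> c\<^sup>2 * ip x x"
    using ip_partial[OF x, of k] by (intro mult_left_mono) auto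
  then show "?B k \<le> A + c\<^sup>2 * ip x x" by simp
qed

lemma P_le_sqrt: "x \<in> l2 \<Longrightarrow> P x \<le> sqrt (ip x x)"
  using P_sq_le by (rule real_le_rsqrt)

lemma sqrt_le_P: "x \<in> l2 \<Longrightarrow> c * sqrt (ip x x) \<le> P x"
  by (rule power2_le_imp_le)
    (simp_all add: power_mult_distrib ip_nonneg P_sq_ge P_nonneg)

lemma P_tail_tendsto_0:
  assumes "x \<in> l2"
  shows "(\<lambda>m. P (x - trunc m x)) \<longlonglongrightarrow> 0"
proof (rule tendsto_sandwich[OF _ _ tendsto_const])
  show "(\<lambda>m. sqrt (ip (x - trunc m x) (x - trunc m x))) \<longlonglongrightarrow> 0"
    using tendsto_real_sqrt[OF ip_tail_tendsto_0[OF assms]] by simp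
qed (use assms in \<open>auto intro!: always_eventually P_nonneg P_le_sqrt l2_diff trunc_l2\<close>)

section \<open>Weakly null sequences in \<open>X\<^sub>c\<close>\<close>

lemma opX_l2: "bounded_op X X T \<Longrightarrow> x \<in> l2 \<Longrightarrow> T x \<in> l2"
  using bounded_opD(1)[of X X T x] by (simp add: X_vecs)

lemma opX_bound: "bounded_op X X T \<Longrightarrow> x \<in> l2 \<Longrightarrow> P (T x) \<le> opnorm X X T * P x"
  using X_normed by (intro opnorm_bound) (simp_all add: X_vecs)

lemma opX_nonneg: "bounded_op X X T \<Longrightarrow> 0 \<le> opnorm X X T"
  using X_normed by (intro opnorm_nonneg)

lemma opX_add: "bounded_op X X T \<Longrightarrow> x \<in> l2 \<Longrightarrow> y \<in> l2 \<Longrightarrow> T (x + y) = T x + T y"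
  and opX_scale: "bounded_op X X T \<Longrightarrow> x \<in> l2 \<Longrightarrow> T (a *\<^sub>R x) = a *\<^sub>R T x"
  using bounded_opD(2)[of X X T x y] bounded_opD(3)[of X X T x a] by (simp_all add: X_vecs)

lemma ip_le_P: "x \<in> l2 \<Longrightarrow> ip x x \<le> (P x / c)\<^sup>2"
  using P_sq_ge[of x] c by (simp add: power_divide le_divide_eq mult.commute)

lemma opX_ip: 
  assumes T: "bounded_op X X T" and x: "x \<in> l2"
  shows "ip (T x) (T x) \<le> (opnorm X X T / c)\<^sup>2 * ip x x"
proof -
  have "ip (T x) (T x) \<le> (P (T x) / c)\<^sup>2" by (rule ip_le_P[OF opX_l2[OF T x]])
  also have "\<dots> \<le> (opnorm X X T * sqrt (ip x x) / c)\<^sup>2"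
  proof (intro power_mono divide_right_mono)
    have "opnorm X X T * P x \<le> opnorm X X T * sqrt (ip x x)"
      using opX_nonneg[OF T] by (intro mult_left_mono P_le_sqrt x)
    then show "P (T x) \<le> opnorm X X T * sqrt (ip x x)" using opX_bound[OF T x] by linarith
  qed (use c P_nonneg[OF opX_l2[OF T x]] in auto)
  also have "\<dots> = (opnorm X X T / c)\<^sup>2 * ip x x"
    using ip_nonneg[OF x] by (simp add: power_divide power_mult_distrib)
  finally show ?thesis .
qed

text \<open>
  Weak continuity: each coordinate of \<open>T\<close> is a bounded functional on \<open>\<ell>\<^sub>2\<close>.
\<close>

lemma opX_wnull:
  assumes T: "bounded_op X X T" and w: "wnull w"
  shows "wnull (\<lambda>n. T (w n))"
proof -
  obtain C where C: "\<And>n. ip (w n) (w n) \<le> C" and wl: "\<And>n. w n \<in> l2"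
    using w by (auto simp: wnull_def)
  have "(\<lambda>n. T (w n) j) \<longlonglongrightarrow> 0" for j
  proof -
    have "bounded_op ell2 real_line (\<lambda>x. T x j)"
      unfolding bounded_op_def
    proof (intro conjI ballI allI exI)
      fix x assume x: "x \<in> l2"
      have "(T x j)\<^sup>2 \<le> (opnorm X X T / c)\<^sup>2 * ip x x"
        using ip_coord[OF opX_l2[OF T x]] opX_ip[OF T x] by (rule order_trans)
      then have "sqrt ((T x j)\<^sup>2) \<le> sqrt ((opnorm X X T / c)\<^sup>2 * ip x x)"
        by (rule real_sqrt_le_mono)
      then show "nm real_line (T x j) \<le> (opnorm X X T / c) * nm ell2 x"
        using opX_nonneg[OF T] c by (simp add: real_line_def nm_ell2 real_sqrt_mult)
    qed (simp_all add: real_line_def opX_add[OF T] opX_scale[OF T])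
    then obtain a where a: "a \<in> l2" "\<And>x. x \<in> l2 \<Longrightarrow> T x j = ip a x"
      by (rule riesz_ell2) (rule that)
    show ?thesis unfolding a(2)[OF wl] by (rule wnull_ip[OF w a(1)])
  qed
  moreover have "ip (T (w n)) (T (w n)) \<le> (opnorm X X T / c)\<^sup>2 * C" for n
    using order_trans[OF opX_ip[OF T wl] mult_left_mono[OF C]] by simp
  ultimately show ?thesis unfolding wnull_def using opX_l2[OF T wl] by auto
qed

lemma P_trunc_wnull:
  assumes w: "wnull w"
  shows "(\<lambda>n. P (trunc m (w n))) \<longlonglongrightarrow> 0"
proof (rule tendsto_sandwich[OF _ _ tendsto_const])
  have "(\<lambda>n. sqrt (\<Sum>j\<le>m. (w n j)\<^sup>2)) \<longlonglongrightarrow> sqrt (\<Sum>j\<le>m. 0\<^sup>2)"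
    using w by (intro tendsto_intros) (auto simp: wnull_def)
  then show "(\<lambda>n. sqrt (ip (trunc m (w n)) (trunc m (w n)))) \<longlonglongrightarrow> 0"
    by (simp add: ip_trunc_self)
qed (use P_nonneg[OF trunc_l2] P_le_sqrt[OF trunc_l2] in \<open>auto intro!: always_eventually\<close>)

lemma ip_shift_tendsto:
  assumes x: "x \<in> l2" and w: "wnull w" and a: "(\<lambda>n. ip (w n) (w n)) \<longlonglongrightarrow> a"
  shows "(\<lambda>n. ip (x + w n) (x + w n)) \<longlonglongrightarrow> ip x x + a"
proof -
  have wl: "w n \<in> l2" for n using w by (simp add: wnull_def)
  have "(\<lambda>n. ip x x + 2 * ip x (w n) + ip (w n) (w n)) \<longlonglongrightarrow> ip x x + 2 * 0 + a"
    by (intro tendsto_intros a wnull_ip w x)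
  then show ?thesis by (simp add: ip_add_self x wl)
qed

text \<open>
  The vector \<open>y\<close> is a sum of \<open>k\<close> members of the sequence with rapidly increasing indices. Such members
  and their images are nearly orthogonal, so squared \<open>\<ell>\<^sub>2\<close> norms add up, whereas at each
  coordinate at most one summand is not negligible, so the coordinates stay bounded independently
  of \<open>k\<close> apart from the error \<open>k d\<close>.
\<close>

lemma sums_of_weakly_null:
  assumes T: "bounded_op X X T" and w: "wnull w" and C: "\<And>n. ip (w n) (w n) \<le> C"
    and a: "(\<lambda>n. ip (w n) (w n)) \<longlonglongrightarrow> a"
    and b: "(\<lambda>n. ip (T (w n)) (T (w n))) \<longlonglongrightarrow> b" and d: "0 < d"
  shows "\<exists>y\<in>l2. ip y y \<le> real k * (a + d) \<and> real k * (b - d) \<le> ip (T y) (T y) \<and>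
    (\<forall>j. \<bar>y j\<bar> \<le> sqrt C + real k * d) \<and> P (trunc m y) \<le> real k * d"
proof (induction k)
  case 0
  have wl: "w n \<in> l2" for n using w by (simp add: wnull_def)
  have C0: "0 \<le> C" using order_trans[OF ip_nonneg[OF wl] C] .
  have "trunc m (0 :: nat \<Rightarrow> real) = 0" by (simp add: trunc_def fun_eq_iff)
  then have P0: "P (trunc m 0) = 0" using P_eq_0[OF zero_l2] by simp
  have ip0: "ip 0 0 = 0" by (simp add: ip_def)
  show ?case
  proof (intro bexI[of _ "0 :: nat \<Rightarrow> real"] conjI allI)
    show "ip 0 0 \<le> real 0 * (a + d)" by (simp only: ip0 of_nat_0 mult_zero_left order_refl)
    show "real 0 * (b - d) \<le> ip (T 0) (T 0)"
      unfolding of_nat_0 mult_zero_left by (rule ip_nonneg[OF opX_l2[OF T zero_l2]])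
    show "\<bar>(0 :: nat \<Rightarrow> real) j\<bar> \<le> sqrt C + real 0 * d" for j using C0 by simp
    show "P (trunc m 0) \<le> real 0 * d" by (simp only: P0 of_nat_0 mult_zero_left order_refl)
  qed (rule zero_l2)
next
  case (Suc k)
  then obtain y where y: "y \<in> l2" and yk: "ip y y \<le> real k * (a + d) \<and>
      real k * (b - d) \<le> ip (T y) (T y) \<and>
      (\<forall>j. \<bar>y j\<bar> \<le> sqrt C + real k * d) \<and> P (trunc m y) \<le> real k * d"
    by (elim bexE)
  have y1: "ip y y \<le> real k * (a + d)" and y2: "real k * (b - d) \<le> ip (T y) (T y)"
    and y3: "\<And>j. \<bar>y j\<bar> \<le> sqrt C + real k * d" and y4: "P (trunc m y) \<le> real k * d"
    using yk by (elim conjE, simp only:)+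
  have wl: "w n \<in> l2" for n using w by (simp add: wnull_def)
  have "\<forall>\<^sub>F J in sequentially. ip (y - trunc J y) (y - trunc J y) < d\<^sup>2"
    using d by (intro order_tendstoD(2)[OF ip_tail_tendsto_0[OF y]]) simp
  then obtain J where J: "ip (y - trunc J y) (y - trunc J y) < d\<^sup>2"
    by (rule sequentially_exE)
  have yJ: "\<bar>y j\<bar> \<le> d" if "J < j" for j
  proof -
    have "(y - trunc J y) j = y j" using that by (simp add: trunc_def)
    moreover have "((y - trunc J y) j)\<^sup>2 \<le> d\<^sup>2"
      using order_le_less_trans[OF ip_coord[OF l2_diff[OF y trunc_l2]] J] by (rule less_imp_le)
    ultimately have "\<bar>y j\<bar>\<^sup>2 \<le> d\<^sup>2" by (simp only: power2_abs)
    then show ?thesis by (rule power2_le_imp_le) (use d in simp)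
  qed
  have "\<forall>\<^sub>F n in sequentially. ip (y + w n) (y + w n) < ip y y + a + d"
    using d by (intro order_tendstoD(2)[OF ip_shift_tendsto[OF y w a]]) simp
  moreover have "\<forall>\<^sub>F n in sequentially. ip (T y) (T y) + b - d < ip (T y + T (w n)) (T y + T (w n))"
    using d by (intro order_tendstoD(1)[OF ip_shift_tendsto[OF opX_l2[OF T y] opX_wnull[OF T w] b]]) simp
  moreover have "\<forall>\<^sub>F n in sequentially. \<forall>j\<in>{..J}. \<bar>w n j\<bar> < d"
  proof (intro eventually_ball_finite ballI)
    fix j
    have "(\<lambda>n. \<bar>w n j\<bar>) \<longlonglongrightarrow> 0" using w by (intro tendsto_rabs_zero) (simp add: wnull_def)
    then show "\<forall>\<^sub>F n in sequentially. \<bar>w n j\<bar> < d" using d by (rule order_tendstoD(2))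
  qed simp
  moreover have "\<forall>\<^sub>F n in sequentially. P (trunc m (w n)) < d"
    using P_trunc_wnull[OF w] d by (rule order_tendstoD(2))
  ultimately have "\<forall>\<^sub>F n in sequentially. ip (y + w n) (y + w n) < ip y y + a + d \<and>
      ip (T y) (T y) + b - d < ip (T y + T (w n)) (T y + T (w n)) \<and>
      (\<forall>j\<in>{..J}. \<bar>w n j\<bar> < d) \<and> P (trunc m (w n)) < d"
    by eventually_elim simp
  then obtain n where nn: "ip (y + w n) (y + w n) < ip y y + a + d \<and>
      ip (T y) (T y) + b - d < ip (T y + T (w n)) (T y + T (w n)) \<and>
      (\<forall>j\<in>{..J}. \<bar>w n j\<bar> < d) \<and> P (trunc m (w n)) < d"
    by (rule sequentially_exE)
  then have n: "ip (y + w n) (y + w n) < ip y y + a + d"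
      "ip (T y) (T y) + b - d < ip (T y + T (w n)) (T y + T (w n))"
      "\<And>j. j \<le> J \<Longrightarrow> \<bar>w n j\<bar> < d" "P (trunc m (w n)) < d"
    by (simp_all only: atMost_iff Ball_def)
  have wC: "\<bar>w n j\<bar> \<le> sqrt C" for j
    using order_trans[OF ip_coord[OF wl[of n], of j] C] by (simp add: real_le_rsqrt)
  have kd: "0 \<le> real k * d" using d by simp
  have Sk: "real (Suc k) * r = real k * r + r" for r by (simp add: algebra_simps)
  show ?case
  proof (intro bexI conjI allI)
    show "y + w n \<in> l2" by (intro l2_add y wl)
    show "ip (y + w n) (y + w n) \<le> real (Suc k) * (a + d)" unfolding Sk using n(1) y1 by linarith
    show "real (Suc k) * (b - d) \<le> ip (T (y + w n)) (T (y + w n))"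
      unfolding Sk opX_add[OF T y wl] using n(2) y2 by linarith
    show "P (trunc m (y + w n)) \<le> real (Suc k) * d"
      unfolding Sk trunc_add using P_add[OF trunc_l2 trunc_l2, of m y m "w n"] n(4) y4 by linarith
    show "\<bar>(y + w n) j\<bar> \<le> sqrt C + real (Suc k) * d" for j
    proof (cases "j \<le> J")
      case True
      then show ?thesis
        unfolding Sk plus_fun_apply
        using y3[of j] n(3)[of j] abs_triangle_ineq[of "y j" "w n j"] by linarith
    next
      case False
      then show ?thesis
        unfolding Sk plus_fun_apply
        using yJ[of j] wC[of j] kd abs_triangle_ineq[of "y j" "w n j"] by linarith
    qed
  qed
qed

text \<open>
  For the sums \<open>y\<close> of \<open>k\<close> members of the sequence, \<open>c\<^sup>2 \<parallel>T y\<parallel>\<^sub>2\<^sup>2 \<le> \<parallel>T y\<parallel>\<^sup>2 \<le> \<parallel>T\<parallel>\<^sup>2 \<parallel>y\<parallel>\<^sup>2\<close>, and after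
  division by \<open>k\<close> the left side tends to \<open>c\<^sup>2 b\<close>. The squares of the coordinates of \<open>y\<close> are negligible
  compared with \<open>k\<close>, so by flatness \<open>\<parallel>y\<parallel>\<^sup>2 / k\<close> is close to \<open>c\<^sup>2 a\<close>.
\<close>

lemma asymptotic_contraction:
  assumes T: "bounded_op X X T" and w: "wnull w"
    and a: "(\<lambda>n. ip (w n) (w n)) \<longlonglongrightarrow> a"
    and b: "(\<lambda>n. ip (T (w n)) (T (w n))) \<longlonglongrightarrow> b"
  shows "b \<le> (opnorm X X T)\<^sup>2 * a"
proof -
  let ?L = "opnorm X X T"
  obtain C where C: "\<And>n. ip (w n) (w n) \<le> C" and wl: "\<And>n. w n \<in> l2"
    using w by (auto simp: wnull_def)
  have a0: "0 \<le> a" using LIMSEQ_le_const[OF a] ip_nonneg[OF wl] by simp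
  have C0: "0 \<le> C" using order_trans[OF ip_nonneg[OF wl] C] .
  have main: "c\<^sup>2 * (b - h) \<le> ?L\<^sup>2 * ((h + c\<^sup>2 * (a + h)) * (1 + h))" if h: "0 < h" "h \<le> 1" for h
  proof -
    have "(\<lambda>m. exp ((a + 1) / h * inverse (real (Suc m)))) \<longlonglongrightarrow> exp ((a + 1) / h * 0)"
      by (intro tendsto_intros LIMSEQ_inverse_real_of_nat)
    then have "\<forall>\<^sub>F m in sequentially. exp ((a + 1) / h * inverse (real (Suc m))) < 1 + h"
      using h by (intro order_tendstoD(2)) auto
    then obtain m' where "exp ((a + 1) / h * inverse (real (Suc m'))) < 1 + h"
      by (rule sequentially_exE)
    then obtain m where m: "1 \<le> m" "exp ((a + 1) / (real m * h)) < 1 + h"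
      by (intro that[of "Suc m'"]) (auto simp: divide_simps mult.commute)
    \<comment> \<open>the coordinates of the sum will be at most \<open>sqrt C + 1\<close>, so its squared coordinates are below \<open>k h\<close>\<close>
    obtain k where k: "(sqrt C + 1)\<^sup>2 / h < real k" using reals_Archimedean2 by metis
    have "1\<^sup>2 \<le> (sqrt C + 1)\<^sup>2" using C0 by (intro power_mono) auto
    moreover have kh: "(sqrt C + 1)\<^sup>2 < real k * h" using k h by (simp add: divide_less_eq)
    ultimately have kh1: "1 < real k * h" by simp
    have k0: "0 < real k" using kh1 by (cases k) auto
    \<comment> \<open>the errors of the \<open>k\<close> summands add up to at most \<open>1\<close>\<close>
    define d where "d = min h (1 / real k)"
    have d: "0 < d" "d \<le> h" "real k * d \<le> 1"
      using h k0 by (auto simp: d_def min_def field_simps)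
    obtain y where y: "y \<in> l2" and yk: "ip y y \<le> real k * (a + d) \<and>
        real k * (b - d) \<le> ip (T y) (T y) \<and>
        (\<forall>j. \<bar>y j\<bar> \<le> sqrt C + real k * d) \<and> P (trunc m y) \<le> real k * d"
      using sums_of_weakly_null[OF T w C a b d(1), of k m] by (elim bexE)
    have y1: "ip y y \<le> real k * (a + d)" and y2: "real k * (b - d) \<le> ip (T y) (T y)"
      and y3: "\<And>j. \<bar>y j\<bar> \<le> sqrt C + real k * d" and y4: "P (trunc m y) \<le> real k * d"
      using yk by (elim conjE, simp only:)+
    have flat: "(y j)\<^sup>2 \<le> real k * h" for j
    proof -
      have "\<bar>y j\<bar>\<^sup>2 \<le> (sqrt C + 1)\<^sup>2" using y3[of j] d(3) by (intro power_mono) auto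
      then show ?thesis using kh by simp
    qed
    have M: "(M m y)\<^sup>2 \<le> real k * h"
    proof -
      have "(M m y)\<^sup>2 \<le> 1"
        using y4 d(3) P_trunc[of m y] M_nonneg[of m y] by (intro power_le_one) auto
      then show ?thesis using kh1 by linarith
    qed
    have ka: "ip y y \<le> real k * (a + h)" "ip y y \<le> real k * (a + 1)"
      using y1 mult_left_mono[of "a + d" "a + h" "real k"] mult_left_mono[of "a + d" "a + 1" "real k"] d h
      by linarith+
    have "(P y)\<^sup>2 \<le> (real k * h + c\<^sup>2 * ip y y) * exp (ip y y / (real m * (real k * h)))"
      using kh1 by (intro P_sq_upper_flat[OF y m(1) _ M flat]) simp
    also have "\<dots> \<le> (real k * h + c\<^sup>2 * (real k * (a + h))) * (1 + h)"
    proof (rule mult_mono)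
      show "real k * h + c\<^sup>2 * ip y y \<le> real k * h + c\<^sup>2 * (real k * (a + h))"
        by (intro add_left_mono mult_left_mono ka) simp
      have "ip y y / (real m * (real k * h)) \<le> real k * (a + 1) / (real m * (real k * h))"
        using h ka by (intro divide_right_mono) auto
      also have "\<dots> = (a + 1) / (real m * h)" using k0 by simp
      finally have "exp (ip y y / (real m * (real k * h))) \<le> exp ((a + 1) / (real m * h))" by simp
      then show "exp (ip y y / (real m * (real k * h))) \<le> 1 + h" using m(2) by linarith
      show "0 \<le> real k * h + c\<^sup>2 * (real k * (a + h))" using h a0 by simp
    qed simp
    finally have Py: "(P y)\<^sup>2 \<le> real k * ((h + c\<^sup>2 * (a + h)) * (1 + h))"
      by (simp add: algebra_simps)
    have "c\<^sup>2 * (real k * (b - h)) \<le> c\<^sup>2 * (real k * (b - d))"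
      using d by (intro mult_left_mono) auto
    also have "\<dots> \<le> c\<^sup>2 * ip (T y) (T y)" using y2 by (intro mult_left_mono) auto
    also have "\<dots> \<le> (P (T y))\<^sup>2" by (rule P_sq_ge[OF opX_l2[OF T y]])
    also have "\<dots> \<le> (?L * P y)\<^sup>2"
      by (rule power_mono[OF opX_bound[OF T y] P_nonneg[OF opX_l2[OF T y]]])
    also have "\<dots> = ?L\<^sup>2 * (P y)\<^sup>2" by (rule power_mult_distrib)
    also have "\<dots> \<le> ?L\<^sup>2 * (real k * ((h + c\<^sup>2 * (a + h)) * (1 + h)))"
      by (intro mult_left_mono Py) simp
    finally have "real k * (c\<^sup>2 * (b - h)) \<le> real k * (?L\<^sup>2 * ((h + c\<^sup>2 * (a + h)) * (1 + h)))"
      by (metis mult.left_commute)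
    then show ?thesis using k0 by (simp only: mult_le_cancel_left_pos)
  qed
  have "c\<^sup>2 * (b - 0) \<le> ?L\<^sup>2 * ((0 + c\<^sup>2 * (a + 0)) * (1 + 0))"
  proof (rule LIMSEQ_le)
    show "(\<lambda>i. c\<^sup>2 * (b - inverse (real (Suc i)))) \<longlonglongrightarrow> c\<^sup>2 * (b - 0)"
      by (intro tendsto_intros LIMSEQ_inverse_real_of_nat)
    show "(\<lambda>i. ?L\<^sup>2 * ((inverse (real (Suc i)) + c\<^sup>2 * (a + inverse (real (Suc i)))) * (1 + inverse (real (Suc i)))))
        \<longlonglongrightarrow> ?L\<^sup>2 * ((0 + c\<^sup>2 * (a + 0)) * (1 + 0))"
      by (intro tendsto_intros LIMSEQ_inverse_real_of_nat)
  qed (intro exI allI impI main; simp add: field_simps)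
  then have "c\<^sup>2 * b \<le> c\<^sup>2 * (?L\<^sup>2 * a)" by (simp add: mult_ac)
  then show ?thesis using c by (simp add: mult_le_cancel_left)
qed

section \<open>The compact perturbation property\<close>

lemma M_shift_tendsto:
  assumes x: "x \<in> l2" and w: "wnull w"
  shows "(\<lambda>n. M m (x + w n)) \<longlonglongrightarrow> M m x"
proof (rule LIM_zero_cancel, rule Lim_null_comparison)
  show "\<forall>\<^sub>F n in sequentially. norm (M m (x + w n) - M m x)
      \<le> P (trunc m (w n))"
    unfolding P_trunc[symmetric] trunc_add real_norm_def
    by (intro always_eventually allI P_diff_bound[OF trunc_l2 trunc_l2])
  show "(\<lambda>n. P (trunc m (w n))) \<longlonglongrightarrow> 0"
    by (rule P_trunc_wnull[OF w])
qed

lemma ip_tail_shift_tendsto: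
  assumes x: "x \<in> l2" and w: "wnull w" and a: "(\<lambda>n. ip (w n) (w n)) \<longlonglongrightarrow> a"
  shows "(\<lambda>n. ip (x + w n - trunc m (x + w n)) (x + w n - trunc m (x + w n)))
    \<longlonglongrightarrow> ip (x - trunc m x) (x - trunc m x) + a"
proof -
  have "(\<lambda>n. ip (x + w n) (x + w n) - (\<Sum>j\<le>m. ((x + w n) j)\<^sup>2)) \<longlonglongrightarrow> (ip x x + a) - (\<Sum>j\<le>m. (x j + 0)\<^sup>2)"
    using w unfolding plus_fun_apply
    by (intro tendsto_diff[OF ip_shift_tendsto[OF x w a, unfolded plus_fun_def]] tendsto_intros)
      (simp add: wnull_def)
  then show ?thesis
    unfolding ip_tail[OF x] ip_tail[OF l2_add[OF x wnullD[OF w]]] by (simp add: algebra_simps)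
qed

text \<open>
  Every coordinate adds at least \<open>c\<^sup>2\<close> times its square to the squared norm. The weakly null part is
  eventually beyond any index \<open>m\<close>, whereas the norm of \<open>x\<close> is almost exhausted before \<open>m\<close>.
\<close>

lemma P_sq_asymptotic_lower:
  assumes x: "x \<in> l2" and w: "wnull w" and a: "(\<lambda>n. ip (w n) (w n)) \<longlonglongrightarrow> a"
    and bd: "\<And>n. P (x + w n) \<le> 1"
  shows "(P x)\<^sup>2 + c\<^sup>2 * a \<le> 1"
proof -
  have "(M m x)\<^sup>2 + c\<^sup>2 * (ip (x - trunc m x) (x - trunc m x) + a) \<le> 1" for m
  proof (rule LIMSEQ_le_const2)
    show "(\<lambda>n. (M m (x + w n))\<^sup>2
          + c\<^sup>2 * ip (x + w n - trunc m (x + w n)) (x + w n - trunc m (x + w n)))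
        \<longlonglongrightarrow> (M m x)\<^sup>2 + c\<^sup>2 * (ip (x - trunc m x) (x - trunc m x) + a)"
      by (intro tendsto_intros M_shift_tendsto[OF x w] ip_tail_shift_tendsto[OF x w a])
    have "(P (x + w n))\<^sup>2 \<le> 1" for n
      using bd[of n] P_nonneg[OF l2_add[OF x wnullD[OF w]]] by (intro power_le_one)
    then show "\<exists>N. \<forall>n\<ge>N. (M m (x + w n))\<^sup>2
        + c\<^sup>2 * ip (x + w n - trunc m (x + w n)) (x + w n - trunc m (x + w n)) \<le> 1"
      by (intro exI[of _ 0] allI impI order_trans[OF P_sq_lower[OF l2_add[OF x wnullD[OF w]]]])
  qed
  then have "(P x)\<^sup>2 + c\<^sup>2 * (0 + a) \<le> 1"
    by (intro LIMSEQ_le_const2[OF tendsto_add[OF tendsto_power[OF M_tendsto_P[OF x]]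
          tendsto_mult[OF tendsto_const tendsto_add[OF ip_tail_tendsto_0[OF x] tendsto_const]]]]
        exI allI impI)
  then show ?thesis by simp
qed

text \<open>
  Far tails of \<open>x + w n\<close> are no longer than \<open>x + w n\<close> itself and are close to \<open>w n\<close>.
\<close>

lemma P_wnull_eventually_le:
  assumes x: "x \<in> l2" and w: "wnull w" and bd: "\<And>n. P (x + w n) \<le> R" and e: "0 < e"
  shows "\<forall>\<^sub>F n in sequentially. P (w n) \<le> R + e"
proof -
  have "\<forall>\<^sub>F m in sequentially. P (x - trunc m x) < e / 2"
    using e by (intro order_tendstoD(2)[OF P_tail_tendsto_0[OF x]]) simp
  then obtain m where m: "P (x - trunc m x) < e / 2" by (rule sequentially_exE)
  have "\<forall>\<^sub>F n in sequentially. P (trunc m (w n)) < e / 2"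
    using e by (intro order_tendstoD(2)[OF P_trunc_wnull[OF w]]) simp
  then show ?thesis
  proof (rule eventually_mono)
    fix n assume n: "P (trunc m (w n)) < e / 2"
    let ?y = "x + w n"
    have y: "?y \<in> l2" by (rule l2_add[OF x wnullD[OF w]])
    have "w n = (trunc m (w n) + (?y - trunc m ?y)) + (-1) *\<^sub>R (x - trunc m x)"
      unfolding tail_add by (simp add: fun_eq_iff)
    then have "P (w n) = P ((trunc m (w n) + (?y - trunc m ?y)) + (-1) *\<^sub>R (x - trunc m x))"
      by (rule arg_cong)
    also have "\<dots> \<le> P (trunc m (w n) + (?y - trunc m ?y)) + P ((-1) *\<^sub>R (x - trunc m x))"
      by (rule P_add[OF l2_add[OF trunc_l2 tail_l2[OF y]] l2_scale[OF tail_l2[OF x]]])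
    also have "P ((-1) *\<^sub>R (x - trunc m x)) = P (x - trunc m x)"
      using P_scale[OF tail_l2[OF x], of "-1"] by simp
    finally show "P (w n) \<le> R + e"
      using P_add[OF trunc_l2 tail_l2[OF y], of m "w n" m] P_tail_le[OF y, of m] bd[of n] m n
      by linarith
  qed
qed

text \<open>
  The hypothesis \<open>r < l\<close> excludes the second alternative of \<open>P_sq_upper_tail\<close>. The slack \<open>d\<close> in the
  proof keeps the accumulated norm bounded away from \<open>0\<close>, so that \<open>z = 0\<close> needs no separate treatment.
\<close>

lemma P_sq_asymptotic_upper:
  assumes z: "z \<in> l2" and v: "wnull v" and b: "(\<lambda>n. ip (v n) (v n)) \<longlonglongrightarrow> b"
    and l: "(\<lambda>n. P (z + v n)) \<longlonglongrightarrow> l"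
    and r: "0 \<le> r" "r < l" "\<forall>\<^sub>F n in sequentially. P (v n) \<le> r"
  shows "l\<^sup>2 \<le> (P z)\<^sup>2 + c\<^sup>2 * b"
proof (rule field_le_epsilon)
  fix d :: real assume d: "0 < d"
  define A where "A = (P z)\<^sup>2 + d"
  have A: "0 < A" unfolding A_def using d by (intro add_nonneg_pos) auto
  have bound: "l\<^sup>2 \<le> max (A + c\<^sup>2 * (ip (z - trunc m z) (z - trunc m z) + b)) ((P (z - trunc m z) + r)\<^sup>2)
      * exp ((ip z z + b) / (real m * A))" if m: "1 \<le> m" for m
  proof (rule tendsto_le[OF sequentially_bot])
    show "(\<lambda>n. (P (z + v n))\<^sup>2) \<longlonglongrightarrow> l\<^sup>2" by (intro tendsto_intros l)
    let ?t = "\<lambda>n. z + v n - trunc m (z + v n)"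
    show "(\<lambda>n. max (A + c\<^sup>2 * ip (?t n) (?t n)) ((P (z - trunc m z) + r)\<^sup>2)
          * exp (ip (z + v n) (z + v n) / (real m * A)))
        \<longlonglongrightarrow> max (A + c\<^sup>2 * (ip (z - trunc m z) (z - trunc m z) + b)) ((P (z - trunc m z) + r)\<^sup>2)
          * exp ((ip z z + b) / (real m * A))"
      using A m by (intro tendsto_intros ip_tail_shift_tendsto[OF z v b] ip_shift_tendsto[OF z v b]) auto
    have "(M m z)\<^sup>2 \<le> (P z)\<^sup>2"
      by (rule power_mono[OF M_le_P[OF z] M_nonneg])
    then have "\<forall>\<^sub>F n in sequentially. (M m (z + v n))\<^sup>2 < A"
      using d by (intro order_tendstoD(2)[OF tendsto_power[OF M_shift_tendsto[OF z v]]]) (simp add: A_def)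
    then show "\<forall>\<^sub>F n in sequentially. (P (z + v n))\<^sup>2
        \<le> max (A + c\<^sup>2 * ip (?t n) (?t n)) ((P (z - trunc m z) + r)\<^sup>2)
          * exp (ip (z + v n) (z + v n) / (real m * A))"
      using r(3)
    proof eventually_elim
      case (elim n)
      have y: "z + v n \<in> l2" by (rule l2_add[OF z wnullD[OF v]])
      have "P (?t n) \<le> P (z - trunc m z) + P (v n - trunc m (v n))"
        unfolding tail_add by (rule P_add[OF tail_l2[OF z] tail_l2[OF wnullD[OF v]]])
      also have "\<dots> \<le> P (z - trunc m z) + r"
        using P_tail_le[OF wnullD[OF v], of n m] elim(2) by linarith
      finally have "(P (?t n))\<^sup>2 \<le> (P (z - trunc m z) + r)\<^sup>2"
        by (rule power_mono[OF _ P_nonneg[OF tail_l2[OF y]]])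
      then have "max (A + c\<^sup>2 * ip (?t n) (?t n)) ((P (?t n))\<^sup>2) * exp (ip (z + v n) (z + v n) / (real m * A))
          \<le> max (A + c\<^sup>2 * ip (?t n) (?t n)) ((P (z - trunc m z) + r)\<^sup>2) * exp (ip (z + v n) (z + v n) / (real m * A))"
        by (intro mult_right_mono max.mono) auto
      then show ?case
        using P_sq_upper_tail[OF y m A less_imp_le[OF elim(1)]] by linarith
    qed
  qed
  have "l\<^sup>2 \<le> max (A + c\<^sup>2 * (0 + b)) ((0 + r)\<^sup>2) * exp ((ip z z + b) / A * 0)"
  proof (rule LIMSEQ_le_const)
    show "(\<lambda>i. max (A + c\<^sup>2 * (ip (z - trunc (Suc i) z) (z - trunc (Suc i) z) + b)) ((P (z - trunc (Suc i) z) + r)\<^sup>2)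
        * exp ((ip z z + b) / A * inverse (real (Suc i)))) \<longlonglongrightarrow>
        max (A + c\<^sup>2 * (0 + b)) ((0 + r)\<^sup>2) * exp ((ip z z + b) / A * 0)"
      by (intro tendsto_intros LIMSEQ_inverse_real_of_nat LIMSEQ_Suc[OF ip_tail_tendsto_0[OF z]]
          LIMSEQ_Suc[OF P_tail_tendsto_0[OF z]])
    have "(ip z z + b) / (real (Suc i) * A) = (ip z z + b) / A * inverse (real (Suc i))" for i
      by (simp add: field_simps)
    then show "\<exists>N. \<forall>i\<ge>N. l\<^sup>2 \<le>
        max (A + c\<^sup>2 * (ip (z - trunc (Suc i) z) (z - trunc (Suc i) z) + b)) ((P (z - trunc (Suc i) z) + r)\<^sup>2)
        * exp ((ip z z + b) / A * inverse (real (Suc i)))"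
      using bound[of "Suc i" for i] by (intro exI[of _ 0] allI impI) (metis le_add1 plus_1_eq_Suc)
  qed
  moreover have "r\<^sup>2 < l\<^sup>2" using r(1,2) by (intro power_strict_mono) auto
  ultimately show "l\<^sup>2 \<le> (P z)\<^sup>2 + c\<^sup>2 * b + d" by (simp add: A_def max_def split: if_splits)
qed

lemma norm_limit_of_wnull:
  assumes v: "wnull v" and q: "q \<in> l2" and lim: "(\<lambda>n. P (v n - q)) \<longlonglongrightarrow> 0"
  shows "q = 0"
proof (rule ext)
  fix j
  have "(\<lambda>n. (v n - q) j) \<longlonglongrightarrow> 0"
  proof (rule Lim_null_comparison)
    have "\<bar>(v n - q) j\<bar> \<le> P (v n - q) / c" for n
    proof -
      have u: "v n - q \<in> l2" by (rule l2_diff[OF wnullD[OF v] q])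
      have "\<bar>(v n - q) j\<bar>\<^sup>2 \<le> (P (v n - q) / c)\<^sup>2"
        unfolding power2_abs by (rule order_trans[OF ip_coord[OF u] ip_le_P[OF u]])
      then show ?thesis
        by (rule power2_le_imp_le) (use P_nonneg[OF u] c in simp)
    qed
    then show "\<forall>\<^sub>F n in sequentially. norm ((v n - q) j) \<le> P (v n - q) / c"
      by (intro always_eventually allI) (simp only: real_norm_def)
    show "(\<lambda>n. P (v n - q) / c) \<longlonglongrightarrow> 0"
      using tendsto_divide[OF lim tendsto_const, of c] c by simp
  qed
  moreover have "(\<lambda>n. (v n - q) j) \<longlonglongrightarrow> 0 - q j"
    unfolding minus_apply using v by (intro tendsto_intros) (simp add: wnull_def)
  ultimately have "0 = 0 - q j" by (rule LIMSEQ_unique)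
  then show "q j = 0 j" by simp
qed

text \<open>
  A norm convergent subsequence exists by compactness, and the coordinates leave \<open>0\<close> as the only
  possible limit.
\<close>

lemma compact_op_wnull:
  assumes K: "compact_op X X K" and s: "\<And>n. s n \<in> ball_of X" and x: "x \<in> l2"
    and w: "wnull (\<lambda>n. s n - x)"
  obtains r where "strict_mono r" "(\<lambda>n. P (K (s (r n) - x))) \<longlonglongrightarrow> 0"
proof -
  have Kb: "bounded_op X X K"
    using K unfolding compact_op_def by (rule conjunct1)
  have "\<forall>n. s n \<in> ball_of X" using s by (rule allI)
  then have "\<exists>r y. strict_mono r \<and> y \<in> vecs X \<and> converges_in X (\<lambda>n. K (s (r n))) y"
    using K[unfolded compact_op_def, THEN conjunct2, THEN spec[of _ s]] by (rule rev_mp)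
  then obtain r y where r: "strict_mono r" and y: "y \<in> vecs X"
    and lim: "converges_in X (\<lambda>n. K (s (r n))) y"
    by (elim exE conjE)
  have yl: "y \<in> l2" using y by (simp only: X_vecs)
  have wl: "s n - x \<in> l2" for n by (rule wnullD[OF w])
  have Ks: "K (s n) = K (s n - x) + K x" for n
  proof -
    have "K ((s n - x) + x) = K (s n - x) + K x" by (rule opX_add[OF Kb wl x])
    then show ?thesis by simp
  qed
  have eq: "K (s (r n) - x) - (y - K x) = K (s (r n)) - y" for n
    unfolding Ks[of "r n"] by (simp add: fun_eq_iff)
  have lim': "(\<lambda>n. P (K (s (r n) - x) - (y - K x))) \<longlonglongrightarrow> 0"
    using lim unfolding eq converges_in_def .
  have "y - K x = 0"
    by (rule norm_limit_of_wnull[OF opX_wnull[OF Kb wnull_subseq[OF w r]]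
          l2_diff[OF yl opX_l2[OF Kb x]] lim'])
  then have "(\<lambda>n. P (K (s (r n) - x))) \<longlonglongrightarrow> 0" using lim' by (simp only: diff_zero)
  with r show ?thesis by (rule that)
qed

lemma wnull_norm_convergent_subseq:
  assumes "wnull w"
  obtains r a where "strict_mono r" "(\<lambda>n. ip (w (r n)) (w (r n))) \<longlonglongrightarrow> a"
proof -
  obtain C where C: "\<And>n. ip (w n) (w n) \<le> C" using assms by (auto simp: wnull_def)
  have "\<bar>ip (w n) (w n)\<bar> \<le> C" for n using C[of n] ip_nonneg[OF wnullD[OF assms], of n] by simp
  then have "bounded (range (\<lambda>n. ip (w n) (w n)))"
    unfolding bounded_iff by (intro exI[of _ C]) auto
  then obtain a r where "strict_mono r" "((\<lambda>n. ip (w n) (w n)) \<circ> r) \<longlonglongrightarrow> a"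
    using bounded_imp_convergent_subsequence by metis
  then show ?thesis by (intro that[of r a]) (simp_all only: o_def)
qed

lemma bounded_op_plus:
  assumes T: "bounded_op X X T" and K: "bounded_op X X K"
  shows "bounded_op X X (\<lambda>x. T x + K x)"
  unfolding bounded_op_def X_vecs
proof (intro conjI ballI allI exI)
  fix x assume x: "x \<in> l2"
  note Tx = opX_l2[OF T x] and Kx = opX_l2[OF K x]
  show "T x + K x \<in> l2" by (rule l2_add[OF Tx Kx])
  show "P (T x + K x) \<le> (opnorm X X T + opnorm X X K) * P x"
    using P_add[OF Tx Kx] opX_bound[OF T x] opX_bound[OF K x] by (simp add: distrib_right)
  show "T (a *\<^sub>R x) + K (a *\<^sub>R x) = a *\<^sub>R (T x + K x)" for a
    unfolding opX_scale[OF T x] opX_scale[OF K x] by (rule scaleR_right_distrib[symmetric])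
  fix y assume y: "y \<in> l2"
  show "T (x + y) + K (x + y) = T x + K x + (T y + K y)"
    unfolding opX_add[OF T x y] opX_add[OF K x y] by (simp only: ac_simps)
qed

lemma ip_perturbation_tendsto:
  assumes u: "wnull u" and b: "(\<lambda>n. ip (u n) (u n)) \<longlonglongrightarrow> b"
    and v: "\<And>n. v n \<in> l2" "(\<lambda>n. P (v n)) \<longlonglongrightarrow> 0"
  shows "(\<lambda>n. ip (u n + v n) (u n + v n)) \<longlonglongrightarrow> b"
proof -
  have vv: "(\<lambda>n. ip (v n) (v n)) \<longlonglongrightarrow> 0"
  proof (rule tendsto_sandwich[OF _ _ tendsto_const])
    show "(\<lambda>n. (P (v n) / c)\<^sup>2) \<longlonglongrightarrow> 0"
      using tendsto_power[OF tendsto_divide[OF v(2) tendsto_const, of c], of 2] c by simp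
  qed (intro always_eventually allI ip_nonneg ip_le_P v(1))+
  have "(\<lambda>n. sqrt (ip (u n) (u n)) * sqrt (ip (v n) (v n))) \<longlonglongrightarrow> sqrt b * sqrt 0"
    by (intro tendsto_intros b vv)
  then have "(\<lambda>n. sqrt (ip (u n) (u n)) * sqrt (ip (v n) (v n))) \<longlonglongrightarrow> 0" by simp
  then have uv: "(\<lambda>n. ip (u n) (v n)) \<longlonglongrightarrow> 0"
    by (rule Lim_null_comparison[rotated])
      (intro always_eventually allI, unfold real_norm_def, rule ip_Cauchy_Schwarz[OF wnullD[OF u] v(1)])
  have "(\<lambda>n. ip (u n) (u n) + 2 * ip (u n) (v n) + ip (v n) (v n)) \<longlonglongrightarrow> b + 2 * 0 + 0"
    by (intro tendsto_intros b uv vv)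
  then show ?thesis by (simp add: ip_add_self[OF wnullD[OF u] v(1)])
qed

text \<open>
  The proof passes to four subsequences in turn: for the weak limit of the maximizing sequence,
  for the convergence of \<open>K w\<close> to \<open>0\<close>, and for the convergence of the squared \<open>\<ell>\<^sub>2\<close> norms of \<open>w\<close> and
  of \<open>T w\<close>.
\<close>

theorem X_space_CPP: "CPP X X"
  unfolding CPP_def
proof (intro allI impI, elim conjE)
  fix T K
  assume T: "bounded_op X X T" and K: "compact_op X X K"
    and less: "opnorm X X T < opnorm X X (\<lambda>x. T x + K x)"
  define S where "S = (\<lambda>x. T x + K x)"
  have Kb: "bounded_op X X K" using K unfolding compact_op_def by (elim conjE)
  have S: "bounded_op X X S" unfolding S_def by (rule bounded_op_plus[OF T Kb])
  let ?L = "opnorm X X S" and ?t = "opnorm X X T"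
  have tL: "?t < ?L" using less by (simp only: S_def)
  have t0: "0 \<le> ?t" by (rule opX_nonneg[OF T])
  obtain s where sb: "\<And>n. s n \<in> ball_of X" and sL: "(\<lambda>n. P (S (s n))) \<longlonglongrightarrow> ?L"
    by (rule opnorm_approximating_sequence[OF S X_normed]) (rule that)
  have sl: "s n \<in> l2" and s1: "P (s n) \<le> 1" for n
    using sb[of n] by (simp_all add: ball_of_def X_vecs)
  have sC: "ip (s n) (s n) \<le> (1 / c)\<^sup>2" for n
    by (rule order_trans[OF ip_le_P[OF sl] power_mono[OF divide_right_mono[OF s1]]])
      (use c P_nonneg[OF sl] in auto)
  obtain r1 x where r1: "strict_mono r1" and x: "x \<in> l2" and w1: "wnull (\<lambda>n. s (r1 n) - x)"
    by (rule l2_bounded_decompose[OF sl sC])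
  obtain r2 where r2: "strict_mono r2" and K2: "(\<lambda>n. P (K (s (r1 (r2 n)) - x))) \<longlonglongrightarrow> 0"
    by (rule compact_op_wnull[OF K sb x w1])
  obtain r3 a where r3: "strict_mono r3"
    and a3: "(\<lambda>n. ip (s (r1 (r2 (r3 n))) - x) (s (r1 (r2 (r3 n))) - x)) \<longlonglongrightarrow> a"
    by (rule wnull_norm_convergent_subseq[OF wnull_subseq[OF w1 r2]])
  obtain r4 b where r4: "strict_mono r4"
    and b4: "(\<lambda>n. ip (T (s (r1 (r2 (r3 (r4 n)))) - x)) (T (s (r1 (r2 (r3 (r4 n)))) - x))) \<longlonglongrightarrow> b"
    by (rule wnull_norm_convergent_subseq[OF opX_wnull[OF T wnull_subseq[OF wnull_subseq[OF w1 r2] r3]]])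
  define w where "w = (\<lambda>n. s (r1 (r2 (r3 (r4 n)))) - x)"
  have r34: "strict_mono (\<lambda>n. r3 (r4 n))" using strict_mono_o[OF r3 r4] by (simp only: o_def)
  have r234: "strict_mono (\<lambda>n. r2 (r3 (r4 n)))" using strict_mono_o[OF r2 r34] by (simp only: o_def)
  have r: "strict_mono (\<lambda>n. r1 (r2 (r3 (r4 n))))" using strict_mono_o[OF r1 r234] by (simp only: o_def)
  have w: "wnull w" unfolding w_def by (rule wnull_subseq[OF w1 r234])
  have xw: "x + w n = s (r1 (r2 (r3 (r4 n))))" for n by (simp add: w_def)
  have wa: "(\<lambda>n. ip (w n) (w n)) \<longlonglongrightarrow> a"
    using LIMSEQ_subseq_LIMSEQ[OF a3 r4] by (simp only: w_def o_def)
  have wb: "(\<lambda>n. ip (T (w n)) (T (w n))) \<longlonglongrightarrow> b" using b4 by (simp only: w_def)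
  have wK: "(\<lambda>n. P (K (w n))) \<longlonglongrightarrow> 0"
    using LIMSEQ_subseq_LIMSEQ[OF K2 r34] by (simp only: w_def o_def)
  have xw1: "P (x + w n) \<le> 1" for n unfolding xw by (rule s1)
  have SL: "(\<lambda>n. P (S x + S (w n))) \<longlonglongrightarrow> ?L"
    using LIMSEQ_subseq_LIMSEQ[OF sL r]
    unfolding opX_add[OF S x wnullD[OF w], symmetric] xw by (simp only: o_def)
  have lower: "(P x)\<^sup>2 + c\<^sup>2 * a \<le> 1"
    by (rule P_sq_asymptotic_lower[OF x w wa xw1])
  have contraction: "b \<le> ?t\<^sup>2 * a" by (rule asymptotic_contraction[OF T w wa wb])
  have a0: "0 \<le> a"
    by (rule LIMSEQ_le_const[OF wa]) (use ip_nonneg[OF wnullD[OF w]] in \<open>intro exI[of _ 0] allI impI\<close>)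
  have upper: "?L\<^sup>2 \<le> (P (S x))\<^sup>2 + c\<^sup>2 * b"
  proof (rule P_sq_asymptotic_upper[OF opX_l2[OF S x] opX_wnull[OF S w] _ SL])
    show "(\<lambda>n. ip (S (w n)) (S (w n))) \<longlonglongrightarrow> b"
      unfolding S_def by (rule ip_perturbation_tendsto[OF opX_wnull[OF T w] wb opX_l2[OF Kb wnullD[OF w]] wK])
    show "0 \<le> (?t + ?L) / 2" "(?t + ?L) / 2 < ?L" using t0 tL by auto
    define d where "d = ?t + 1"
    \<comment> \<open>chosen such that \<open>?t * (1 + e) + e\<close> is the midpoint of \<open>?t\<close> and \<open>?L\<close>\<close>
    define e where "e = (?L - ?t) / (2 * d)"
    have d: "0 < d" using t0 by (simp add: d_def)
    then have e0: "0 < e" using tL by (simp add: e_def)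
    have "e * d = (?L - ?t) / 2" using d by (simp add: e_def)
    then have e: "0 < e" "?t * (1 + e) + e = (?t + ?L) / 2"
      using e0 by (simp_all add: d_def algebra_simps)
    have "\<forall>\<^sub>F n in sequentially. P (K (w n)) < e"
      using wK e(1) by (rule order_tendstoD(2))
    then show "\<forall>\<^sub>F n in sequentially. P (S (w n)) \<le> (?t + ?L) / 2"
      using P_wnull_eventually_le[OF x w xw1 e(1)]
    proof eventually_elim
      case (elim n)
      note wl = wnullD[OF w, of n]
      have "P (S (w n)) \<le> P (T (w n)) + P (K (w n))"
        unfolding S_def by (rule P_add[OF opX_l2[OF T wl] opX_l2[OF Kb wl]])
      also have "P (T (w n)) \<le> ?t * (1 + e)"
        by (rule order_trans[OF opX_bound[OF T wl] mult_left_mono[OF elim(2) t0]])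
      finally show ?case using elim(1) e(2) by linarith
    qed
  qed
  have L2: "?t\<^sup>2 < ?L\<^sup>2" using t0 tL by (intro power_strict_mono) auto
  have cb: "c\<^sup>2 * b \<le> ?t\<^sup>2 * (c\<^sup>2 * a)"
    using mult_left_mono[OF contraction, of "c\<^sup>2"] by (simp add: mult_ac)
  have x0: "x \<noteq> 0"
  proof
    assume "x = 0"
    have "0 = (0::real) *\<^sub>R x" by simp
    then have "S x = 0" using opX_scale[OF S x, of 0] \<open>x = 0\<close> by simp
    then have "P (S x) = 0" using P_eq_0[OF zero_l2] by simp
    then have "?L\<^sup>2 \<le> ?t\<^sup>2 * (c\<^sup>2 * a)" using upper cb by simp
    also have "\<dots> \<le> ?t\<^sup>2 * 1"
    proof (rule mult_left_mono)
      show "c\<^sup>2 * a \<le> 1" using lower zero_le_power2[of "P x"] by linarith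
    qed simp
    finally show False using L2 by simp
  qed
  have "?L\<^sup>2 * (P x)\<^sup>2 \<le> (P (S x))\<^sup>2"
  proof -
    have "?L\<^sup>2 * (P x)\<^sup>2 \<le> ?L\<^sup>2 * (1 - c\<^sup>2 * a)"
      using lower by (intro mult_left_mono) auto
    moreover have "?t\<^sup>2 * (c\<^sup>2 * a) \<le> ?L\<^sup>2 * (c\<^sup>2 * a)"
      using L2 a0 by (intro mult_right_mono) auto
    ultimately show ?thesis using upper cb by (simp add: right_diff_distrib)
  qed
  then have "(?L * P x)\<^sup>2 \<le> (P (S x))\<^sup>2" by (simp only: power_mult_distrib)
  then have ge: "?L * P x \<le> P (S x)"
    by (rule power2_le_imp_le) (rule P_nonneg[OF opX_l2[OF S x]])
  have px: "0 < P x" using P_nonneg[OF x] P_eq_0[OF x] x0 by simp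
  define u where "u = (1 / P x) *\<^sub>R x"
  have u: "u \<in> l2" "P u = 1"
    unfolding u_def using P_scale[OF x, of "1 / P x"] px l2_scale[OF x] by simp_all
  have "P (S u) = P (S x) / P x"
    unfolding u_def opX_scale[OF S x] P_scale[OF opX_l2[OF S x]] using px by simp
  then have "?L \<le> P (S u)" using ge px by (simp add: le_divide_eq)
  moreover have "P (S u) \<le> ?L" using opX_bound[OF S u(1)] u(2) by simp
  ultimately show "attains_norm X X (\<lambda>x. T x + K x)"
    unfolding attains_norm_def S_def[symmetric] sphere_of_def X_vecs
    using u by (intro bexI[of _ u]) auto
qed

section \<open>Failure of the weak maximizing property\<close>

definition diag_op :: "(nat \<Rightarrow> real) \<Rightarrow> nat \<Rightarrow> real" where
  "diag_op x = (\<lambda>j. real j / (real j + 1) * x j)"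

lemma diag_op_abs: "\<bar>diag_op x j\<bar> = real j / (real j + 1) * \<bar>x j\<bar>"
  by (simp add: diag_op_def abs_mult)

lemma diag_op_abs_le: "\<bar>diag_op x j\<bar> \<le> \<bar>x j\<bar>"
  unfolding diag_op_abs by (rule mult_left_le_one_le) auto

lemma diag_op_l2: "x \<in> l2 \<Longrightarrow> diag_op x \<in> l2"
  by (rule l2_dominated[OF _ diag_op_abs_le])

lemma P_diag_op_le: "x \<in> l2 \<Longrightarrow> P (diag_op x) \<le> P x"
  by (rule P_mono_abs[OF diag_op_l2 _ diag_op_abs_le])

lemma diag_op_bounded: "bounded_op X X diag_op"
  unfolding bounded_op_def X_vecs
proof (intro conjI ballI allI exI)
  fix x assume x: "x \<in> l2"
  show "diag_op x \<in> l2" by (rule diag_op_l2[OF x])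
  show "P (diag_op x) \<le> 1 * P x" using P_diag_op_le[OF x] by simp
  show "diag_op (x + y) = diag_op x + diag_op y" for y
    by (simp add: diag_op_def fun_eq_iff distrib_left)
  show "diag_op (a *\<^sub>R x) = a *\<^sub>R diag_op x" for a
    by (simp add: diag_op_def fun_eq_iff)
qed

text \<open>
  Up to a large index \<open>m\<close> the entries of the diagonal are at most some \<open>l < 1\<close>. So \<open>diag_op x\<close> is
  dominated by the convex combination of \<open>x\<close> and its tail after \<open>m\<close> with weights \<open>l\<close> and
  \<open>1 - l\<close>, and the tail is shorter than \<open>x\<close>. This gives strictness although the entries tend to \<open>1\<close>.
\<close>

lemma P_diag_op_less:
  assumes x: "x \<in> l2" "x \<noteq> 0"
  shows "P (diag_op x) < P x"
proof -
  have px: "0 < P x" using P_nonneg[OF x(1)] P_eq_0[OF x(1)] x(2) by simp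
  then have "\<forall>\<^sub>F m in sequentially. P (x - trunc m x) < P x"
    by (intro order_tendstoD(2)[OF P_tail_tendsto_0[OF x(1)]])
  then obtain m where m: "P (x - trunc m x) < P x" by (rule sequentially_exE)
  define l where "l = real m / (real m + 1)"
  have l: "0 \<le> l" "l < 1" by (auto simp: l_def)
  note t = tail_l2[OF x(1), of m]
  define z where "z = l *\<^sub>R x + (1 - l) *\<^sub>R (x - trunc m x)"
  have z: "z \<in> l2" unfolding z_def by (rule l2_add[OF l2_scale[OF x(1)] l2_scale[OF t]])
  have "\<bar>diag_op x j\<bar> \<le> \<bar>z j\<bar>" for j
  proof (cases "j \<le> m")
    case True
    then have "real j / (real j + 1) \<le> l" by (simp add: l_def field_simps)
    then have "real j / (real j + 1) * \<bar>x j\<bar> \<le> l * \<bar>x j\<bar>" by (rule mult_right_mono) simp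
    also have "\<dots> = \<bar>z j\<bar>" using True l by (simp add: z_def trunc_def abs_mult)
    finally show ?thesis by (simp only: diag_op_abs)
  next
    case False
    then have "z j = x j" by (simp add: z_def trunc_def algebra_simps)
    then show ?thesis using diag_op_abs_le[of x j] by simp
  qed
  then have "P (diag_op x) \<le> P z" by (rule P_mono_abs[OF diag_op_l2[OF x(1)] z])
  also have "\<dots> \<le> P (l *\<^sub>R x) + P ((1 - l) *\<^sub>R (x - trunc m x))"
    unfolding z_def by (rule P_add[OF l2_scale[OF x(1)] l2_scale[OF t]])
  also have "\<dots> = l * P x + (1 - l) * P (x - trunc m x)"
    using l P_scale[OF x(1)] P_scale[OF t] by simp
  also have "\<dots> < l * P x + (1 - l) * P x"
    using l m by (intro add_strict_left_mono mult_strict_left_mono) auto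
  finally show ?thesis by (simp add: algebra_simps)
qed

text \<open>
  The coefficient of \<open>e\<^sub>0\<close> is the largest one that the limiting norm cannot see: with
  \<open>s\<^sup>2 = 1 - c\<^sup>2\<close> and \<open>t = 1\<close> the two alternatives \<open>\<bar>t\<bar>\<close> and \<open>sqrt (s\<^sup>2 + c\<^sup>2 t\<^sup>2)\<close> both equal \<open>1\<close>.
\<close>

definition spread :: "nat \<Rightarrow> nat \<Rightarrow> real" where
  "spread n = (\<lambda>j. if j = 0 then sqrt (1 - c\<^sup>2) else if j = n then 1 else 0)"

lemma spread_l2: "spread n \<in> l2"
  by (rule finite_support_l2[of n]) (simp add: spread_def)

lemma one_minus_c2_pos: "0 < 1 - c\<^sup>2"
  using c by (simp add: power_less_one_iff)

lemma P_spread: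
  assumes n: "1 \<le> n"
  shows "1 \<le> P (spread n)" "P (spread n) \<le> root n 2"
proof -
  have "trunc n (spread n) = spread n" by (auto simp: trunc_def spread_def fun_eq_iff)
  then have eq: "P (spread n) = M n (spread n)"
    using P_trunc[of n "spread n"] by simp
  have below: "M k (spread n) = sqrt (1 - c\<^sup>2)" if "k < n" for k
    using that
  proof (induction k)
    case 0
    then show ?case using one_minus_c2_pos by (simp add: spread_def)
  next
    case (Suc k)
    then show ?case
      using abs_normalized_norm_axes(1)[OF Nc_norm, of k "sqrt (1 - c\<^sup>2)"] one_minus_c2_pos
      by (simp add: spread_def)
  qed
  obtain k where k: "n = Suc k" using n by (cases n) auto
  have last: "spread n n = 1" using n by (simp add: spread_def)
  have "M (Suc k) (spread n) = Nc c (Suc k) (sqrt (1 - c\<^sup>2)) \<bar>spread n (Suc k)\<bar>"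
    using below[of k] k by (simp only: iter_norm.simps lessI)
  then have N: "P (spread n) = Nc c n (sqrt (1 - c\<^sup>2)) 1"
    unfolding eq k[symmetric] last by simp
  have "(sqrt (1 - c\<^sup>2))\<^sup>2 + c\<^sup>2 * 1\<^sup>2 = 1" using one_minus_c2_pos by simp
  then have pow: "((P (spread n))\<^sup>2) ^ n = (1 - c ^ (2 * n)) + 1"
    unfolding N Nc_power[OF c n] by (simp only: power_one mult_1_right)
  have "1\<^sup>2 \<le> (P (spread n))\<^sup>2"
    using M_sq_coord[of "spread n" n] unfolding last eq .
  then show ge: "1 \<le> P (spread n)"
    by (rule power2_le_imp_le) (rule P_nonneg[OF spread_l2])
  have "0 \<le> c ^ (2 * n)" using c by simp
  then have "((P (spread n))\<^sup>2) ^ n \<le> 2" using pow by linarith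
  then have "root n (((P (spread n))\<^sup>2) ^ n) \<le> root n 2" using n by (intro real_root_le_mono) auto
  moreover have "root n (((P (spread n))\<^sup>2) ^ n) = (P (spread n))\<^sup>2"
    using n by (intro real_root_power_cancel) auto
  ultimately have "(P (spread n))\<^sup>2 \<le> root n 2" by simp
  moreover have "P (spread n) * 1 \<le> P (spread n) * P (spread n)"
    using ge by (intro mult_left_mono) auto
  ultimately show "P (spread n) \<le> root n 2" by (simp add: power2_eq_square)
qed

lemma P_spread_tendsto: "(\<lambda>n. P (spread (Suc n))) \<longlonglongrightarrow> 1"
proof (rule tendsto_sandwich[OF _ _ tendsto_const])
  show "(\<lambda>n. root (Suc n) 2) \<longlonglongrightarrow> 1" by (rule LIMSEQ_Suc[OF LIMSEQ_root_const]) simp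
qed (intro always_eventually allI P_spread; simp)+

theorem X_space_not_WMP: "\<not> WMP X X"
proof
  assume WMP: "WMP X X"
  define s where "s n = (1 / P (spread (Suc n))) *\<^sub>R spread (Suc n)" for n
  have p1: "1 \<le> P (spread (Suc n))" for n by (rule P_spread) simp
  have sl: "s n \<in> l2" for n unfolding s_def by (rule l2_scale[OF spread_l2])
  have s1: "P (s n) = 1" for n
    unfolding s_def P_scale[OF spread_l2] using p1[of n] by simp
  have Ds: "(\<lambda>n. P (diag_op (s n))) \<longlonglongrightarrow> 1"
  proof (rule tendsto_sandwich[OF _ _ _ tendsto_const])
    have "(\<lambda>n. (1 - inverse (real (Suc (Suc n)))) / P (spread (Suc n))) \<longlonglongrightarrow> (1 - 0) / 1"
      by (intro tendsto_intros P_spread_tendsto LIMSEQ_Suc[OF LIMSEQ_inverse_real_of_nat]) simp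
    then show "(\<lambda>n. (1 - inverse (real (Suc (Suc n)))) / P (spread (Suc n))) \<longlonglongrightarrow> 1" by simp
    have "(1 - inverse (real (Suc (Suc n)))) / P (spread (Suc n)) \<le> P (diag_op (s n))" for n
    proof -
      have "\<bar>diag_op (s n) (Suc n)\<bar> = (1 - inverse (real (Suc (Suc n)))) / P (spread (Suc n))"
        unfolding diag_op_abs using p1[of n] by (simp add: s_def spread_def field_simps)
      then show ?thesis using coord_le_P[OF diag_op_l2[OF sl[of n]], of "Suc n"] by simp
    qed
    then show "\<forall>\<^sub>F n in sequentially. (1 - inverse (real (Suc (Suc n)))) / P (spread (Suc n))
        \<le> P (diag_op (s n))"
      by (rule always_eventually[OF allI])
    show "\<forall>\<^sub>F n in sequentially. P (diag_op (s n)) \<le> 1"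
      using P_diag_op_le[OF sl] s1 by (intro always_eventually allI) simp
  qed
  have norm1: "opnorm X X diag_op = 1"
  proof (rule antisym)
    show "opnorm X X diag_op \<le> 1"
      by (rule opnorm_le[OF X_normed])
        (use P_diag_op_le order_trans in \<open>auto simp: ball_of_def X_vecs\<close>)
    show "1 \<le> opnorm X X diag_op"
      by (rule LIMSEQ_le_const2[OF Ds])
        (use opX_bound[OF diag_op_bounded sl] s1 in \<open>intro exI[of _ 0] allI impI; simp\<close>)
  qed
  have "maximizing X X diag_op s"
    unfolding maximizing_def sphere_of_def norm1 X_vecs using sl s1 Ds by simp
  moreover have "\<not> weakly_null X s"
  proof
    assume wn: "weakly_null X s"
    define f where "f = (\<lambda>x :: nat \<Rightarrow> real. if x \<in> l2 then x 0 else 0)"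
    have "bounded_op X real_line f"
      unfolding bounded_op_def X_vecs
    proof (intro conjI ballI allI exI)
      fix x assume x: "x \<in> l2"
      show "f x \<in> vecs real_line" by (simp add: real_line_def)
      show "nm real_line (f x) \<le> 1 * P x"
        using coord_le_P[OF x, of 0] x by (simp add: f_def real_line_def)
      show "f (a *\<^sub>R x) = a *\<^sub>R f x" for a using x l2_scale[OF x, of a] by (simp add: f_def)
      fix y assume y: "y \<in> l2"
      show "f (x + y) = f x + f y" using x y l2_add[OF x y] by (simp add: f_def)
    qed
    then have "f \<in> vecs (dual X)" by (simp add: dual_def f_def X_vecs)
    then have "(\<lambda>n. f (s n)) \<longlonglongrightarrow> 0" using wn unfolding weakly_null_def by (rule bspec[rotated])
    moreover have "(\<lambda>n. sqrt (1 - c\<^sup>2) / P (spread (Suc n))) \<longlonglongrightarrow> sqrt (1 - c\<^sup>2) / 1"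
      by (intro tendsto_intros P_spread_tendsto) simp
    moreover have "f (s n) = sqrt (1 - c\<^sup>2) / P (spread (Suc n))" for n
      using sl[of n] by (simp add: f_def) (simp add: s_def spread_def)
    ultimately have "sqrt (1 - c\<^sup>2) = 0" using LIMSEQ_unique by fastforce
    then show False using one_minus_c2_pos by simp
  qed
  ultimately have "attains_norm X X diag_op"
    using WMP diag_op_bounded unfolding WMP_def by metis
  then obtain x where x: "x \<in> l2" "P x = 1" "P (diag_op x) = 1"
    unfolding attains_norm_def norm1 sphere_of_def X_vecs by auto
  then have "x \<noteq> 0" using P_eq_0[OF x(1)] by auto
  then show False using P_diag_op_less[OF x(1)] x by simp
qed

section \<open>Reflexivity and distance to \<open>\<ell>\<^sub>2\<close>\<close>

lemma bounded_functional_ell2: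
  assumes "bounded_op X real_line f"
  shows "bounded_op ell2 real_line f"
proof -
  obtain B where B: "0 \<le> B" "\<And>x. x \<in> vecs X \<Longrightarrow> nm real_line (f x) \<le> B * P x"
    by (rule bounded_op_boundE[OF assms X_normed]) (rule that)
  have "nm real_line (f x) \<le> B * nm ell2 x" if x: "x \<in> l2" for x
    using B(2)[of x] mult_left_mono[OF P_le_sqrt[OF x] B(1)] x
    by (simp add: X_vecs nm_ell2)
  then show ?thesis
    using assms unfolding bounded_op_def X_vecs by (intro conjI exI[of _ B] ballI) auto
qed

text \<open>
  Extended by \<open>0\<close> like the elements of \<open>dual\<close>.
\<close>

definition ip_functional :: "(nat \<Rightarrow> real) \<Rightarrow> (nat \<Rightarrow> real) \<Rightarrow> real" where
  "ip_functional a = (\<lambda>x. if x \<in> l2 then ip a x else 0)"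

lemma ip_functional_bound:
  assumes "a \<in> l2" "x \<in> l2"
  shows "\<bar>ip a x\<bar> \<le> sqrt (ip a a) / c * P x"
proof -
  have "sqrt (ip x x) \<le> P x / c" using sqrt_le_P[OF assms(2)] c by (simp add: le_divide_eq mult.commute)
  then have "sqrt (ip a a) * sqrt (ip x x) \<le> sqrt (ip a a) * (P x / c)"
    using ip_nonneg[OF assms(1)] by (intro mult_left_mono) auto
  then show ?thesis using ip_Cauchy_Schwarz[OF assms] by simp
qed

lemma ip_functional_dual:
  assumes a: "a \<in> l2"
  shows "ip_functional a \<in> vecs (dual X)"
proof -
  have "bounded_op X real_line (ip_functional a)"
    unfolding bounded_op_def X_vecs
  proof (intro conjI ballI allI exI)
    fix x assume x: "x \<in> l2"
    show "ip_functional a x \<in> vecs real_line" by (simp add: real_line_def)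
    show "nm real_line (ip_functional a x) \<le> sqrt (ip a a) / c * P x"
      using ip_functional_bound[OF a x] x by (simp add: ip_functional_def real_line_def)
    show "ip_functional a (r *\<^sub>R x) = r *\<^sub>R ip_functional a x" for r
      using x l2_scale[OF x, of r] ip_scale[OF x a, of r] ip_commute[of a x] ip_commute[of a "r *\<^sub>R x"]
      by (simp add: ip_functional_def)
    fix y assume y: "y \<in> l2"
    show "ip_functional a (x + y) = ip_functional a x + ip_functional a y"
      using x y l2_add[OF x y] ip_add[OF x y a] ip_commute[of a x] ip_commute[of a y] ip_commute[of a "x + y"]
      by (simp add: ip_functional_def)
  qed
  then show ?thesis by (simp add: dual_def ip_functional_def X_vecs)
qed

lemma ip_functional_norm_le:
  assumes a: "a \<in> l2"
  shows "nm (dual X) (ip_functional a) \<le> sqrt (ip a a) / c"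
  unfolding dual_def nspace.simps
proof (rule opnorm_le[OF X_normed])
  fix x assume "x \<in> ball_of X"
  then have x: "x \<in> l2" "P x \<le> 1" by (simp_all add: ball_of_def X_vecs)
  have "sqrt (ip a a) / c * P x \<le> sqrt (ip a a) / c * 1"
    using x(2) c ip_nonneg[OF a] by (intro mult_left_mono) auto
  then show "nm real_line (ip_functional a x) \<le> sqrt (ip a a) / c"
    using ip_functional_bound[OF a x(1)] x(1) by (simp add: ip_functional_def real_line_def)
qed

lemma dual_representation:
  assumes "f \<in> vecs (dual X)"
  obtains a where "a \<in> l2" "f = ip_functional a"
proof -
  have f: "bounded_op X real_line f" and f0: "\<forall>x. x \<notin> l2 \<longrightarrow> f x = 0"
    using assms by (simp_all add: dual_def X_vecs)
  obtain a where a: "a \<in> l2" "\<And>x. x \<in> l2 \<Longrightarrow> f x = ip a x"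
    by (rule riesz_ell2[OF bounded_functional_ell2[OF f]]) (rule that)
  have "f = ip_functional a"
    using a(2) f0 by (auto simp: ip_functional_def fun_eq_iff)
  with a(1) show ?thesis by (rule that)
qed

text \<open>
  The dual is \<open>\<ell>\<^sub>2\<close> by the Riesz representation and norm equivalence. A functional on the dual thus
  becomes a functional on \<open>\<ell>\<^sub>2\<close>, and a second use of the representation gives the vector.
\<close>

theorem X_space_reflexive: "reflexive X"
  unfolding reflexive_def X_vecs
proof (intro allI impI)
  fix \<phi> assume phi: "bounded_op (dual X) real_line \<phi>"
  obtain B where "\<forall>f\<in>vecs (dual X). \<bar>\<phi> f\<bar> \<le> B * nm (dual X) f"
    using phi unfolding bounded_op_def real_line_def nspace.simps by (elim conjE exE)
  then have B: "\<bar>\<phi> f\<bar> \<le> B * nm (dual X) f" if "f \<in> vecs (dual X)" for f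
    using that by (rule bspec)
  have "bounded_op ell2 real_line (\<lambda>a. \<phi> (ip_functional a))"
    unfolding bounded_op_def
  proof (intro conjI ballI allI exI)
    fix a assume a: "a \<in> l2"
    show "\<phi> (ip_functional a) \<in> vecs real_line" by (simp add: real_line_def)
    have "\<bar>\<phi> (ip_functional a)\<bar> \<le> B * nm (dual X) (ip_functional a)" by (rule B[OF ip_functional_dual[OF a]])
    also have "\<dots> \<le> \<bar>B\<bar> * (sqrt (ip a a) / c)"
    proof (rule mult_mono)
      have "0 \<in> ball_of X" by (rule zero_in_ball[OF X_normed])
      have "bounded_op X real_line (ip_functional a)"
        using ip_functional_dual[OF a] by (simp add: dual_def)
      from opnorm_ge[OF this X_normed \<open>0 \<in> ball_of X\<close>]
      show "0 \<le> nm (dual X) (ip_functional a)" by (simp add: dual_def real_line_def)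
    qed (use ip_functional_norm_le[OF a] in auto)
    finally show "nm real_line (\<phi> (ip_functional a)) \<le> \<bar>B\<bar> / c * nm ell2 a"
      by (simp add: real_line_def nm_ell2)
    have "ip_functional (r *\<^sub>R a) = r *\<^sub>R ip_functional a" for r
      using ip_scale[OF a] by (auto simp: ip_functional_def fun_eq_iff)
    then show "\<phi> (ip_functional (r *\<^sub>R a)) = r *\<^sub>R \<phi> (ip_functional a)" for r
      using bounded_opD(3)[OF phi ip_functional_dual[OF a]] by simp
    fix b assume b: "b \<in> l2"
    have "ip_functional (a + b) = ip_functional a + ip_functional b"
      using ip_add[OF a b] by (auto simp: ip_functional_def fun_eq_iff)
    then show "\<phi> (ip_functional (a + b)) = \<phi> (ip_functional a) + \<phi> (ip_functional b)"
      using bounded_opD(2)[OF phi ip_functional_dual[OF a] ip_functional_dual[OF b]] by simp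
  qed
  then obtain x where x: "x \<in> l2" "\<And>a. a \<in> l2 \<Longrightarrow> \<phi> (ip_functional a) = ip x a"
    by (rule riesz_ell2) (rule that)
  have "\<phi> f = f x" if f: "f \<in> vecs (dual X)" for f
  proof -
    obtain a where a: "a \<in> l2" "f = ip_functional a" using f by (rule dual_representation)
    show ?thesis unfolding a(2) x(2)[OF a(1)] using x(1) by (simp add: ip_functional_def ip_commute)
  qed
  then show "\<exists>x\<in>l2. \<forall>f\<in>vecs (dual X). \<phi> f = f x" using x(1) by (intro bexI ballI)
qed

lemma inv_id_l2: "x \<in> l2 \<Longrightarrow> inv_into l2 id x = x"
  using inv_into_f_f[of id l2 x] by simp

lemma id_bounded: "bounded_op X ell2 id"
  unfolding bounded_op_def X_vecs id_apply
proof (intro conjI ballI allI exI)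
  fix x assume x: "x \<in> l2"
  show "nm ell2 x \<le> 1 / c * P x"
    using sqrt_le_P[OF x] c by (simp add: nm_ell2 le_divide_eq mult.commute)
qed simp_all

lemma id_isomorphism: "isomorphism X ell2 id"
  unfolding isomorphism_def
proof (intro conjI id_bounded)
  show "bij_betw id (vecs X) l2" by (simp add: X_vecs)
  show "bounded_op ell2 X (inv_into (vecs X) id)"
    unfolding bounded_op_def X_vecs
  proof (intro conjI ballI allI exI)
    fix x assume x: "x \<in> l2"
    show "inv_into l2 id x \<in> l2" by (simp only: inv_id_l2[OF x] x)
    show "P (inv_into l2 id x) \<le> 1 * nm ell2 x"
      using P_le_sqrt[OF x] by (simp add: inv_id_l2[OF x] nm_ell2)
    show "inv_into l2 id (a *\<^sub>R x) = a *\<^sub>R inv_into l2 id x" for a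
      by (simp only: inv_id_l2[OF x] inv_id_l2[OF l2_scale[OF x]])
    fix y assume y: "y \<in> l2"
    show "inv_into l2 id (x + y) = inv_into l2 id x + inv_into l2 id y"
      by (simp only: inv_id_l2[OF x] inv_id_l2[OF y] inv_id_l2[OF l2_add[OF x y]])
  qed
qed

lemma banach_mazur_le: "banach_mazur X ell2 \<le> ereal (1 / c)"
proof -
  let ?p = "opnorm X ell2 id" and ?q = "opnorm ell2 X (inv_into (vecs X) id)"
  have "0 \<le> nm ell2 (id 0)" using ip_nonneg[OF zero_l2] by (simp add: nm_ell2)
  then have p0: "0 \<le> ?p"
    using opnorm_ge[OF id_bounded X_normed zero_in_ball[OF X_normed]] by linarith
  have p: "?p \<le> 1 / c"
  proof (rule opnorm_le[OF X_normed])
    fix x assume "x \<in> ball_of X"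
    then have x: "x \<in> l2" "P x \<le> 1" by (simp_all add: ball_of_def X_vecs)
    have "c * sqrt (ip x x) \<le> 1" using sqrt_le_P[OF x(1)] x(2) by linarith
    then show "nm ell2 (id x) \<le> 1 / c" using c by (simp add: nm_ell2 le_divide_eq mult.commute)
  qed
  have q: "?q \<le> 1"
    unfolding opnorm_def X_vecs
  proof (rule cSUP_least)
    have "nm ell2 0 = 0" by (simp add: nm_ell2 ip_def)
    then have "0 \<in> ball_of ell2" using zero_l2 by (simp add: ball_of_def)
    then show "ball_of ell2 \<noteq> {}" by auto
    fix x assume "x \<in> ball_of ell2"
    then have x: "x \<in> l2" "sqrt (ip x x) \<le> 1" by (simp_all add: ball_of_def nm_ell2)
    show "P (inv_into l2 id x) \<le> 1"
      unfolding inv_id_l2[OF x(1)] using P_le_sqrt[OF x(1)] x(2) by linarith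
  qed
  have "?p * ?q \<le> 1 / c" using mult_left_mono[OF q p0] p by linarith
  moreover have "banach_mazur X ell2 \<le> ereal (?p * ?q)"
    unfolding banach_mazur_def by (rule INF_lower) (simp add: id_isomorphism)
  ultimately show ?thesis using order_trans ereal_less_eq(3) by metis
qed

end

section \<open>Counterexamples close to \<open>\<ell>\<^sub>2\<close>\<close>

theorem corollary5p6:
  shows "(\<forall>c::real. 0 < c \<and> c < 1 \<longrightarrow>
            CPP (X_space c) (X_space c) \<and> \<not> WMP (X_space c) (X_space c)) \<and>
         (\<exists>E :: (nat \<Rightarrow> real) nspace.
            banach_space E \<and> reflexive E \<and> isomorphic E ell2 \<and> CPP E E \<and> \<not> WMP E E) \<and>
         (\<forall>\<epsilon>::real. \<epsilon> > 0 \<longrightarrow>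
            (\<exists>E :: (nat \<Rightarrow> real) nspace.
               banach_space E \<and> reflexive E \<and> isomorphic E ell2 \<and>
               banach_mazur E ell2 < ereal (1 + \<epsilon>) \<and> CPP E E \<and> \<not> WMP E E))"
proof -
  have main: "CPP (X_space c) (X_space c) \<and> \<not> WMP (X_space c) (X_space c)"
    and space: "banach_space (X_space c)" "reflexive (X_space c)" "isomorphic (X_space c) ell2"
    if c: "0 < c" "c < 1" for c
  proof -
    show "CPP (X_space c) (X_space c) \<and> \<not> WMP (X_space c) (X_space c)"
      using X_space_CPP[OF c] X_space_not_WMP[OF c] by (rule conjI)
    show "banach_space (X_space c)" by (rule X_banach[OF c])
    show "reflexive (X_space c)" by (rule X_space_reflexive[OF c])
    show "isomorphic (X_space c) ell2"
      unfolding isomorphic_def by (rule exI[of _ id]) (rule id_isomorphism[OF c])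
  qed
  have close: "\<exists>c. 0 < c \<and> c < 1 \<and> banach_mazur (X_space c) ell2 < ereal (1 + \<epsilon>)" if "\<epsilon> > 0" for \<epsilon> :: real
  proof -
    \<comment> \<open>then \<open>1 / c = 1 + \<epsilon> / 2\<close> leaves room for the strict inequality\<close>
    define c where "c = 1 / (1 + \<epsilon> / 2)"
    have c: "0 < c" "c < 1" "1 / c < 1 + \<epsilon>" using that by (auto simp: c_def)
    have "banach_mazur (X_space c) ell2 \<le> ereal (1 / c)" by (rule banach_mazur_le[OF c(1,2)])
    also have "\<dots> < ereal (1 + \<epsilon>)" using c(3) by simp
    finally show ?thesis using c by (intro exI[of _ c]) simp
  qed
  have half: "0 < (1 / 2 :: real)" "(1 / 2 :: real) < 1" by simp_all
  show ?thesis
  proof (intro conjI allI impI)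
    show "CPP (X_space c) (X_space c)" "\<not> WMP (X_space c) (X_space c)" if "0 < c \<and> c < 1" for c
      using main that by simp_all
    show "\<exists>E :: (nat \<Rightarrow> real) nspace.
        banach_space E \<and> reflexive E \<and> isomorphic E ell2 \<and> CPP E E \<and> \<not> WMP E E"
      by (intro exI[of _ "X_space (1 / 2)"] conjI space[OF half] main[OF half, THEN conjunct1]
          main[OF half, THEN conjunct2])
    fix \<epsilon> :: real assume "\<epsilon> > 0"
    then obtain c where c: "0 < c" "c < 1" and bm: "banach_mazur (X_space c) ell2 < ereal (1 + \<epsilon>)"
      using close by metis
    show "\<exists>E :: (nat \<Rightarrow> real) nspace. banach_space E \<and> reflexive E \<and> isomorphic E ell2 \<and>
        banach_mazur E ell2 < ereal (1 + \<epsilon>) \<and> CPP E E \<and> \<not> WMP E E"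
      by (intro exI[of _ "X_space c"] conjI space[OF c] bm main[OF c, THEN conjunct1]
          main[OF c, THEN conjunct2])
  qed
qed

end
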